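(* Let $d\ge1$, $0<\sigma<d/2$ and $1\le p,q\le\infty$ (with $\frac1\infty=0$). Define $$ R=\Big\{\big(\tfrac1p,\tfrac1q\big)\colon 0\le\tfrac1p\le1 \text{ and } 0\vee\big(\tfrac1p-\tfrac{2\sigma}d\big)\le\tfrac1q\le 1\wedge\big(\tfrac1p+\tfrac{2\sigma}d\big)\Big\}\Big\backslash\bigg(\Big\{\big(\tfrac1p,\tfrac1q\big)\colon 0\le\tfrac1p\le1-\tfrac{2\sigma}d \text{ and } \tfrac1q=\tfrac1p+\tfrac{2\sigma}d\Big\}\cup\Big\{\big(\tfrac{2\sigma}d,0\big),\big(1,1-\tfrac{2\sigma}d\big)\Big\}\bigg). $$ Then: (1) $\mathcal I^\sigma$ is bounded from $L^p(\mathbb{R}^d)$ to $L^q(\mathbb{R}^d)$ if and only if $(\frac1p,\frac1q)\in R$. (2) If $(\frac1p,\frac1q)\in[0,1]^2$ is not in the closure of $R$, then $\mathcal I^\sigma$ is not of restricted weak type $(p,q)$. (3) $\mathcal I^\sigma$ is of weak type $(p,q)$ for $(\frac1p,\frac1q)=(0,\frac{2\sigma}d)$ and for $(\frac1p,\frac1q)=(1,1-\frac{2\sigma}d)$. (4) For $(\frac1p,\frac1q)=(\frac{2\sigma}d,0)$, $\mathcal I^\sigma$ is of restricted weak type $(p,q)$ but not of weak type $(p,q)$.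
   Context: $\vee,\wedge$ denote maximum and minimum; $\|\cdot\|$ is the Euclidean norm on $\mathbb{R}^d$. For $t>0$ and $x,y\in\mathbb{R}^d$ let $$ G_t(x,y)=\big(2\pi\sinh(2t)\big)^{-d/2}\exp\Big(-\tfrac14\big[\tanh(t)\|x+y\|^2+\coth(t)\|x-y\|^2\big]\Big) $$ (the kernel of $\exp(-t\mathcal H)$, $\mathcal H=-\Delta+\|x\|^2$), and $$ \mathcal K^\sigma(x,y)=\frac1{\Gamma(\sigma)}\int_0^\infty G_t(x,y)\,t^{\sigma-1}\,dt,\qquad \mathcal I^\sigma f(x)=\int_{\mathbb{R}^d}\mathcal K^\sigma(x,y)f(y)\,dy. $$ The natural domain of $\mathcal I^\sigma$ consists of those $f$ for which the integral converges for a.e. $x$; it contains all $L^p(\mathbb{R}^d)$, $1\le p\le\infty$. Let $T$ be an operator defined on $L^p(\mathbb{R}^d)$, $1\le p\le\infty$, with values in measurable functions on $\mathbb{R}^d$. For $1\le q<\infty$, $T$ is of weak type $(p,q)$ if there is $C>0$ such that $|\{x\in\mathbb{R}^d\colon|Tf(x)|>\lambda\}|\le C(\|f\|_p/\lambda)^q$ for all $f\in L^p(\mathbb{R}^d)$ and $\lambda>0$; it is of restricted weak type $(p,q)$ if this inequality holds (with a uniform $C$) for all $f=\chi_E$, $E\subset\mathbb{R}^d$ measurable of finite measure, and all $\lambda>0$. For $q=\infty$, weak type $(p,\infty)$ means $\|Tf\|_\infty\le C\|f\|_p$ for all $f\in L^p(\mathbb{R}^d)$, and restricted weak type $(p,\infty)$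 means that this holds (with a uniform $C$) for all $f=\chi_E$ with $E$ measurable of finite measure. *)

theory Defs
  imports "HOL-Probability.Probability"
begin

definition hermite_heat_kernel :: "real \<Rightarrow> real^'n \<Rightarrow> real^'n \<Rightarrow> real" where
  "hermite_heat_kernel t x y =
     (2 * pi * sinh (2 * t)) powr (- real CARD('n) / 2) *
     exp (- (1 / 4) * (tanh t * (norm (x + y))\<^sup>2 + (cosh t / sinh t) * (norm (x - y))\<^sup>2))"

text \<open>For \<open>0 < \<sigma> < d/2\<close> the integral converges exactly when \<open>x \<noteq> y\<close>; on the diagonal, where it
  is infinite, the Bochner integral returns \<open>0\<close>.  For fixed \<open>x\<close> this concerns a single \<open>y\<close> and
  is not seen by the operator below.\<close>

definition potential_kernel :: "real \<Rightarrow> real^'n \<Rightarrow> real^'n \<Rightarrow> real" where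
  "potential_kernel \<sigma> x y =
     1 / Gamma \<sigma> * (LINT t:{0<..}|lborel. hermite_heat_kernel t x y * t powr (\<sigma> - 1))"

definition potential_operator :: "real \<Rightarrow> (real^'n \<Rightarrow> real) \<Rightarrow> real^'n \<Rightarrow> real" where
  "potential_operator \<sigma> f x = (LINT y|lebesgue. potential_kernel \<sigma> x y * f y)"

definition natural_domain :: "real \<Rightarrow> (real^'n \<Rightarrow> real) set" where
  "natural_domain \<sigma> = {f \<in> borel_measurable lebesgue.
     AE x in lebesgue. integrable lebesgue (\<lambda>y. potential_kernel \<sigma> x y * f y)}"

text \<open>Powers of extended nonnegative reals; used for positive real exponents only.\<close>

definition ennreal_rpow :: "ennreal \<Rightarrow> real \<Rightarrow> ennreal" where
  "ennreal_rpow u a = (if u = \<infinity> then \<infinity> else ennreal (enn2real u powr a))"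

definition Lp_norm :: "ennreal \<Rightarrow> (real^'n \<Rightarrow> real) \<Rightarrow> ennreal" where
  "Lp_norm p f =
     (if p = \<infinity> then esssup lebesgue (\<lambda>x. ennreal \<bar>f x\<bar>)
      else ennreal_rpow (\<integral>\<^sup>+x. ennreal (\<bar>f x\<bar> powr enn2real p) \<partial>lebesgue) (1 / enn2real p))"

definition Lp_space :: "ennreal \<Rightarrow> (real^'n \<Rightarrow> real) set" where
  "Lp_space p = {f \<in> borel_measurable lebesgue. Lp_norm p f < \<infinity>}"

definition bounded_Lp_Lq ::
    "((real^'n \<Rightarrow> real) \<Rightarrow> real^'n \<Rightarrow> real) \<Rightarrow> ennreal \<Rightarrow> ennreal \<Rightarrow> bool" where
  "bounded_Lp_Lq T p q \<longleftrightarrow>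
     (\<exists>C>0::real. \<forall>f\<in>Lp_space p. T f \<in> Lp_space q \<and> Lp_norm q (T f) \<le> ennreal C * Lp_norm p f)"

definition weak_type_bound ::
    "real \<Rightarrow> ((real^'n \<Rightarrow> real) \<Rightarrow> real^'n \<Rightarrow> real) \<Rightarrow> ennreal \<Rightarrow> ennreal \<Rightarrow> (real^'n \<Rightarrow> real) \<Rightarrow> bool" where
  "weak_type_bound C T p q f \<longleftrightarrow>
     (if q = \<infinity> then Lp_norm \<infinity> (T f) \<le> ennreal C * Lp_norm p f
      else \<forall>s>0. emeasure lebesgue {x. \<bar>T f x\<bar> > s} \<le>
             ennreal C * ennreal_rpow (Lp_norm p f / ennreal s) (enn2real q))"

definition weak_type ::
    "((real^'n \<Rightarrow> real) \<Rightarrow> real^'n \<Rightarrow> real) \<Rightarrow> ennreal \<Rightarrow> ennreal \<Rightarrow> bool" where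
  "weak_type T p q \<longleftrightarrow> (\<exists>C>0::real. \<forall>f\<in>Lp_space p. weak_type_bound C T p q f)"

definition restricted_weak_type ::
    "((real^'n \<Rightarrow> real) \<Rightarrow> real^'n \<Rightarrow> real) \<Rightarrow> ennreal \<Rightarrow> ennreal \<Rightarrow> bool" where
  "restricted_weak_type T p q \<longleftrightarrow>
     (\<exists>C>0::real. \<forall>E\<in>lmeasurable. weak_type_bound C T p q (indicat_real E))"

text \<open>The pair \<open>(1/p, 1/q)\<close>; in \<^typ>\<open>ennreal\<close>, \<open>1 / \<infinity> = 0\<close>.\<close>

definition reciprocal_pair :: "ennreal \<Rightarrow> ennreal \<Rightarrow> real \<times> real" where
  "reciprocal_pair p q = (enn2real (1 / p), enn2real (1 / q))"

definition boundedness_region :: "real \<Rightarrow> real \<Rightarrow> (real \<times> real) set" where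
  "boundedness_region d \<sigma> =
     {(u, v). 0 \<le> u \<and> u \<le> 1 \<and> max 0 (u - 2 * \<sigma> / d) \<le> v \<and> v \<le> min 1 (u + 2 * \<sigma> / d)} -
     ({(u, v). 0 \<le> u \<and> u \<le> 1 - 2 * \<sigma> / d \<and> v = u + 2 * \<sigma> / d} \<union>
      {(2 * \<sigma> / d, 0), (1, 1 - 2 * \<sigma> / d)})"

text \<open>\<open>L\<^sup>p\<close> is contained in the natural domain, for every \<open>1 \<le> p \<le> \<infinity>\<close>, and \<open>potential_operator\<close> maps
  measurable functions to measurable functions.  Hence on \<open>L\<^sup>p\<close> the value \<open>0\<close> that the Bochner integral
  gives to a divergent integral occurs only on a null set.  The proof dominates the kernel by
  dropping the \<open>tanh\<close> term from the exponent.\<close>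

lemma hermite_heat_kernel_le:
  fixes x y :: "real^'n"
  assumes t: "0 < t"
  shows "hermite_heat_kernel t x y \<le>
    (1 / cosh t) ^ CARD('n) *
    (\<Prod>b\<in>Basis. normal_density (x \<bullet> b) (sqrt (2 * tanh t)) (y \<bullet> b))"
proof -
  have pos: "sinh t > 0" "cosh t > 0" "tanh t > 0" "sinh (2 * t) > 0"
    using t by (auto simp: tanh_def)
  let ?s = "sqrt (2 * tanh t)"
  have s2: "?s\<^sup>2 = 2 * tanh t"
    using pos by simp
  have "(\<Sum>b\<in>Basis. (y \<bullet> b - x \<bullet> b)\<^sup>2) = (norm (x - y))\<^sup>2"
    unfolding power2_norm_eq_inner euclidean_inner[of "x - y" "x - y"]
    by (intro sum.cong) (simp_all add: inner_diff_left power2_eq_square algebra_simps)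
  then have e: "(\<Sum>b\<in>Basis. - (y \<bullet> b - x \<bullet> b)\<^sup>2 / (4 * tanh t)) =
      - (1 / 4) * ((cosh t / sinh t) * (norm (x - y))\<^sup>2)"
    using pos by (simp add: sum_divide_distrib[symmetric] sum_negf tanh_def field_simps
        flip: sum_distrib_left)
  have "(\<Prod>b\<in>Basis. normal_density (x \<bullet> b) ?s (y \<bullet> b)) =
      (\<Prod>b\<in>(Basis::(real^'n) set). 1 / sqrt (4 * pi * tanh t)) *
      (\<Prod>b\<in>Basis. exp (- (y \<bullet> b - x \<bullet> b)\<^sup>2 / (4 * tanh t)))"
    unfolding normal_density_def s2 prod.distrib[symmetric]
    by (intro prod.cong) (auto simp: algebra_simps)
  also have "(\<Prod>b\<in>Basis. exp (- (y \<bullet> b - x \<bullet> b)\<^sup>2 / (4 * tanh t))) =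
      exp (- (1 / 4) * ((cosh t / sinh t) * (norm (x - y))\<^sup>2))"
    unfolding e[symmetric] by (simp add: exp_sum)
  finally have 1: "(\<Prod>b\<in>Basis. normal_density (x \<bullet> b) ?s (y \<bullet> b)) =
      (1 / sqrt (4 * pi * tanh t)) ^ CARD('n) *
      exp (- (1 / 4) * ((cosh t / sinh t) * (norm (x - y))\<^sup>2))"
    by simp
  have "2 * pi * sinh (2 * t) = (cosh t)\<^sup>2 * (4 * pi * tanh t)"
    using pos(2) by (simp add: sinh_double tanh_def power2_eq_square)
  then have 3: "(1 / cosh t) * (1 / sqrt (4 * pi * tanh t)) = 1 / sqrt (2 * pi * sinh (2 * t))"
    using pos(2) by (simp add: real_sqrt_mult)
  have "(2 * pi * sinh (2 * t)) powr (- real CARD('n) / 2) =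
      ((2 * pi * sinh (2 * t)) powr (- 1 / 2)) powr real CARD('n)"
    unfolding powr_powr by simp
  also have "\<dots> = ((2 * pi * sinh (2 * t)) powr (- 1 / 2)) ^ CARD('n)"
    using pos(4) by (intro powr_realpow) auto
  also have "(2 * pi * sinh (2 * t)) powr (- 1 / 2) = 1 / sqrt (2 * pi * sinh (2 * t))"
    using pos(4) by (simp add: powr_minus_divide powr_half_sqrt)
  finally have "(2 * pi * sinh (2 * t)) powr (- real CARD('n) / 2) =
      ((1 / cosh t) * (1 / sqrt (4 * pi * tanh t))) ^ CARD('n)"
    unfolding 3 .
  then have 2: "(2 * pi * sinh (2 * t)) powr (- real CARD('n) / 2) =
      (1 / cosh t) ^ CARD('n) * (1 / sqrt (4 * pi * tanh t)) ^ CARD('n)"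
    by (simp only: power_mult_distrib)
  have "exp (- (1 / 4) * (tanh t * (norm (x + y))\<^sup>2 + (cosh t / sinh t) * (norm (x - y))\<^sup>2)) \<le>
      exp (- (1 / 4) * ((cosh t / sinh t) * (norm (x - y))\<^sup>2))"
    using pos by simp
  then show ?thesis
    unfolding hermite_heat_kernel_def 1 2 mult.assoc[of "(1 / cosh t) ^ CARD('n)"]
    using pos by (intro mult_left_mono) auto
qed

lemma nn_integral_gaussian_eq_1:
  fixes x :: "'a::euclidean_space"
  assumes "0 < s"
  shows "(\<integral>\<^sup>+y. ennreal (\<Prod>b\<in>Basis. normal_density (x \<bullet> b) s (y \<bullet> b)) \<partial>lborel) = 1"
proof -
  have "(\<integral>\<^sup>+y. ennreal (normal_density m s y) \<partial>lborel) = 1" for m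
    using assms by (simp add: nn_integral_eq_integral)
  then show ?thesis
    using nn_integral_lborel_prod[of "\<lambda>b z. ennreal (normal_density (x \<bullet> b) s z)"]
    by (simp add: prod_ennreal[symmetric])
qed

definition time_weight :: "real \<Rightarrow> nat \<Rightarrow> real \<Rightarrow> real" where
  "time_weight \<sigma> d t = indicator {0<..} t * (t powr (\<sigma> - 1) * (1 / cosh t) ^ d)"

lemma hyperbolic_measurable [measurable]:
  "(sinh :: real \<Rightarrow> real) \<in> borel_measurable borel"
  "(cosh :: real \<Rightarrow> real) \<in> borel_measurable borel"
  "(tanh :: real \<Rightarrow> real) \<in> borel_measurable borel"
  by (auto intro!: borel_measurable_continuous_onI continuous_intros)

lemma time_weight_measurable [measurable]: "time_weight \<sigma> d \<in> borel_measurable borel"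
  unfolding time_weight_def by measurable

lemma time_weight_finite:
  assumes "0 < \<sigma>" "1 \<le> d"
  shows "(\<integral>\<^sup>+t. ennreal (time_weight \<sigma> d t) \<partial>lborel) < \<infinity>"
proof -
  have le: "time_weight \<sigma> d t \<le> 2 * (indicator {0..} t * t powr (\<sigma> - 1) / exp t)" for t
  proof (cases "0 < t")
    case True
    have "(1 / cosh t) ^ d \<le> (1 / cosh t) ^ 1"
      using cosh_real_ge_1[of t] \<open>1 \<le> d\<close> by (intro power_decreasing) auto
    also have "\<dots> \<le> 2 / exp t"
      by (simp add: cosh_def field_simps add_pos_pos)
    finally have "t powr (\<sigma> - 1) * (1 / cosh t) ^ d \<le> t powr (\<sigma> - 1) * (2 / exp t)"
      by (intro mult_left_mono) auto
    then show ?thesis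
      using True by (simp add: time_weight_def mult.commute)
  qed (auto simp: time_weight_def)
  have "(\<integral>\<^sup>+t. ennreal (time_weight \<sigma> d t) \<partial>lborel) \<le>
      (\<integral>\<^sup>+t. ennreal 2 * ennreal (indicator {0..} t * t powr (\<sigma> - 1) / exp t) \<partial>lborel)"
    using le by (intro nn_integral_mono, subst ennreal_mult'[symmetric]) (auto intro!: ennreal_leI)
  also have "\<dots> = ennreal 2 * ennreal (Gamma \<sigma>)"
    using \<open>0 < \<sigma>\<close> by (subst nn_integral_cmult) (auto simp: Gamma_conv_nn_integral_real)
  also have "\<dots> < \<infinity>"
    by (simp add: ennreal_mult_less_top)
  finally show ?thesis .
qed

definition gaussian_majorant :: "real \<Rightarrow> real^'n \<Rightarrow> real^'n \<Rightarrow> ennreal" where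
  "gaussian_majorant \<sigma> x y = (\<integral>\<^sup>+t. ennreal (time_weight \<sigma> CARD('n) t) *
     ennreal (\<Prod>b\<in>Basis. normal_density (x \<bullet> b) (sqrt (2 * tanh t)) (y \<bullet> b)) \<partial>lborel)"

lemma normal_density_measurable [measurable (raw)]:
  assumes [measurable]: "m \<in> borel_measurable M" "s \<in> borel_measurable M" "z \<in> borel_measurable M"
  shows "(\<lambda>w. normal_density (m w) (s w) (z w)) \<in> borel_measurable M"
  unfolding normal_density_def by measurable

lemma gaussian_measurable [measurable]:
  "(\<lambda>((x::real^'n, y::real^'n), t). ennreal (time_weight \<sigma> CARD('n) t) *
     ennreal (\<Prod>b\<in>Basis. normal_density (x \<bullet> b) (sqrt (2 * tanh t)) (y \<bullet> b)))
   \<in> borel_measurable ((borel \<Otimes>\<^sub>M borel) \<Otimes>\<^sub>M borel)"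
  unfolding split_beta' by measurable

lemma gaussian_majorant_measurable [measurable]:
  "(\<lambda>(x::real^'n, y::real^'n). gaussian_majorant \<sigma> x y) \<in> borel_measurable (borel \<Otimes>\<^sub>M borel)"
  unfolding gaussian_majorant_def split_beta' by measurable

lemma gaussian_majorant_commute: "gaussian_majorant \<sigma> x y = gaussian_majorant \<sigma> y x"
  unfolding gaussian_majorant_def normal_density_def by (simp add: power2_commute)

lemma gaussian_majorant_integral:
  fixes x :: "real^'n"
  shows "(\<integral>\<^sup>+y. gaussian_majorant \<sigma> x y \<partial>lborel) = (\<integral>\<^sup>+t. ennreal (time_weight \<sigma> CARD('n) t) \<partial>lborel)"
proof -
  let ?g = "\<lambda>t y. \<Prod>b\<in>Basis. normal_density (x \<bullet> b) (sqrt (2 * tanh t)) (y \<bullet> b)"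
  have "(\<integral>\<^sup>+y. gaussian_majorant \<sigma> x y \<partial>lborel) =
      (\<integral>\<^sup>+t. \<integral>\<^sup>+y. ennreal (time_weight \<sigma> CARD('n) t) * ennreal (?g t y) \<partial>lborel \<partial>lborel)"
    unfolding gaussian_majorant_def by (rule lborel_pair.Fubini') measurable
  also have "\<dots> = (\<integral>\<^sup>+t. ennreal (time_weight \<sigma> CARD('n) t) \<partial>lborel)"
  proof (rule nn_integral_cong)
    fix t :: real
    have m: "(\<lambda>y. ennreal (?g t y)) \<in> borel_measurable lborel"
      unfolding normal_density_def by measurable
    show "(\<integral>\<^sup>+y. ennreal (time_weight \<sigma> CARD('n) t) * ennreal (?g t y) \<partial>lborel) =
        ennreal (time_weight \<sigma> CARD('n) t)"
    proof (cases "0 < t")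
      case True
      then have "0 < sqrt (2 * tanh t)"
        by simp
      then show ?thesis
        by (simp only: nn_integral_cmult[OF m] nn_integral_gaussian_eq_1 mult_1_right)
    qed (simp add: time_weight_def)
  qed
  finally show ?thesis .
qed

lemma potential_kernel_le:
  fixes x y :: "real^'n"
  assumes "0 < \<sigma>"
  shows "ennreal \<bar>potential_kernel \<sigma> x y\<bar> \<le> ennreal (1 / Gamma \<sigma>) * gaussian_majorant \<sigma> x y"
proof -
  let ?F = "\<lambda>t. indicat_real {0<..} t *\<^sub>R (hermite_heat_kernel t x y * t powr (\<sigma> - 1))"
  have "ennreal \<bar>integral\<^sup>L lborel ?F\<bar> \<le> (\<integral>\<^sup>+t. ennreal (norm (?F t)) \<partial>lborel)"
  proof (cases "integrable lborel ?F")
    case True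
    then show ?thesis
      using integral_norm_bound_ennreal[OF True] by simp
  qed (simp add: not_integrable_integral_eq)
  also have "\<dots> \<le> gaussian_majorant \<sigma> x y"
    unfolding gaussian_majorant_def
  proof (rule nn_integral_mono)
    fix t :: real
    let ?g = "\<Prod>b\<in>Basis. normal_density (x \<bullet> b) (sqrt (2 * tanh t)) (y \<bullet> b)"
    have "norm (?F t) \<le> time_weight \<sigma> CARD('n) t * ?g"
    proof (cases "0 < t")
      case True
      have "0 \<le> hermite_heat_kernel t x y"
        by (simp add: hermite_heat_kernel_def)
      then show ?thesis
        using mult_left_mono[OF hermite_heat_kernel_le[OF True, of x y], of "t powr (\<sigma> - 1)"] True
        by (simp add: time_weight_def mult_ac)
    qed (simp add: time_weight_def)
    then show "ennreal (norm (?F t)) \<le> ennreal (time_weight \<sigma> CARD('n) t) * ennreal ?g"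
      by (simp add: ennreal_mult'[symmetric] prod_nonneg ennreal_leI ennreal_mult''[symmetric])
  qed
  finally have *: "ennreal \<bar>integral\<^sup>L lborel ?F\<bar> \<le> gaussian_majorant \<sigma> x y" .
  have "ennreal \<bar>potential_kernel \<sigma> x y\<bar> = ennreal (1 / Gamma \<sigma>) * ennreal \<bar>integral\<^sup>L lborel ?F\<bar>"
    using Gamma_real_pos[OF assms]
    by (simp add: potential_kernel_def set_lebesgue_integral_def abs_mult ennreal_mult'[symmetric])
  then show ?thesis
    using * by (simp add: mult_left_mono)
qed

lemma potential_kernel_measurable [measurable]:
  "(\<lambda>(x::real^'n, y::real^'n). potential_kernel \<sigma> x y) \<in> borel_measurable (borel \<Otimes>\<^sub>M borel)"
  unfolding potential_kernel_def set_lebesgue_integral_def hermite_heat_kernel_def by measurable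

lemma potential_kernel_mult_measurable:
  fixes f :: "real^'n \<Rightarrow> real"
  assumes "f \<in> borel_measurable lebesgue"
  shows "(\<lambda>y. potential_kernel \<sigma> x y * f y) \<in> borel_measurable lebesgue"
proof -
  have "(\<lambda>y. potential_kernel \<sigma> x y) \<in> borel_measurable lborel"
    by measurable
  then show ?thesis
    using assms by (intro borel_measurable_times[OF measurable_completion])
qed

lemma lebesgue_borel_representative:
  fixes f :: "real^'n \<Rightarrow> real"
  assumes "f \<in> borel_measurable lebesgue"
  obtains g where "g \<in> borel_measurable borel" "AE x in lebesgue. f x = g x"
  using completion_ex_borel_measurable_real[OF assms] by (auto intro: AE_completion that)

lemma potential_operator_measurable:
  fixes f :: "real^'n \<Rightarrow> real"
  assumes "f \<in> borel_measurable lebesgue"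
  shows "potential_operator \<sigma> f \<in> borel_measurable lebesgue"
proof -
  obtain g where g [measurable]: "g \<in> borel_measurable borel" and fg: "AE x in lebesgue. f x = g x"
    using lebesgue_borel_representative[OF assms] .
  have "potential_operator \<sigma> f x = (LINT y|lborel. potential_kernel \<sigma> x y * g y)" for x
  proof -
    have m: "(\<lambda>y. potential_kernel \<sigma> x y * g y) \<in> borel_measurable lborel"
      by measurable
    have "potential_operator \<sigma> f x = (LINT y|lebesgue. potential_kernel \<sigma> x y * g y)"
      unfolding potential_operator_def
    proof (rule integral_cong_AE)
      show "(\<lambda>y. potential_kernel \<sigma> x y * f y) \<in> borel_measurable lebesgue"
        using assms by (rule potential_kernel_mult_measurable)
      show "(\<lambda>y. potential_kernel \<sigma> x y * g y) \<in> borel_measurable lebesgue"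
        using m by (rule measurable_completion)
      show "AE y in lebesgue. potential_kernel \<sigma> x y * f y = potential_kernel \<sigma> x y * g y"
        using fg by eventually_elim simp
    qed
    also have "\<dots> = (LINT y|lborel. potential_kernel \<sigma> x y * g y)"
      by (rule integral_completion[OF m])
    finally show ?thesis .
  qed
  then have "potential_operator \<sigma> f = (\<lambda>x. LINT y|lborel. potential_kernel \<sigma> x y * g y)"
    by blast
  moreover have "(\<lambda>x. LINT y|lborel. potential_kernel \<sigma> x y * g y) \<in> borel_measurable lborel"
    by measurable
  ultimately show ?thesis
    using measurable_completion by metis
qed

lemma Lp_space_le:
  fixes f :: "real^'n \<Rightarrow> real"
  assumes f: "f \<in> Lp_space p" and p: "1 \<le> p"
  obtains c :: real and h where "0 \<le> c" "h \<in> borel_measurable lebesgue"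
    "(\<integral>\<^sup>+y. h y \<partial>lebesgue) < \<infinity>" "AE y in lebesgue. ennreal \<bar>f y\<bar> \<le> ennreal c + h y"
proof (cases "p = \<infinity>")
  case True
  have fin: "esssup lebesgue (\<lambda>x. ennreal \<bar>f x\<bar>) < \<infinity>"
    using f True by (simp add: Lp_space_def Lp_norm_def)
  have "AE y in lebesgue. ennreal \<bar>f y\<bar> \<le> esssup lebesgue (\<lambda>x. ennreal \<bar>f x\<bar>)"
    by (rule esssup_AE)
  then have "AE y in lebesgue. ennreal \<bar>f y\<bar> \<le> ennreal (enn2real (esssup lebesgue (\<lambda>x. ennreal \<bar>f x\<bar>))) + 0"
    using fin by simp
  then show ?thesis
    by (intro that[of "enn2real (esssup lebesgue (\<lambda>x. ennreal \<bar>f x\<bar>))" "\<lambda>_. 0"]) auto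
next
  case False
  have [measurable]: "f \<in> borel_measurable lebesgue"
    using f by (simp add: Lp_space_def)
  define r where "r = enn2real p"
  have r: "1 \<le> r"
    using p False enn2real_mono[of 1 p] by (simp add: r_def less_top)
  show ?thesis
  proof (rule that[of 1 "\<lambda>y. ennreal (\<bar>f y\<bar> powr r)"])
    show "(\<lambda>y. ennreal (\<bar>f y\<bar> powr r)) \<in> borel_measurable lebesgue"
      by measurable
    show "(\<integral>\<^sup>+y. ennreal (\<bar>f y\<bar> powr r) \<partial>lebesgue) < \<infinity>"
      using f False by (auto simp: Lp_space_def Lp_norm_def ennreal_rpow_def r_def less_top split: if_splits)
    have "\<bar>f y\<bar> \<le> 1 + \<bar>f y\<bar> powr r" for y
    proof (cases "\<bar>f y\<bar> \<le> 1")
      case True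
      then show ?thesis
        using powr_ge_zero[of "\<bar>f y\<bar>" r] by linarith
    next
      case False
      then show ?thesis
        using powr_mono[OF r, of "\<bar>f y\<bar>"] by simp
    qed
    then have "ennreal \<bar>f y\<bar> \<le> ennreal 1 + ennreal (\<bar>f y\<bar> powr r)" for y
      by (subst ennreal_plus[symmetric]) (auto intro!: ennreal_leI simp del: ennreal_plus)
    then show "AE y in lebesgue. ennreal \<bar>f y\<bar> \<le> ennreal 1 + ennreal (\<bar>f y\<bar> powr r)"
      by simp
  qed simp
qed

lemma Lp_space_subset_natural_domain:
  assumes \<sigma>: "0 < \<sigma>" and p: "1 \<le> p"
  shows "Lp_space p \<subseteq> (natural_domain \<sigma> :: (real^'n \<Rightarrow> real) set)"
proof
  fix f :: "real^'n \<Rightarrow> real"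
  assume f: "f \<in> Lp_space p"
  then have fm: "f \<in> borel_measurable lebesgue"
    by (simp add: Lp_space_def)
  obtain c h where c: "0 \<le> c" and hm: "h \<in> borel_measurable lebesgue"
    and hfin: "(\<integral>\<^sup>+y. h y \<partial>lebesgue) < \<infinity>"
    and fh: "AE y in lebesgue. ennreal \<bar>f y\<bar> \<le> ennreal c + h y"
    using Lp_space_le[OF f p] .
  obtain g where [measurable]: "g \<in> borel_measurable lborel" and hg: "AE y in lborel. h y = g y"
    using completion_ex_borel_measurable[OF hm] by auto
  let ?W = "\<integral>\<^sup>+t. ennreal (time_weight \<sigma> CARD('n) t) \<partial>lborel"
  have W: "?W < \<infinity>"
    using time_weight_finite[OF \<sigma>, of "CARD('n)"] by (simp add: Suc_leI)
  have gfin: "(\<integral>\<^sup>+y. g y \<partial>lborel) < \<infinity>"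
    using hfin nn_integral_cong_AE[OF hg] by (simp add: nn_integral_completion)
  have "(\<integral>\<^sup>+x. \<integral>\<^sup>+y. gaussian_majorant \<sigma> x y * g y \<partial>lborel \<partial>lborel) =
      (\<integral>\<^sup>+y. \<integral>\<^sup>+x. gaussian_majorant \<sigma> x y * g y \<partial>lborel \<partial>lborel)"
    by (rule lborel_pair.Fubini') measurable
  also have "\<dots> = (\<integral>\<^sup>+y. ?W * g y \<partial>lborel)"
    by (intro nn_integral_cong)
      (simp add: nn_integral_multc gaussian_majorant_commute[of _ _ "_::real^'n"] gaussian_majorant_integral)
  also have "\<dots> < \<infinity>"
    using W gfin by (simp add: nn_integral_cmult ennreal_mult_less_top)
  finally have "AE x in lborel. (\<integral>\<^sup>+y. gaussian_majorant \<sigma> x y * g y \<partial>lborel) \<noteq> \<infinity>"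
    by (intro nn_integral_PInf_AE) (auto simp: less_top)
  then have "AE x in lebesgue. (\<integral>\<^sup>+y. gaussian_majorant \<sigma> x y * g y \<partial>lborel) \<noteq> \<infinity>"
    by (rule AE_completion)
  then have "AE x in lebesgue. integrable lebesgue (\<lambda>y. potential_kernel \<sigma> x y * f y)"
  proof eventually_elim
    case (elim x)
    have m [measurable]: "(\<lambda>y. potential_kernel \<sigma> x y * f y) \<in> borel_measurable lebesgue"
      using fm by (rule potential_kernel_mult_measurable)
    have "(\<integral>\<^sup>+y. ennreal (norm (potential_kernel \<sigma> x y * f y)) \<partial>lebesgue) \<le>
        (\<integral>\<^sup>+y. ennreal (1 / Gamma \<sigma>) * gaussian_majorant \<sigma> x y * (ennreal c + g y) \<partial>lebesgue)"
    proof (rule nn_integral_mono_AE)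
      show "AE y in lebesgue. ennreal (norm (potential_kernel \<sigma> x y * f y)) \<le>
          ennreal (1 / Gamma \<sigma>) * gaussian_majorant \<sigma> x y * (ennreal c + g y)"
        using fh AE_completion[OF hg]
      proof eventually_elim
        case (elim y)
        have "ennreal (norm (potential_kernel \<sigma> x y * f y)) =
            ennreal \<bar>potential_kernel \<sigma> x y\<bar> * ennreal \<bar>f y\<bar>"
          by (simp add: abs_mult ennreal_mult)
        also have "\<dots> \<le> ennreal (1 / Gamma \<sigma>) * gaussian_majorant \<sigma> x y * (ennreal c + g y)"
          using elim by (intro mult_mono potential_kernel_le[OF \<sigma>]) auto
        finally show ?case .
      qed
    qed
    also have "\<dots> = (\<integral>\<^sup>+y. ennreal (1 / Gamma \<sigma>) * (gaussian_majorant \<sigma> x y * ennreal c +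
        gaussian_majorant \<sigma> x y * g y) \<partial>lborel)"
      by (simp add: nn_integral_completion distrib_left mult.assoc)
    also have "\<dots> = ennreal (1 / Gamma \<sigma>) * (?W * ennreal c +
        (\<integral>\<^sup>+y. gaussian_majorant \<sigma> x y * g y \<partial>lborel))"
      by (simp add: nn_integral_cmult nn_integral_add nn_integral_multc gaussian_majorant_integral)
    also have "\<dots> < \<infinity>"
      using W elim by (simp add: ennreal_mult_less_top less_top)
    finally show ?case
      by (intro integrableI_bounded m)
  qed
  then show "f \<in> natural_domain \<sigma>"
    using fm by (simp add: natural_domain_def)
qed

end

theory Submission
  imports Defs
begin

text \<open>Since \<open>tanh t \<le> coth t\<close>, half of the exponent of the heat kernel already dominates
  \<open>tanh t * (|x|\<^sup>2 + |y|\<^sup>2)\<close> by the parallelogram law, and the other half leaves \<open>coth t * |x - y|\<^sup>2\<close>.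
  Integrating in \<open>t\<close>, one gets for every \<open>\<theta> \<ge> 0\<close> the bound
  \<open>K(x, y) \<le> C max(1, |x|)\<^bsup>-2\<theta>\<^esup> |x - y|\<^bsup>2(\<sigma> - \<theta>) - d\<^esup> exp(-|x - y|\<^sup>2 / 16)\<close>.
  With \<open>\<theta> = 0\<close> this is a Riesz kernel with a Gaussian tail: Young's inequality gives the pairs strictly
  between the diagonal and the lower edge, the Hardy--Littlewood--Sobolev inequality the lower edge, and the
  bound \<open>|E|\<^bsup>2\<sigma>/d\<^esup>\<close> for the potential of a set \<open>E\<close> the two lower end points.  With \<open>0 < \<theta> < \<sigma>\<close> the
  convolution kernel is integrable and the weight lies in some \<open>L\<^sup>s\<close>, which gives the pairs above the diagonal;
  using \<open>\<theta> = 0\<close> where \<open>|x - y| < 1/|x|\<close> and \<open>\<theta> = 2\<sigma>\<close> elsewhere gives \<open>\<integral> K(x, y) dy \<le> C |x|\<^bsup>-2\<sigma>\<^esup>\<close>.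

  Conversely \<open>K(x, y) \<ge> c |x - y|\<^bsup>2\<sigma> - d\<^esup>\<close> when \<open>|x - y| \<le> 1\<close> and \<open>|x - y| |x + y| \<le> 3\<close>.  Small and large
  balls then exclude everything outside the closed region, and the excluded boundary points are
  logarithmic failures: at each of them a truncated power or a small ball produces \<open>\<integral> |x|\<^bsup>-d\<^esup> dx\<close> over a
  growing annulus, with too large an exponent on the logarithm.\<close>

section \<open>Radial integrals\<close>

text \<open>The radius 1/|x| rules both directions. For times t \<le> 1 comparable with |x - y|^2
  the term tanh t |x + y|^2 in the exponent has size (|x - y| |x + y|)^2, so the potential kernel
  stays comparable with the Riesz kernel as long as that product is bounded. For |x| \<ge> 1 this
  covers the ball of radius 1/|x| about x, over which the Riesz kernel has an integral of order
  |x|^(-2\<sigma>). The bound 3 is what this radius yields: (2|x| + 1/|x|) / |x| \<le> 3.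

  The weight max(1, |x|)^(-2\<theta>) costs a factor |x - y|^(-2\<theta>), and the remaining
  convolution kernel is integrable at the origin only for \<theta> < \<sigma>. Hence the weight
  argument reaches the strip below the upper edge, but never the edge itself.

  A divergent Bochner integral has the value 0. Upper bounds survive this, since the operator is at
  most the corresponding integral in [0, \<infinity>]. Lower bounds do not, so every test function
  is bounded: for such functions the integral converges at every x.

  The lower edge is reached without interpolation, by truncating each of two functions at a level
  set by the other.\<close>

lemma distr_norm_lborel:
  "distr (lborel :: 'a::euclidean_space measure) borel norm =
    density lborel (\<lambda>r. ennreal (DIM('a) * unit_ball_vol DIM('a) * r ^ (DIM('a) - 1)) * indicator {0..} r)"
    (is "?M = ?N")
proof (rule measure_eqI_generator_eq[where E = "range atMost" and \<Omega> = UNIV and A = "\<lambda>i. {..real i}"])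
  \<comment> \<open>Both measures are determined by the half-lines \<open>{..a}\<close>: one side is
    the volume of a ball, the other integrates its derivative in the radius. For
    \<open>a < 0\<close> both vanish.\<close>
  have M: "emeasure ?M {..a} = (if 0 \<le> a then ennreal (unit_ball_vol DIM('a) * a ^ DIM('a)) else 0)" for a
  proof -
    have "norm -` {..a} \<inter> space (lborel :: 'a measure) = (if 0 \<le> a then cball 0 a else {})"
      by (auto simp: dist_norm dest: order_trans[OF norm_ge_zero])
    then show ?thesis
      by (subst emeasure_distr) (auto simp: emeasure_cball)
  qed
  have N: "emeasure ?N {..a} = (if 0 \<le> a then ennreal (unit_ball_vol DIM('a) * a ^ DIM('a)) else 0)" for a
  proof (cases "0 \<le> a")
    case True
    have "emeasure ?N {..a} = (\<integral>\<^sup>+r. ennreal (DIM('a) * unit_ball_vol DIM('a) * r ^ (DIM('a) - 1)) * indicator {0..a} r \<partial>lborel)"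
      by (subst emeasure_density) (auto intro!: nn_integral_cong simp: indicator_def)
    also have "\<dots> = ennreal (unit_ball_vol DIM('a) * a ^ DIM('a) - unit_ball_vol DIM('a) * 0 ^ DIM('a))"
      by (rule nn_integral_FTC_Icc) (auto intro!: derivative_eq_intros simp: True)
    finally show ?thesis using True by simp
  next
    case False
    then show ?thesis
      by (subst emeasure_density) (auto intro!: nn_integral_zero' AE_I2 simp: indicator_def)
  qed
  show "\<And>X. X \<in> range atMost \<Longrightarrow> emeasure ?M X = emeasure ?N X"
    using M N by auto
  show "emeasure ?M {..real i} \<noteq> \<infinity>" for i
    by (simp add: M)
  show "sets ?M = sigma_sets UNIV (range atMost)" "sets ?N = sigma_sets UNIV (range atMost)"
    by (simp_all add: borel_eq_atMost)
  show "(\<Union>i. {..real i}) = UNIV"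
    using real_arch_simple by auto
  show "Int_stable (range (atMost :: real \<Rightarrow> real set))"
    by (auto simp: Int_stable_def)
qed auto

lemma nn_integral_norm:
  assumes [measurable]: "\<phi> \<in> borel_measurable borel"
  shows "(\<integral>\<^sup>+z. \<phi> (norm (z::'a::euclidean_space)) \<partial>lborel) =
    (\<integral>\<^sup>+r. ennreal (DIM('a) * unit_ball_vol DIM('a) * r ^ (DIM('a) - 1)) * indicator {0..} r * \<phi> r \<partial>lborel)"
proof -
  have "(\<integral>\<^sup>+z. \<phi> (norm (z::'a)) \<partial>lborel) = (\<integral>\<^sup>+r. \<phi> r \<partial>distr (lborel :: 'a measure) borel norm)"
    by (subst nn_integral_distr) auto
  then show ?thesis
    by (simp add: distr_norm_lborel nn_integral_density)
qed

text \<open>Polar coordinates turn the Jacobian r^(d - 1) and the power r^(-b) into a single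
  exponent. The sign of d - b separates the three uses: balls around the origin, their exteriors,
  and annuli at the critical b = d.\<close>

lemma nn_integral_powr_norm:
  fixes b v :: real
  assumes [measurable]: "A \<in> sets borel" and "A \<subseteq> {0..}"
    and I: "((\<lambda>r. r powr (real DIM('a) - 1 - b)) has_integral v) A"
  shows "(\<integral>\<^sup>+z. ennreal (norm (z::'a::euclidean_space) powr (-b)) * indicator A (norm z) \<partial>lborel) =
    ennreal (DIM('a) * unit_ball_vol DIM('a) * v)"
proof -
  let ?c = "DIM('a) * unit_ball_vol DIM('a)"
  have "(\<integral>\<^sup>+z. ennreal (norm (z::'a) powr (-b)) * indicator A (norm z) \<partial>lborel) =
     (\<integral>\<^sup>+r. ennreal (?c * r ^ (DIM('a) - 1)) * indicator {0..} r *
       (ennreal (r powr (-b)) * indicator A r) \<partial>lborel)"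
    by (rule nn_integral_norm) measurable
  also have "\<dots> = (\<integral>\<^sup>+r. ennreal ?c * (ennreal (r powr (real DIM('a) - 1 - b)) * indicator A r) \<partial>lborel)"
  proof (rule nn_integral_cong)
    fix r :: real
    \<comment> \<open>At r = 0 both sides are 0 even in dimension one, where the Jacobian is
      \<open>0 ^ 0 = 1\<close>, because \<open>0 powr (-b) = 0\<close>.\<close>
    have "r ^ (DIM('a) - 1) * r powr (-b) = r powr (real DIM('a) - 1 - b)" if "0 \<le> r"
    proof (cases "r = 0")
      case False
      then have "r ^ (DIM('a) - 1) = r powr (real DIM('a) - 1)"
        using that by (subst powr_realpow[symmetric]) (auto simp: of_nat_diff Suc_leI)
      then show ?thesis
        by (simp add: powr_add[symmetric])
    qed auto
    then show "ennreal (?c * r ^ (DIM('a) - 1)) * indicator {0..} r * (ennreal (r powr (-b)) * indicator A r) =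
      ennreal ?c * (ennreal (r powr (real DIM('a) - 1 - b)) * indicator A r)"
      using \<open>A \<subseteq> {0..}\<close> by (auto simp: indicator_def ennreal_mult'[symmetric] ennreal_mult''[symmetric] mult.assoc)
  qed
  also have "\<dots> = ennreal ?c * ennreal v"
    by (subst nn_integral_cmult) (use nn_integral_has_integral_lebesgue'[OF _ I] in auto)
  also have "\<dots> = ennreal (?c * v)"
    by (simp add: ennreal_mult')
  finally show ?thesis .
qed

lemma nn_integral_powr_norm_le:
  fixes b \<rho> :: real
  assumes "b < DIM('a)" "0 \<le> \<rho>"
  shows "(\<integral>\<^sup>+z. ennreal (norm (z::'a::euclidean_space) powr (-b)) * indicator {0..\<rho>} (norm z) \<partial>lborel) =
    ennreal (DIM('a) * unit_ball_vol DIM('a) * (\<rho> powr (DIM('a) - b) / (DIM('a) - b)))"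
  using assms has_integral_powr_from_0[of "DIM('a) - 1 - b" \<rho>]
  by (intro nn_integral_powr_norm) (auto simp: algebra_simps)

lemma nn_integral_powr_norm_ge:
  fixes b \<rho> :: real
  assumes "b > DIM('a)" "0 < \<rho>"
  shows "(\<integral>\<^sup>+z. ennreal (norm (z::'a::euclidean_space) powr (-b)) * indicator {\<rho>..} (norm z) \<partial>lborel) =
    ennreal (DIM('a) * unit_ball_vol DIM('a) * (\<rho> powr (DIM('a) - b) / (b - DIM('a))))"
proof (rule nn_integral_powr_norm)
  have "- (\<rho> powr (real DIM('a) - 1 - b + 1)) / (real DIM('a) - 1 - b + 1) = \<rho> powr (DIM('a) - b) / (b - DIM('a))"
    using assms by (simp add: minus_divide_right algebra_simps del: minus_divide_left)
  with has_integral_powr_to_inf[of "DIM('a) - 1 - b" \<rho>] assms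
  show "((\<lambda>r. r powr (real DIM('a) - 1 - b)) has_integral \<rho> powr (DIM('a) - b) / (b - DIM('a))) {\<rho>..}"
    by auto
qed (use assms in auto)

text \<open>At the critical exponent the radial density is a multiple of 1/r. Every logarithm in the
  negative results comes from here.\<close>

lemma nn_integral_powr_norm_annulus:
  fixes a c :: real
  assumes "0 < a" "a \<le> c"
  shows "(\<integral>\<^sup>+z. ennreal (norm (z::'a::euclidean_space) powr (- real DIM('a))) * indicator {a..c} (norm z) \<partial>lborel) =
    ennreal (DIM('a) * unit_ball_vol DIM('a) * ln (c / a))"
proof (rule nn_integral_powr_norm)
  have "((\<lambda>r. r powr (real DIM('a) - 1 - DIM('a))) has_integral (ln c - ln a)) {a..c}"
    using assms by (intro fundamental_theorem_of_calculus)
      (auto intro!: derivative_eq_intros simp: powr_minus divide_simps has_real_derivative_iff_has_vector_derivative[symmetric])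
  then show "((\<lambda>r. r powr (real DIM('a) - 1 - DIM('a))) has_integral ln (c / a)) {a..c}"
    using assms by (simp add: ln_div)
qed (use assms in auto)


section \<open>Pointwise bounds for the potential kernel\<close>

lemma one_plus_powr_le_exp:
  fixes a b :: real
  assumes "0 \<le> a" "0 < b"
  shows "\<exists>C>0. \<forall>s\<ge>0. (1 + s) powr a \<le> C * exp (b * s)"
proof (cases "a = 0")
  case True
  with assms show ?thesis
    by (intro exI[of _ 1]) auto
next
  case False
  define e where "e = b / a"
  have e: "0 < e" "a * e = b"
    using assms False by (auto simp: e_def)
  \<comment> \<open>\<open>m\<close> is large enough for 1 + s \<le> m (1 + e s) \<le> m exp(e s);
    raising this to the power \<open>a\<close> gives the rate a e = b.\<close>
  define m where "m = max 1 (1 / e)"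
  have m: "1 \<le> m" "1 \<le> m * e"
    using e by (auto simp: m_def max_def field_simps)
  have "(1 + s) powr a \<le> m powr a * exp (b * s)" if "0 \<le> s" for s
  proof -
    have "1 + s \<le> m + m * e * s"
      using m that by (intro add_mono) (auto simp: mult_right_le_one_le intro: mult_right_mono[of 1 "m * e" s, simplified])
    also have "\<dots> = m * (1 + e * s)"
      by (simp add: algebra_simps)
    also have "\<dots> \<le> m * exp (e * s)"
      using m by (intro mult_left_mono) auto
    finally have "(1 + s) powr a \<le> (m * exp (e * s)) powr a"
      using assms that by (intro powr_mono2) auto
    also have "\<dots> = m powr a * exp (b * s)"
      using m by (subst powr_mult) (auto simp: exp_powr_real mult.commute e(2)[symmetric] mult.left_commute)
    finally show ?thesis .
  qed
  then show ?thesis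
    using m by (intro exI[of _ "m powr a"]) auto
qed

lemma exp_minus_le_powr:
  fixes \<theta> b :: real
  assumes "0 \<le> \<theta>" "0 < b"
  shows "\<exists>C>0. \<forall>u>0. exp (- (b * u)) \<le> C * u powr (- \<theta>)"
proof -
  obtain C where C: "C > 0" "\<And>s. 0 \<le> s \<Longrightarrow> (1 + s) powr \<theta> \<le> C * exp (b * s)"
    using one_plus_powr_le_exp[OF assms] by blast
  have "exp (- (b * u)) \<le> C * u powr (- \<theta>)" if "0 < u" for u
  proof -
    have "u powr \<theta> \<le> (1 + u) powr \<theta>"
      using that assms by (intro powr_mono2) auto
    also have "\<dots> \<le> C * exp (b * u)"
      using C that by simp
    finally show ?thesis
      using that by (simp add: exp_minus powr_minus field_simps)
  qed
  with C show ?thesis by blast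
qed

text \<open>By scaling the integral is a multiple of \<delta>^(-\<kappa>). Here it is split at t =
  \<delta>: below, exp(-\<delta>/(16t)) is traded for (t/\<delta>)^(\<kappa> + 1), which cancels the
  singular power and leaves a constant on an interval of length \<delta>; above, the exponential is
  at most 1 and the power is integrable because \<kappa> > 0.\<close>

lemma nn_integral_heat_time:
  fixes \<kappa> :: real
  assumes "0 < \<kappa>"
  shows "\<exists>C>0. \<forall>\<delta>>0. (\<integral>\<^sup>+t. ennreal (exp (- (\<delta> / (16 * t))) * t powr (- \<kappa> - 1)) * indicator {0<..} t \<partial>lborel)
    \<le> ennreal (C * \<delta> powr (- \<kappa>))"
proof -
  obtain C where C: "C > 0" "\<And>u. 0 < u \<Longrightarrow> exp (- (1/16 * u)) \<le> C * u powr (- (\<kappa> + 1))"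
    using exp_minus_le_powr[of "\<kappa> + 1" "1/16"] assms by auto
  have "(\<integral>\<^sup>+t. ennreal (exp (- (\<delta> / (16 * t))) * t powr (- \<kappa> - 1)) * indicator {0<..} t \<partial>lborel)
    \<le> ennreal ((C + 1 / \<kappa>) * \<delta> powr (- \<kappa>))" if \<delta>: "0 < \<delta>" for \<delta>
  proof -
    have le: "ennreal (exp (- (\<delta> / (16 * t))) * t powr (- \<kappa> - 1)) * indicator {0<..} t \<le>
      ennreal (C * \<delta> powr (- (\<kappa> + 1))) * indicator {0..\<delta>} t + ennreal (t powr (- \<kappa> - 1)) * indicator {\<delta>..} t" for t
    proof (cases "0 < t")
      case t: True
      show ?thesis
      proof (cases "t \<le> \<delta>")
        case True
        have "exp (- (\<delta> / (16 * t))) \<le> C * (\<delta> / t) powr (- (\<kappa> + 1))"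
          using C(2)[of "\<delta> / t"] t \<delta> by simp
        also have "(\<delta> / t) powr (- (\<kappa> + 1)) = \<delta> powr (- (\<kappa> + 1)) * t powr (\<kappa> + 1)"
          using t \<delta> powr_minus_divide[of t "\<kappa> + 1"] by (simp add: powr_divide)
        finally have "exp (- (\<delta> / (16 * t))) * t powr (- \<kappa> - 1) \<le>
            (C * (\<delta> powr (- (\<kappa> + 1)) * t powr (\<kappa> + 1))) * t powr (- \<kappa> - 1)"
          by (rule mult_right_mono) auto
        also have "\<dots> = C * \<delta> powr (- (\<kappa> + 1))"
          using t by (simp add: powr_add[symmetric] mult.assoc)
        finally show ?thesis
          using t True by (auto simp: indicator_def intro!: ennreal_leI add_increasing2)
      next
        case False
        then show ?thesis
          using t \<delta> by (auto simp: indicator_def intro!: ennreal_leI mult_left_le_one_le)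
      qed
    qed auto
    have "- (\<delta> powr (- \<kappa> - 1 + 1)) / (- \<kappa> - 1 + 1) = \<delta> powr (- \<kappa>) / \<kappa>"
      by simp
    with has_integral_powr_to_inf[of "- \<kappa> - 1" \<delta>] assms \<delta>
    have I: "(\<integral>\<^sup>+t. ennreal (t powr (- \<kappa> - 1)) * indicator {\<delta>..} t \<partial>lborel) = ennreal (\<delta> powr (- \<kappa>) / \<kappa>)"
      by (intro nn_integral_has_integral_lebesgue') auto
    have "(\<integral>\<^sup>+t. ennreal (exp (- (\<delta> / (16 * t))) * t powr (- \<kappa> - 1)) * indicator {0<..} t \<partial>lborel)
      \<le> (\<integral>\<^sup>+t. ennreal (C * \<delta> powr (- (\<kappa> + 1))) * indicator {0..\<delta>} t + ennreal (t powr (- \<kappa> - 1)) * indicator {\<delta>..} t \<partial>lborel)"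
      by (intro nn_integral_mono le)
    also have "\<dots> = ennreal (C * \<delta> powr (- (\<kappa> + 1))) * ennreal \<delta> + ennreal (\<delta> powr (- \<kappa>) / \<kappa>)"
      using \<delta> by (subst nn_integral_add) (auto simp: I nn_integral_cmult_indicator)
    also have "\<dots> = ennreal (C * (\<delta> powr (- (\<kappa> + 1)) * \<delta> powr 1) + \<delta> powr (- \<kappa>) / \<kappa>)"
      using C \<delta> assms by (simp add: ennreal_mult'[symmetric] ennreal_plus[symmetric] mult.assoc del: ennreal_plus)
    also have "\<dots> = ennreal ((C + 1 / \<kappa>) * \<delta> powr (- \<kappa>))"
      unfolding powr_add[symmetric] by (simp add: algebra_simps)
    finally show ?thesis .
  qed
  moreover have "0 < C + 1 / \<kappa>"
    using C assms by (simp add: add_pos_pos)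
  ultimately show ?thesis by blast
qed

text \<open>One expression of the right order both near 0 (about s) and at infinity (about
  exp(s)/2), so that no case distinction in the time variable is needed later. It follows from 1 +
  2s \<le> exp(2s).\<close>

lemma sinh_ge:
  assumes "0 < (s::real)"
  shows "s * exp s / (1 + 2 * s) \<le> sinh s"
proof -
  have "(1 + 2 * s) \<le> exp (2 * s)"
    by simp
  then have "exp (- (2 * s)) \<le> 1 / (1 + 2 * s)"
    using assms by (simp add: exp_minus field_simps)
  then have "2 * s / (1 + 2 * s) \<le> 1 - exp (- (2 * s))"
    using assms by (simp add: field_simps)
  then have "exp s / 2 * (2 * s / (1 + 2 * s)) \<le> exp s / 2 * (1 - exp (- (2 * s)))"
    by (intro mult_left_mono) auto
  also have "\<dots> = sinh s"
    by (simp add: sinh_def algebra_simps exp_add[symmetric])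
  finally show ?thesis
    by (simp add: field_simps)
qed

lemma sinh_le:
  assumes "0 \<le> (s::real)"
  shows "sinh s \<le> s * exp s"
proof -
  have "1 - exp (- (2 * s)) \<le> 2 * s"
    using exp_ge_add_one_self[of "- (2 * s)"] by simp
  then have "exp s / 2 * (1 - exp (- (2 * s))) \<le> exp s / 2 * (2 * s)"
    by (intro mult_left_mono) auto
  moreover have "exp s / 2 * (1 - exp (- (2 * s))) = sinh s"
    by (simp add: sinh_def algebra_simps exp_add[symmetric])
  moreover have "exp s / 2 * (2 * s) = s * exp s"
    by simp
  ultimately show ?thesis
    by metis
qed

lemma le_sinh:
  assumes "0 \<le> (s::real)"
  shows "s \<le> sinh s"
proof -
  have "sinh 0 - 0 \<le> sinh s - s"
    by (rule DERIV_nonneg_imp_nondecreasing[OF assms])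
      (auto intro!: exI derivative_eq_intros simp: cosh_real_ge_1)
  then show ?thesis by simp
qed

lemma tanh_ge:
  assumes "0 < (t::real)"
  shows "t / (1 + t) \<le> tanh t"
proof -
  have "1 + 2 * t \<le> exp (2 * t)"
    by simp
  then have "exp (- 2 * t) * (1 + 2 * t) \<le> 1"
    by (simp add: exp_minus field_simps)
  then have "t * (1 + exp (- 2 * t)) \<le> (1 - exp (- 2 * t)) * (1 + t)"
    by (simp add: algebra_simps)
  then show ?thesis
    using assms by (simp add: tanh_real_altdef divide_simps add_pos_pos mult_ac)
qed

text \<open>The mean of coth t \<ge> 1 and coth t \<ge> 1/t. The first produces the Gaussian tail in
  |x - y|, the second the heat kernel behaviour at small times; the second holds since t cosh t -
  sinh t has the derivative t sinh t \<ge> 0.\<close>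

lemma coth_ge:
  assumes "0 < (t::real)"
  shows "(1 + 1 / t) / 2 \<le> cosh t / sinh t"
proof -
  have s: "0 < sinh t"
    using assms by simp
  have "sinh t \<le> cosh t"
    by (simp add: sinh_le_cosh_real)
  then have 1: "1 \<le> cosh t / sinh t"
    using s by simp
  have "sinh 0 - 0 * cosh 0 \<ge> sinh t - t * cosh t"
    by (rule DERIV_nonpos_imp_nonincreasing[of 0 t "\<lambda>t. sinh t - t * cosh t"])
      (use assms in \<open>auto intro!: exI derivative_eq_intros\<close>)
  then have 2: "1 / t \<le> cosh t / sinh t"
    using s assms by (simp add: field_simps)
  have "(1 + r) / 2 \<le> c" if "1 \<le> c" "r \<le> c" for r c :: real
    using that by simp
  from this[OF 1 2] show ?thesis .
qed


text \<open>Comparing sinh(2t) and tanh t with t loses powers of 1 + 4t, which are repaid by the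
  factor exp(-dt) contained in sinh(2t)^(-d/2). The part tanh t |x|^2 of the exponent is turned into
  the weight by exp(-u/4) \<le> C u^(-\<theta>); this costs t^(-\<theta>), so that \<sigma> -
  \<theta> takes the place of \<sigma> in the time integral.\<close>

lemma kernel_time_bound:
  fixes \<sigma> \<theta> :: real
  assumes "0 < \<sigma>" "0 \<le> \<theta>"
  shows "\<exists>C>0. \<forall>(x::real^'n) y. \<forall>t>0. hermite_heat_kernel t x y * t powr (\<sigma> - 1) \<le>
    C * max 1 (norm x) powr (- 2 * \<theta>) * exp (- (norm (x - y))\<^sup>2 / 16) *
    (exp (- ((norm (x - y))\<^sup>2 / (16 * t))) * t powr (- (real CARD('n) / 2 - (\<sigma> - \<theta>)) - 1))"
proof -
  define d where "d = real CARD('n)"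
  have d: "0 < d" by (simp add: d_def)
  \<comment> \<open>Used at s = 4t, so the rate d/4 becomes the exp(dt) that the heat kernel can
    absorb.\<close>
  obtain C1 where C1: "C1 > 0" "\<And>s. 0 \<le> s \<Longrightarrow> (1 + s) powr (d / 2 + \<theta>) \<le> C1 * exp (d / 4 * s)"
    using one_plus_powr_le_exp[of "d / 2 + \<theta>" "d / 4"] d assms by auto
  obtain C2 where C2: "C2 > 0" "\<And>u. 0 < u \<Longrightarrow> exp (- (1/4 * u)) \<le> C2 * u powr (- \<theta>)"
    using exp_minus_le_powr[of \<theta> "1/4"] assms by auto
  define C where "C = max 1 C2"
  have C: "1 \<le> C" "C2 \<le> C" by (auto simp: C_def)
  have "hermite_heat_kernel t x y * t powr (\<sigma> - 1) \<le>
    C1 * C * max 1 (norm x) powr (- 2 * \<theta>) * exp (- (norm (x - y))\<^sup>2 / 16) *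
    (exp (- ((norm (x - y))\<^sup>2 / (16 * t))) * t powr (- (d / 2 - (\<sigma> - \<theta>)) - 1))"
    if t: "0 < t" for x y :: "real^'n" and t
  proof -
    have pos: "0 < sinh (2 * t)" "0 < tanh t" "0 < sinh t" "tanh t < 1" using t by (auto simp: tanh_real_lt_1)
    have s: "(2 * pi * sinh (2 * t)) powr (- d / 2) \<le> t powr (- d / 2) * (1 + 4 * t) powr (d / 2) * exp (- d * t)"
    proof -
      have "t * exp (2 * t) / (1 + 4 * t) \<le> 2 * t * exp (2 * t) / (1 + 2 * (2 * t))"
        using t by (simp add: divide_right_mono)
      also have "\<dots> \<le> sinh (2 * t)"
        using sinh_ge[of "2 * t"] t by simp
      also have "\<dots> \<le> 2 * pi * sinh (2 * t)"
        using pos pi_gt3 by simp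
      finally have "(2 * pi * sinh (2 * t)) powr (- d / 2) \<le> (t * exp (2 * t) / (1 + 4 * t)) powr (- d / 2)"
        using t d by (intro powr_mono2') auto
      also have "\<dots> = t powr (- d / 2) * (1 + 4 * t) powr (d / 2) * exp (- d * t)"
        using t by (simp add: powr_divide powr_mult exp_powr_real powr_minus field_simps exp_minus)
      finally show ?thesis .
    qed
    have e: "exp (- (1 / 4) * (tanh t * (norm x)\<^sup>2)) \<le> C * t powr (- \<theta>) * (1 + 4 * t) powr \<theta> * max 1 (norm x) powr (- 2 * \<theta>)"
    proof -
      have "tanh t powr (- \<theta>) \<le> (t / (1 + t)) powr (- \<theta>)"
        using t assms tanh_ge[OF t] by (intro powr_mono2') auto
      also have "\<dots> = t powr (- \<theta>) * (1 + t) powr \<theta>"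
        using t by (simp add: powr_divide powr_minus field_simps)
      also have "\<dots> \<le> t powr (- \<theta>) * (1 + 4 * t) powr \<theta>"
        using t assms by (intro mult_left_mono powr_mono2) auto
      finally have th: "tanh t powr (- \<theta>) \<le> t powr (- \<theta>) * (1 + 4 * t) powr \<theta>" .
      have "exp (- (1 / 4) * (tanh t * (norm x)\<^sup>2)) \<le> C * tanh t powr (- \<theta>) * max 1 (norm x) powr (- 2 * \<theta>)"
      proof (cases "norm x \<le> 1")
        case True
        \<comment> \<open>Here the weight is 1, and \<theta> \<ge> 0 with tanh t < 1 makes the
          right-hand side at least 1.\<close>
        have "1 \<le> tanh t powr (- \<theta>)"
          using powr_mono2'[of "- \<theta>" "tanh t" 1] pos assms by simp
        then have "1 \<le> C * tanh t powr (- \<theta>)"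
          using C mult_mono[of 1 C 1 "tanh t powr (- \<theta>)"] by simp
        moreover have "exp (- (1 / 4) * (tanh t * (norm x)\<^sup>2)) \<le> 1"
          using pos by simp
        ultimately have "exp (- (1 / 4) * (tanh t * (norm x)\<^sup>2)) \<le> C * tanh t powr (- \<theta>)"
          by linarith
        moreover have "max 1 (norm x) = 1"
          using True by simp
        ultimately show ?thesis
          by simp
      next
        case False
        then have n: "0 < (norm x)\<^sup>2"
          by (intro zero_less_power) linarith
        have "exp (- (1 / 4) * (tanh t * (norm x)\<^sup>2)) \<le> C2 * (tanh t * (norm x)\<^sup>2) powr (- \<theta>)"
          using C2(2)[OF mult_pos_pos[OF pos(2) n]] by (simp add: mult.assoc)
        also have "\<dots> \<le> C * (tanh t * (norm x)\<^sup>2) powr (- \<theta>)"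
          using C by (intro mult_right_mono) auto
        also have "(tanh t * (norm x)\<^sup>2) powr (- \<theta>) = tanh t powr (- \<theta>) * norm x powr (- 2 * \<theta>)"
          using False pos by (subst powr_mult) (auto simp: powr_powr simp flip: powr_numeral)
        finally show ?thesis
          using False by (simp add: max_def mult.assoc)
      qed
      also have "\<dots> \<le> C * (t powr (- \<theta>) * (1 + 4 * t) powr \<theta>) * max 1 (norm x) powr (- 2 * \<theta>)"
        using C th by (intro mult_right_mono mult_left_mono) auto
      finally show ?thesis by (simp add: mult_ac)
    qed
    \<comment> \<open>Half of the coth term goes into the parallelogram law, and
      \<open>coth_ge\<close> halves what remains, hence the 4. With the outer factor 1/4 of the
      exponent this becomes the 16 of the statement.\<close>
    have q: "(norm (x - y))\<^sup>2 / 4 * (1 + 1 / t) + tanh t * (norm x)\<^sup>2 \<le>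
       tanh t * (norm (x + y))\<^sup>2 + (cosh t / sinh t) * (norm (x - y))\<^sup>2"
    proof -
      have "tanh t \<le> 1 / tanh t"
        using pos by (simp add: field_simps mult_le_one)
      also have "1 / tanh t = cosh t / sinh t"
        by (simp add: tanh_def)
      finally have 1: "tanh t \<le> cosh t / sinh t" .
      have p: "(norm (x + y))\<^sup>2 + (norm (x - y))\<^sup>2 = 2 * (norm x)\<^sup>2 + 2 * (norm y)\<^sup>2"
        by (simp add: power2_norm_eq_inner inner_add inner_diff inner_commute)
      have "tanh t * (norm x)\<^sup>2 \<le> tanh t * ((norm x)\<^sup>2 + (norm y)\<^sup>2)"
        using pos by simp
      also have "\<dots> = tanh t * (norm (x + y))\<^sup>2 / 2 + tanh t * (norm (x - y))\<^sup>2 / 2"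
        using arg_cong[OF p, of "\<lambda>u. tanh t / 2 * u"] by (simp add: algebra_simps)
      also have "\<dots> \<le> tanh t * (norm (x + y))\<^sup>2 + (cosh t / sinh t) * (norm (x - y))\<^sup>2 / 2"
        using pos 1 by (intro add_mono divide_right_mono mult_right_mono) auto
      finally have "tanh t * (norm x)\<^sup>2 \<le> \<dots>" .
      moreover have "(1 + 1 / t) / 2 * (norm (x - y))\<^sup>2 \<le> (cosh t / sinh t) * (norm (x - y))\<^sup>2"
        using coth_ge[OF t] by (intro mult_right_mono) auto
      moreover have "(norm (x - y))\<^sup>2 / 4 * (1 + 1 / t) = ((1 + 1 / t) / 2 * (norm (x - y))\<^sup>2) / 2"
        by simp
      moreover have "a + u \<le> v + w" if "u \<le> v + w / 2" "r \<le> w" "a = r / 2" for a u v w r :: real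
        using that by linarith
      ultimately show ?thesis by blast
    qed
    have pw: "t powr (- d / 2) * t powr (- \<theta>) * t powr (\<sigma> - 1) = t powr (- (d / 2 - (\<sigma> - \<theta>)) - 1)"
      by (simp add: powr_add[symmetric] algebra_simps)
    have "exp (- (1 / 4) * (tanh t * (norm (x + y))\<^sup>2 + (cosh t / sinh t) * (norm (x - y))\<^sup>2)) \<le>
       exp (- (1 / 4) * ((norm (x - y))\<^sup>2 / 4 * (1 + 1 / t) + tanh t * (norm x)\<^sup>2))"
      unfolding exp_le_cancel_iff by (rule mult_left_mono_neg[OF q]) simp
    also have "\<dots> = exp (- (norm (x - y))\<^sup>2 / 16) * exp (- ((norm (x - y))\<^sup>2 / (16 * t))) *
       exp (- (1 / 4) * (tanh t * (norm x)\<^sup>2))"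
      by (simp add: exp_add[symmetric] field_simps)
    also have "\<dots> \<le> exp (- (norm (x - y))\<^sup>2 / 16) * exp (- ((norm (x - y))\<^sup>2 / (16 * t))) *
       (C * t powr (- \<theta>) * (1 + 4 * t) powr \<theta> * max 1 (norm x) powr (- 2 * \<theta>))"
      by (intro mult_left_mono e) auto
    finally have "hermite_heat_kernel t x y * t powr (\<sigma> - 1) \<le>
      (t powr (- d / 2) * (1 + 4 * t) powr (d / 2) * exp (- d * t)) *
      (exp (- (norm (x - y))\<^sup>2 / 16) * exp (- ((norm (x - y))\<^sup>2 / (16 * t))) *
       (C * t powr (- \<theta>) * (1 + 4 * t) powr \<theta> * max 1 (norm x) powr (- 2 * \<theta>))) * t powr (\<sigma> - 1)"
      unfolding hermite_heat_kernel_def d_def[symmetric]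
      using t C s by (intro mult_right_mono mult_mono) auto
    also have "\<dots> = ((1 + 4 * t) powr (d / 2) * (1 + 4 * t) powr \<theta> * exp (- d * t)) *
       (C * max 1 (norm x) powr (- 2 * \<theta>) * exp (- (norm (x - y))\<^sup>2 / 16) *
       (exp (- ((norm (x - y))\<^sup>2 / (16 * t))) * t powr (- (d / 2 - (\<sigma> - \<theta>)) - 1)))"
      unfolding pw[symmetric] by (simp only: mult_ac)
    also have "\<dots> \<le> C1 * (C * max 1 (norm x) powr (- 2 * \<theta>) * exp (- (norm (x - y))\<^sup>2 / 16) *
       (exp (- ((norm (x - y))\<^sup>2 / (16 * t))) * t powr (- (d / 2 - (\<sigma> - \<theta>)) - 1)))"
    proof (rule mult_right_mono)
      show "(1 + 4 * t) powr (d / 2) * (1 + 4 * t) powr \<theta> * exp (- d * t) \<le> C1"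
        using C1(2)[of "4 * t"] t by (simp add: powr_add[symmetric] exp_minus field_simps)
    qed (use C in auto)
    finally show ?thesis
      by (simp only: mult.assoc)
  qed
  then show ?thesis
    using C C1 unfolding d_def by (intro exI[of _ "C1 * C"]) auto
qed


section \<open>From the heat kernel to the potential kernel\<close>

lemma hermite_heat_kernel_nonneg: "0 \<le> hermite_heat_kernel t x y"
  by (simp add: hermite_heat_kernel_def)

lemma hermite_heat_kernel_measurable [measurable]:
  "(\<lambda>t. hermite_heat_kernel t x y) \<in> borel_measurable borel"
  unfolding hermite_heat_kernel_def by measurable

lemma potential_kernel_nonneg: "0 < \<sigma> \<Longrightarrow> 0 \<le> potential_kernel \<sigma> x y"
  unfolding potential_kernel_def set_lebesgue_integral_def
  by (intro mult_nonneg_nonneg Bochner_Integration.integral_nonneg)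
    (auto simp: hermite_heat_kernel_nonneg Gamma_real_nonneg)

text \<open>The time integral is taken with \<delta> = |x - y|^2 and \<kappa> = d/2 - (\<sigma> -
  \<theta>), and \<delta>^(-\<kappa>) is the stated power of |x - y|. The hypothesis on \<sigma> -
  \<theta> says \<kappa> > 0.\<close>

lemma nn_integral_time_bound:
  fixes \<sigma> \<theta> :: real
  assumes "0 < \<sigma>" "0 \<le> \<theta>" "\<sigma> - \<theta> < real CARD('n) / 2"
  shows "\<exists>C>0. \<forall>(x::real^'n) y. x \<noteq> y \<longrightarrow>
    (\<integral>\<^sup>+t. ennreal (hermite_heat_kernel t x y * t powr (\<sigma> - 1)) * indicator {0<..} t \<partial>lborel) \<le>
    ennreal (C * max 1 (norm x) powr (- 2 * \<theta>) * norm (x - y) powr (2 * (\<sigma> - \<theta>) - real CARD('n)) *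
      exp (- (norm (x - y))\<^sup>2 / 16))"
proof -
  define \<kappa> where "\<kappa> = real CARD('n) / 2 - (\<sigma> - \<theta>)"
  obtain C1 where C1: "C1 > 0" "\<And>(x::real^'n) y t. t > 0 \<Longrightarrow> hermite_heat_kernel t x y * t powr (\<sigma> - 1) \<le>
    C1 * max 1 (norm x) powr (- 2 * \<theta>) * exp (- (norm (x - y))\<^sup>2 / 16) *
    (exp (- ((norm (x - y))\<^sup>2 / (16 * t))) * t powr (- \<kappa> - 1))"
    using kernel_time_bound[OF assms(1,2), where 'n = 'n] unfolding \<kappa>_def by blast
  obtain C2 where C2: "C2 > 0" "\<And>\<delta>. \<delta> > 0 \<Longrightarrow> (\<integral>\<^sup>+t. ennreal (exp (- (\<delta> / (16 * t))) * t powr (- \<kappa> - 1)) * indicator {0<..} t \<partial>lborel)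
    \<le> ennreal (C2 * \<delta> powr (- \<kappa>))"
    using nn_integral_heat_time[of \<kappa>] assms unfolding \<kappa>_def by auto
  have "(\<integral>\<^sup>+t. ennreal (hermite_heat_kernel t x y * t powr (\<sigma> - 1)) * indicator {0<..} t \<partial>lborel) \<le>
    ennreal (C1 * C2 * max 1 (norm x) powr (- 2 * \<theta>) * norm (x - y) powr (2 * (\<sigma> - \<theta>) - real CARD('n)) *
      exp (- (norm (x - y))\<^sup>2 / 16))" if "x \<noteq> y" for x y :: "real^'n"
  proof -
    define \<delta> where "\<delta> = (norm (x - y))\<^sup>2"
    define B where "B = C1 * max 1 (norm x) powr (- 2 * \<theta>) * exp (- \<delta> / 16)"
    have \<delta>: "0 < \<delta>" using that by (simp add: \<delta>_def)
    have B: "0 \<le> B" using C1 by (simp add: B_def)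
    have "(\<integral>\<^sup>+t. ennreal (hermite_heat_kernel t x y * t powr (\<sigma> - 1)) * indicator {0<..} t \<partial>lborel) \<le>
      (\<integral>\<^sup>+t. ennreal B * (ennreal (exp (- (\<delta> / (16 * t))) * t powr (- \<kappa> - 1)) * indicator {0<..} t) \<partial>lborel)"
      using C1(2) B unfolding B_def \<delta>_def
      by (intro nn_integral_mono) (auto simp: indicator_def ennreal_mult[symmetric] intro!: ennreal_leI)
    also have "\<dots> \<le> ennreal B * ennreal (C2 * \<delta> powr (- \<kappa>))"
      using C2(2)[OF \<delta>] by (subst nn_integral_cmult) (auto intro: mult_left_mono)
    also have "\<dots> = ennreal (B * (C2 * \<delta> powr (- \<kappa>)))"
      using B by (simp add: ennreal_mult')
    also have "\<delta> powr (- \<kappa>) = norm (x - y) powr (2 * (\<sigma> - \<theta>) - real CARD('n))"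
      using that unfolding \<delta>_def \<kappa>_def by (simp add: powr_powr algebra_simps flip: powr_numeral)
    finally show ?thesis
      by (simp add: B_def \<delta>_def mult_ac)
  qed
  then show ?thesis
    using C1(1) C2(1) by (intro exI[of _ "C1 * C2"]) auto
qed

text \<open>Off the diagonal the case \<theta> = 0 of the time bound gives a finite integral, so the
  Bochner integral is not the default value 0 and estimates may be carried out in
  [0, \<infinity>].\<close>

lemma potential_kernel_eq_nn_integral:
  fixes x y :: "real^'n"
  assumes "0 < \<sigma>" "\<sigma> < real CARD('n) / 2" "x \<noteq> y"
  shows "ennreal (potential_kernel \<sigma> x y) = ennreal (1 / Gamma \<sigma>) *
    (\<integral>\<^sup>+t. ennreal (hermite_heat_kernel t x y * t powr (\<sigma> - 1)) * indicator {0<..} t \<partial>lborel)"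
proof -
  let ?F = "\<lambda>t. indicat_real {0<..} t *\<^sub>R (hermite_heat_kernel t x y * t powr (\<sigma> - 1))"
  have eq: "(\<integral>\<^sup>+t. ennreal (hermite_heat_kernel t x y * t powr (\<sigma> - 1)) * indicator {0<..} t \<partial>lborel) =
    (\<integral>\<^sup>+t. ennreal (?F t) \<partial>lborel)"
    by (intro nn_integral_cong) (auto simp: indicator_def)
  have nn: "0 \<le> ?F t" for t
    by (simp add: hermite_heat_kernel_nonneg)
  have "\<exists>B. (\<integral>\<^sup>+t. ennreal (?F t) \<partial>lborel) \<le> ennreal B"
    unfolding eq[symmetric] using nn_integral_time_bound[OF assms(1) order_refl, where 'n='n] assms(2,3)
    unfolding diff_0_right by blast
  then have "(\<integral>\<^sup>+t. ennreal (?F t) \<partial>lborel) < \<infinity>"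
    by (auto intro: le_less_trans)
  then have "integrable lborel ?F"
    using nn by (intro integrableI_nonneg) auto
  then have "(\<integral>\<^sup>+t. ennreal (?F t) \<partial>lborel) = ennreal (integral\<^sup>L lborel ?F)"
    using nn by (intro nn_integral_eq_integral) auto
  then show ?thesis
    unfolding eq potential_kernel_def set_lebesgue_integral_def
    using Gamma_real_nonneg[of \<sigma>] assms by (simp add: ennreal_mult'[symmetric])
qed

text \<open>The weight is \<open>max 1 (norm x)\<close> rather than \<open>norm x\<close> also because \<open>0 powr b = 0\<close>.\<close>

lemma potential_kernel_upper:
  fixes \<sigma> \<theta> :: real
  assumes "0 < \<sigma>" "\<sigma> < real CARD('n) / 2" "0 \<le> \<theta>"
  shows "\<exists>C>0. \<forall>(x::real^'n) y. x \<noteq> y \<longrightarrow> potential_kernel \<sigma> x y \<le>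
    C * max 1 (norm x) powr (- 2 * \<theta>) * norm (x - y) powr (2 * (\<sigma> - \<theta>) - real CARD('n)) *
      exp (- (norm (x - y))\<^sup>2 / 16)"
proof -
  have lt: "\<sigma> - \<theta> < real CARD('n) / 2"
    using assms by linarith
  obtain C where C: "C > 0" "\<And>(x::real^'n) y. x \<noteq> y \<Longrightarrow>
    (\<integral>\<^sup>+t. ennreal (hermite_heat_kernel t x y * t powr (\<sigma> - 1)) * indicator {0<..} t \<partial>lborel) \<le>
    ennreal (C * max 1 (norm x) powr (- 2 * \<theta>) * norm (x - y) powr (2 * (\<sigma> - \<theta>) - real CARD('n)) *
      exp (- (norm (x - y))\<^sup>2 / 16))"
    using nn_integral_time_bound[OF assms(1,3) lt] by blast
  have G: "0 < Gamma \<sigma>" using assms by simp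
  have "potential_kernel \<sigma> x y \<le> 1 / Gamma \<sigma> * C * max 1 (norm x) powr (- 2 * \<theta>) *
    norm (x - y) powr (2 * (\<sigma> - \<theta>) - real CARD('n)) * exp (- (norm (x - y))\<^sup>2 / 16)"
    if "x \<noteq> y" for x y :: "real^'n"
  proof -
    have "ennreal (potential_kernel \<sigma> x y) \<le> ennreal (1 / Gamma \<sigma>) *
      ennreal (C * max 1 (norm x) powr (- 2 * \<theta>) * norm (x - y) powr (2 * (\<sigma> - \<theta>) - real CARD('n)) *
      exp (- (norm (x - y))\<^sup>2 / 16))"
      unfolding potential_kernel_eq_nn_integral[OF assms(1,2) that]
      by (intro mult_left_mono C that) auto
    also have "\<dots> = ennreal (1 / Gamma \<sigma> * (C * max 1 (norm x) powr (- 2 * \<theta>) * norm (x - y) powr (2 * (\<sigma> - \<theta>) - real CARD('n)) *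
      exp (- (norm (x - y))\<^sup>2 / 16)))"
      using G C by (intro ennreal_mult[symmetric]) auto
    finally show ?thesis
      using G C(1) by (subst (asm) ennreal_le_iff) (auto simp: mult.assoc)
  qed
  then show ?thesis
    using G C(1) by (intro exI[of _ "1 / Gamma \<sigma> * C"]) auto
qed

text \<open>Only the times between \<delta>/2 and \<delta> with \<delta> = |x - y|^2 are kept. There
  both terms of the exponent are bounded, the tanh term because \<delta> |x + y|^2 \<le> 9, so the
  integrand is at least of size \<delta>^(\<sigma> - d/2 - 1) on an interval of length
  \<delta>/2.\<close>

lemma potential_kernel_lower:
  fixes \<sigma> :: real
  assumes "0 < \<sigma>" "\<sigma> < real CARD('n) / 2"
  shows "\<exists>c>0. \<forall>(x::real^'n) y. x \<noteq> y \<longrightarrow> norm (x - y) \<le> 1 \<longrightarrow> norm (x - y) * norm (x + y) \<le> 3 \<longrightarrow>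
    c * norm (x - y) powr (2 * \<sigma> - real CARD('n)) \<le> potential_kernel \<sigma> x y"
proof -
  define d where "d = real CARD('n)"
  have d: "0 < d" by (simp add: d_def)
  have G: "0 < Gamma \<sigma>" using assms by simp
  \<comment> \<open>2 pi sinh(2t) \<le> 4 pi exp(2) \<delta> for t \<le> \<delta> \<le> 1; the two
    terms of the exponent are at most 27 and 6, and 33/4 \<le> 9; the last factor comes from t \<ge>
    \<delta>/2.\<close>
  define c where "c = (4 * pi * exp 2) powr (- d / 2) * exp (- 9) * (1 / 2) powr \<sigma>"
  have c: "0 < c" by (simp add: c_def)
  have "1 / Gamma \<sigma> * (c / 2) * norm (x - y) powr (2 * \<sigma> - d) \<le> potential_kernel \<sigma> x y"
    if xy: "x \<noteq> y" "norm (x - y) \<le> 1" "norm (x - y) * norm (x + y) \<le> 3" for x y :: "real^'n"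
  proof -
    define \<delta> where "\<delta> = (norm (x - y))\<^sup>2"
    have \<delta>: "0 < \<delta>" "\<delta> \<le> 1" using xy by (auto simp: \<delta>_def power_le_one)
    have p: "\<delta> * (norm (x + y))\<^sup>2 \<le> 9"
      using power_mono[OF xy(3), of 2] by (simp add: \<delta>_def power_mult_distrib)
    have b: "c * \<delta> powr (\<sigma> - d / 2) / \<delta> \<le> hermite_heat_kernel t x y * t powr (\<sigma> - 1)"
      if t: "\<delta> / 2 \<le> t" "t \<le> \<delta>" for t
    proof -
      have t0: "0 < t" "t \<le> 1" using t \<delta> by linarith+
      have s: "0 < sinh t" "0 < sinh (2 * t)" using t0 by auto
      have "sinh (2 * t) \<le> 2 * t * exp (2 * t)"
        using sinh_le[of "2 * t"] t0 by simp
      also have "\<dots> \<le> 2 * \<delta> * exp 2"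
        using t t0 \<delta> by (intro mult_mono) auto
      finally have "2 * pi * sinh (2 * t) \<le> (4 * pi * exp 2) * \<delta>"
        by simp
      then have 1: "((4 * pi * exp 2) * \<delta>) powr (- d / 2) \<le> (2 * pi * sinh (2 * t)) powr (- d / 2)"
        using s d by (intro powr_mono2') auto
      have e3: "exp t \<le> 3"
        using exp_le t0 order_trans[of "exp t" "exp 1" 3] by simp
      have "tanh t \<le> sinh t"
        using s cosh_real_ge_1[of t] by (simp add: tanh_def divide_le_eq mult_le_cancel_left1)
      also have "\<dots> \<le> \<delta> * 3"
        using sinh_le[of t] t t0 e3 mult_mono[of t \<delta> "exp t" 3] by simp
      finally have "tanh t * (norm (x + y))\<^sup>2 \<le> (\<delta> * 3) * (norm (x + y))\<^sup>2"
        by (rule mult_right_mono) auto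
      then have 2: "tanh t * (norm (x + y))\<^sup>2 \<le> 27"
        using p by simp
      have "cosh t \<le> exp t"
        using t0 by (simp add: cosh_def)
      then have "cosh t / sinh t \<le> 3 / (\<delta> / 2)"
        using le_sinh[of t] t t0 e3 \<delta> by (intro frac_le) auto
      then have "(cosh t / sinh t) * \<delta> \<le> (3 / (\<delta> / 2)) * \<delta>"
        using \<delta> by (intro mult_right_mono) auto
      then have 3: "(cosh t / sinh t) * (norm (x - y))\<^sup>2 \<le> 6"
        using \<delta> by (simp add: \<delta>_def)
      have 4: "exp (- 9) \<le> exp (- (1 / 4) * (tanh t * (norm (x + y))\<^sup>2 + (cosh t / sinh t) * (norm (x - y))\<^sup>2))"
        using 2 3 by simp
      \<comment> \<open>The sign of \<sigma> - 1 is open, so the power is estimated as a quotient,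
        numerator and denominator separately.\<close>
      have "(\<delta> / 2) powr \<sigma> / \<delta> \<le> t powr \<sigma> / t"
        using t t0 \<delta> assms by (intro frac_le powr_mono2) auto
      then have 5: "(\<delta> / 2) powr \<sigma> / \<delta> \<le> t powr (\<sigma> - 1)"
        using t0 by (simp add: powr_diff)
      have "c * \<delta> powr (\<sigma> - d / 2) / \<delta> =
        ((4 * pi * exp 2) * \<delta>) powr (- d / 2) * exp (- 9) * ((\<delta> / 2) powr \<sigma> / \<delta>)"
      proof -
        have "\<delta> powr (\<sigma> - d / 2) = \<delta> powr \<sigma> * \<delta> powr (- d / 2)"
          by (simp add: powr_add[symmetric])
        moreover have "(\<delta> / 2) powr \<sigma> = \<delta> powr \<sigma> * (1 / 2) powr \<sigma>"
          using \<delta> powr_mult[of \<delta> "1/2" \<sigma>] by simp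
        ultimately show ?thesis
          using \<delta> by (simp add: c_def powr_mult)
      qed
      also have "\<dots> \<le> hermite_heat_kernel t x y * t powr (\<sigma> - 1)"
        unfolding hermite_heat_kernel_def d_def[symmetric]
        using 1 4 5 \<delta> by (intro mult_mono) auto
      finally show ?thesis .
    qed
    have "ennreal (1 / Gamma \<sigma> * (c / 2) * \<delta> powr (\<sigma> - d / 2)) =
       ennreal (1 / Gamma \<sigma>) * (ennreal (c * \<delta> powr (\<sigma> - d / 2) / \<delta>) * ennreal (\<delta> / 2))"
      using \<delta> G c by (simp add: ennreal_mult'[symmetric] ennreal_mult''[symmetric])
    also have "\<dots> = ennreal (1 / Gamma \<sigma>) *
      (\<integral>\<^sup>+t. ennreal (c * \<delta> powr (\<sigma> - d / 2) / \<delta>) * indicator {\<delta>/2..\<delta>} t \<partial>lborel)"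
      using \<delta> by (subst nn_integral_cmult_indicator) auto
    also have "\<dots> \<le> ennreal (1 / Gamma \<sigma>) *
      (\<integral>\<^sup>+t. ennreal (hermite_heat_kernel t x y * t powr (\<sigma> - 1)) * indicator {0<..} t \<partial>lborel)"
      using b \<delta> by (intro mult_left_mono nn_integral_mono) (auto simp: indicator_def intro!: ennreal_leI)
    also have "\<dots> = ennreal (potential_kernel \<sigma> x y)"
      using potential_kernel_eq_nn_integral[OF assms xy(1)] by simp
    also have "\<delta> powr (\<sigma> - d / 2) = norm (x - y) powr (2 * \<sigma> - d)"
      using xy unfolding \<delta>_def by (simp add: powr_powr algebra_simps flip: powr_numeral)
    finally show ?thesis
      using potential_kernel_nonneg[of \<sigma> x y] assms by (simp add: ennreal_le_iff)
  qed
  then show ?thesis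
    using G c unfolding d_def by (intro exI[of _ "1 / Gamma \<sigma> * (c / 2)"]) auto
qed


section \<open>Reduction to the unit ball\<close>

text \<open>The integral of the product enters through the real number \<open>a\<close>, so that no power of an
  extended real is taken.\<close>

lemma powr_le_holder:
  fixes \<phi> \<psi> :: "'a \<Rightarrow> real"
  assumes [measurable]: "\<phi> \<in> borel_measurable N" "\<psi> \<in> borel_measurable N"
    and nn: "\<And>y. 0 \<le> \<phi> y" "\<And>y. 0 \<le> \<psi> y"
    and q: "1 < q" "1 < q'" "1 / q + 1 / q' = 1"
    and M: "0 < M" "(\<integral>\<^sup>+y. ennreal (\<psi> y powr q') \<partial>N) \<le> ennreal M"
    and a: "0 \<le> a" "ennreal a \<le> (\<integral>\<^sup>+y. ennreal (\<phi> y * \<psi> y) \<partial>N)"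
  shows "ennreal (a powr q) \<le> ennreal (2 powr q * M powr (q - 1)) * (\<integral>\<^sup>+y. ennreal (\<phi> y powr q) \<partial>N)"
proof (cases "a = 0")
  case False
  with a have a0: "0 < a" by simp
  \<comment> \<open>This scaling makes the \<open>\<psi>\<close> term of Young's inequality at most
    a/2. Being finite, it can be moved to the left, which leaves a/2; the factor 2^q collects both
    twos.\<close>
  define c where "c = (2 * M / a) powr (1 / q')"
  have c: "0 < c" using M a0 by (simp add: c_def)
  have q': "1 / q' = 1 - 1 / q" using q by linarith
  have cq': "c powr (- q') * M = a / 2"
    using M a0 q by (simp add: c_def powr_powr powr_minus)
  have cq: "c powr q = (2 * M / a) powr (q - 1)"
  proof -
    have "1 / q' * q = q - 1"
      unfolding q' using q by (simp add: field_simps)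
    then show ?thesis
      by (simp add: c_def powr_powr)
  qed
  have pt: "\<phi> y * \<psi> y \<le> c powr q * \<phi> y powr q + c powr (- q') * \<psi> y powr q'" for y
  proof -
    have "\<phi> y * \<psi> y = (c * \<phi> y) * (\<psi> y / c)"
      using c by simp
    also have "\<dots> \<le> (c * \<phi> y) powr q / q + (\<psi> y / c) powr q' / q'"
      using q nn c by (intro Youngs_inequality) auto
    also have "\<dots> \<le> (c * \<phi> y) powr q + (\<psi> y / c) powr q'"
      using q by (intro add_mono) (auto simp: divide_le_eq mult_le_cancel_left1)
    also have "\<dots> = c powr q * \<phi> y powr q + c powr (- q') * \<psi> y powr q'"
      using c nn by (simp add: powr_mult powr_divide powr_minus field_simps)
    finally show ?thesis .
  qed
  let ?B = "\<integral>\<^sup>+y. ennreal (\<phi> y powr q) \<partial>N"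
  have "ennreal a \<le> (\<integral>\<^sup>+y. ennreal (c powr q) * ennreal (\<phi> y powr q) + ennreal (c powr (- q')) * ennreal (\<psi> y powr q') \<partial>N)"
    using pt by (intro order_trans[OF a(2)] nn_integral_mono)
      (simp add: ennreal_mult[symmetric] ennreal_plus[symmetric] del: ennreal_plus)
  also have "\<dots> = ennreal (c powr q) * ?B + ennreal (c powr (- q')) * (\<integral>\<^sup>+y. ennreal (\<psi> y powr q') \<partial>N)"
    by (simp add: nn_integral_add nn_integral_cmult)
  also have "\<dots> \<le> ennreal (c powr q) * ?B + ennreal (c powr (- q')) * ennreal M"
    by (intro add_left_mono mult_left_mono M) auto
  also have "ennreal (c powr (- q')) * ennreal M = ennreal (a / 2)"
    using M by (simp add: ennreal_mult[symmetric] cq')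
  finally have "ennreal a \<le> ennreal (c powr q) * ?B + ennreal (a / 2)" .
  then have "ennreal a - ennreal (a / 2) \<le> ennreal (c powr q) * ?B"
    by (simp add: ennreal_minus_le_iff add.commute)
  then have "ennreal (a / 2) \<le> ennreal (c powr q) * ?B"
    using a0 by (simp add: ennreal_minus)
  then have "ennreal (2 * a powr (q - 1)) * ennreal (a / 2) \<le> ennreal (2 * a powr (q - 1)) * (ennreal (c powr q) * ?B)"
    by (rule mult_left_mono) auto
  moreover have "ennreal (2 * a powr (q - 1)) * ennreal (a / 2) = ennreal (a powr q)"
    using a0 by (simp add: ennreal_mult[symmetric] powr_diff)
  moreover have "2 * a powr (q - 1) * c powr q = 2 powr q * M powr (q - 1)"
    unfolding cq using a0 M by (simp add: powr_divide powr_mult powr_diff)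
  ultimately show ?thesis
    by (simp add: mult.assoc[symmetric] ennreal_mult[symmetric])
qed simp

text \<open>Borel measurability, the sign and, for p = \<infinity>, the bound hold at every point,
  so the kernel estimates need no exceptional sets. Comparing the integral of the power with 1
  avoids the root in \<open>Lp_norm\<close>.\<close>

definition unit_ball_Lp :: "ennreal \<Rightarrow> (real^'n \<Rightarrow> real) set" where
  "unit_ball_Lp p = {g \<in> borel_measurable borel. (\<forall>x. 0 \<le> g x) \<and>
     (if p = \<infinity> then \<forall>x. g x \<le> 1 else (\<integral>\<^sup>+x. ennreal (g x powr enn2real p) \<partial>lborel) \<le> 1)}"

lemma unit_ball_LpD:
  assumes "g \<in> unit_ball_Lp p"
  shows "g \<in> borel_measurable borel" "g \<in> borel_measurable lebesgue" "\<And>x. 0 \<le> g x"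
  using assms by (auto simp: unit_ball_Lp_def intro!: measurable_completion)

lemma potential_operator_nonneg:
  assumes "0 < \<sigma>" "\<And>y. 0 \<le> g y"
  shows "0 \<le> potential_operator \<sigma> g x"
  unfolding potential_operator_def
  by (intro Bochner_Integration.integral_nonneg mult_nonneg_nonneg potential_kernel_nonneg assms)

lemma potential_operator_cong_AE:
  fixes f g :: "real^'n \<Rightarrow> real"
  assumes "f \<in> borel_measurable lebesgue" "g \<in> borel_measurable lebesgue" "AE x in lebesgue. f x = g x"
  shows "potential_operator \<sigma> f = potential_operator \<sigma> g"
  unfolding potential_operator_def
  using assms by (intro ext integral_cong_AE potential_kernel_mult_measurable) auto

lemma potential_operator_abs_le:
  assumes "0 < \<sigma>"
  shows "\<bar>potential_operator \<sigma> f x\<bar> \<le> potential_operator \<sigma> (\<lambda>y. \<bar>f y\<bar>) x"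
proof -
  have "\<bar>potential_operator \<sigma> f x\<bar> \<le> (LINT y|lebesgue. \<bar>potential_kernel \<sigma> x y * f y\<bar>)"
    unfolding potential_operator_def by (rule integral_abs_bound)
  then show ?thesis
    unfolding potential_operator_def by (simp add: abs_mult potential_kernel_nonneg[OF assms])
qed

lemma potential_operator_cmult: "potential_operator \<sigma> (\<lambda>y. c * f y) x = c * potential_operator \<sigma> f x"
  unfolding potential_operator_def by (simp add: mult.left_commute)

text \<open>An inequality at every x, without any integrability: if the integral diverges, the
  left-hand side is the default value 0.\<close>

lemma potential_operator_le_nn_integral:
  fixes g :: "real^'n \<Rightarrow> real"
  assumes "0 < \<sigma>" and [measurable]: "g \<in> borel_measurable borel" and "\<And>y. 0 \<le> g y"
  shows "ennreal (potential_operator \<sigma> g x) \<le> (\<integral>\<^sup>+y. ennreal (potential_kernel \<sigma> x y * g y) \<partial>lborel)"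
proof (cases "integrable lebesgue (\<lambda>y. potential_kernel \<sigma> x y * g y)")
  case True
  have "(\<integral>\<^sup>+y. ennreal (potential_kernel \<sigma> x y * g y) \<partial>lebesgue) = ennreal (potential_operator \<sigma> g x)"
    unfolding potential_operator_def using True assms potential_kernel_nonneg[OF assms(1)]
    by (intro nn_integral_eq_integral) (auto intro!: AE_I2 mult_nonneg_nonneg)
  then show ?thesis
    by (simp add: nn_integral_completion)
qed (simp add: potential_operator_def not_integrable_integral_eq)

text \<open>Homogeneity: after passing to a Borel representative, |f| is divided by its norm. Norm 0
  cannot be normalised, but then f vanishes almost everywhere and the operator is 0 at every
  point.\<close>

lemma Lp_space_cases:
  fixes f :: "real^'n \<Rightarrow> real"
  assumes \<sigma>: "0 < \<sigma>" and f: "f \<in> Lp_space p" and p: "1 \<le> p"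
  obtains (zero) "Lp_norm p f = 0" "\<And>x. potential_operator \<sigma> f x = 0"
  | (nonzero) c g where "0 < c" "Lp_norm p f = ennreal c" "g \<in> unit_ball_Lp p"
      "\<And>x. \<bar>potential_operator \<sigma> f x\<bar> \<le> c * potential_operator \<sigma> g x"
proof -
  have fm [measurable]: "f \<in> borel_measurable lebesgue" and fin: "Lp_norm p f < \<infinity>"
    using f by (auto simp: Lp_space_def)
  obtain h where hm [measurable]: "h \<in> borel_measurable borel" and h: "AE x in lebesgue. f x = h x"
    using lebesgue_borel_representative[OF fm] .
  define c where "c = enn2real (Lp_norm p f)"
  have c: "Lp_norm p f = ennreal c" "0 \<le> c"
    using fin by (auto simp: c_def)
  have z: thesis if "AE x in lebesgue. f x = 0" "c = 0"
  proof (rule zero)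
    show "Lp_norm p f = 0" using c that by simp
    show "potential_operator \<sigma> f x = 0" for x
      using potential_operator_cong_AE[OF fm _ that(1)] by (simp add: potential_operator_def)
  qed
  have bound: "\<bar>potential_operator \<sigma> f x\<bar> \<le> c * potential_operator \<sigma> g x"
    if g: "g \<in> borel_measurable borel" "AE x in lebesgue. \<bar>h x\<bar> = c * g x" for g x
  proof -
    have "potential_operator \<sigma> (\<lambda>y. \<bar>f y\<bar>) = potential_operator \<sigma> (\<lambda>y. c * g y)"
    proof (rule potential_operator_cong_AE)
      show "(\<lambda>y. c * g y) \<in> borel_measurable lebesgue"
        using g(1) by (intro measurable_completion) simp
      show "AE x in lebesgue. \<bar>f x\<bar> = c * g x"
        using h g(2) by eventually_elim simp
    qed simp
    then show ?thesis
      using potential_operator_abs_le[OF \<sigma>, of f x] by (simp add: potential_operator_cmult)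
  qed
  show thesis
  proof (cases "p = \<infinity>")
    case True
    have "AE x in lebesgue. ennreal \<bar>f x\<bar> \<le> ennreal c"
      using esssup_AE[of "\<lambda>x. ennreal \<bar>f x\<bar>" lebesgue] c True by (simp add: Lp_norm_def)
    then have le: "AE x in lebesgue. \<bar>f x\<bar> \<le> c"
      using c by simp
    show thesis
    proof (cases "c = 0")
      case True
      with le z show thesis by simp
    next
      case False
      with c have c0: "0 < c" by simp
      \<comment> \<open>The quotient |h|/c is at most 1 only almost everywhere; the minimum enforces
        it everywhere and changes it only on a null set.\<close>
      have "(\<lambda>x. min 1 (\<bar>h x\<bar> / c)) \<in> unit_ball_Lp p"
        using c0 \<open>p = \<infinity>\<close> by (auto simp: unit_ball_Lp_def)
      moreover have "AE x in lebesgue. \<bar>h x\<bar> = c * min 1 (\<bar>h x\<bar> / c)"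
        using le h by eventually_elim (use c0 in \<open>auto simp: min_def field_simps\<close>)
      ultimately show thesis
        using nonzero[OF c0 c(1)] bound by simp
    qed
  next
    case False
    define P where "P = enn2real p"
    have P: "1 \<le> P"
      using p False enn2real_mono[of 1 p] by (simp add: P_def less_top)
    define A where "A = (\<integral>\<^sup>+x. ennreal (\<bar>f x\<bar> powr P) \<partial>lebesgue)"
    have "Lp_norm p f = ennreal_rpow A (1 / P)"
      using False by (simp add: Lp_norm_def A_def P_def)
    with fin have A: "A \<noteq> \<infinity>" "c = enn2real A powr (1 / P)"
      by (auto simp: ennreal_rpow_def c_def split: if_splits)
    have "A = (\<integral>\<^sup>+x. ennreal (\<bar>h x\<bar> powr P) \<partial>lebesgue)"
      unfolding A_def using h by (intro nn_integral_cong_AE) auto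
    then have Ah: "A = (\<integral>\<^sup>+x. ennreal (\<bar>h x\<bar> powr P) \<partial>lborel)"
      by (simp add: nn_integral_completion)
    have AcP: "A = ennreal (c powr P)"
      using A P by (simp add: powr_powr ennreal_enn2real_if)
    show thesis
    proof (cases "c = 0")
      case True
      then have "A = 0" using AcP P by simp
      then have "AE x in lebesgue. ennreal (\<bar>f x\<bar> powr P) = 0"
        unfolding A_def by (subst (asm) nn_integral_0_iff_AE) auto
      then have "AE x in lebesgue. f x = 0"
        by eventually_elim (auto simp: ennreal_eq_0_iff)
      then show thesis using z True by simp
    next
      case False
      with c have c0: "0 < c" by simp
      have "(\<integral>\<^sup>+x. ennreal ((\<bar>h x\<bar> / c) powr P) \<partial>lborel) = (\<integral>\<^sup>+x. ennreal (\<bar>h x\<bar> powr P) / ennreal (c powr P) \<partial>lborel)"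
        using c0 by (intro nn_integral_cong) (simp add: powr_divide divide_ennreal)
      also have "\<dots> = A / ennreal (c powr P)"
        unfolding Ah by (intro nn_integral_divide) simp
      also have "\<dots> = 1"
        unfolding AcP using c0 by (simp add: divide_ennreal)
      finally have "(\<lambda>x. \<bar>h x\<bar> / c) \<in> unit_ball_Lp p"
        using c0 \<open>p \<noteq> \<infinity>\<close> by (auto simp: unit_ball_Lp_def P_def)
      then show thesis
        using nonzero[OF c0 c(1)] bound c0 by simp
    qed
  qed
qed

section \<open>Mapping properties tested on normalised functions\<close>

lemma ennreal_rpow_mono: "u \<le> v \<Longrightarrow> 0 \<le> a \<Longrightarrow> ennreal_rpow u a \<le> ennreal_rpow v a"
  by (auto simp: ennreal_rpow_def top_unique less_top intro!: ennreal_leI powr_mono2 enn2real_mono)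

lemma ennreal_rpow_ennreal: "0 \<le> u \<Longrightarrow> ennreal_rpow (ennreal u) a = ennreal (u powr a)"
  by (simp add: ennreal_rpow_def)

lemma bounded_Lp_Lq_finiteI:
  fixes \<sigma> :: real
  assumes \<sigma>: "0 < \<sigma>" and p: "1 \<le> p" and Q: "1 \<le> Q" and M: "0 < M"
    and H: "\<And>g::real^'n \<Rightarrow> real. g \<in> unit_ball_Lp p \<Longrightarrow>
      (\<integral>\<^sup>+x. ennreal (potential_operator \<sigma> g x powr Q) \<partial>lebesgue) \<le> ennreal M"
  shows "bounded_Lp_Lq (potential_operator \<sigma> :: (real^'n \<Rightarrow> real) \<Rightarrow> _) p (ennreal Q)"
proof -
  have "potential_operator \<sigma> f \<in> Lp_space (ennreal Q) \<and>
    Lp_norm (ennreal Q) (potential_operator \<sigma> f) \<le> ennreal (M powr (1 / Q)) * Lp_norm p f"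
    if f: "f \<in> Lp_space p" for f :: "real^'n \<Rightarrow> real"
  proof -
    have m: "potential_operator \<sigma> f \<in> borel_measurable lebesgue"
      using f by (intro potential_operator_measurable) (simp add: Lp_space_def)
    have "Lp_norm (ennreal Q) (potential_operator \<sigma> f) \<le> ennreal (M powr (1 / Q)) * Lp_norm p f"
      using \<sigma> f p
    proof (cases rule: Lp_space_cases)
      case zero
      then show ?thesis
        using Q by (simp add: Lp_norm_def ennreal_rpow_def)
    next
      case (nonzero c g)
      have gm: "potential_operator \<sigma> g \<in> borel_measurable lebesgue" and gn: "0 \<le> potential_operator \<sigma> g x" for x
        using unit_ball_LpD[OF nonzero(3)] by (auto intro!: potential_operator_nonneg potential_operator_measurable \<sigma>)
      have "(\<integral>\<^sup>+x. ennreal (\<bar>potential_operator \<sigma> f x\<bar> powr Q) \<partial>lebesgue) \<le>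
        (\<integral>\<^sup>+x. ennreal (c powr Q) * ennreal (potential_operator \<sigma> g x powr Q) \<partial>lebesgue)"
      proof (rule nn_integral_mono)
        fix x
        have "\<bar>potential_operator \<sigma> f x\<bar> powr Q \<le> (c * potential_operator \<sigma> g x) powr Q"
          using Q nonzero(4) by (intro powr_mono2) auto
        then show "ennreal (\<bar>potential_operator \<sigma> f x\<bar> powr Q) \<le> ennreal (c powr Q) * ennreal (potential_operator \<sigma> g x powr Q)"
          using nonzero(1) gn by (simp add: powr_mult ennreal_mult[symmetric] ennreal_leI)
      qed
      also have "\<dots> \<le> ennreal (c powr Q) * ennreal M"
        using gm H[OF nonzero(3)] by (subst nn_integral_cmult) (auto intro: mult_left_mono)
      also have "\<dots> = ennreal (c powr Q * M)"
        using M by (simp add: ennreal_mult)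
      finally have "ennreal_rpow (\<integral>\<^sup>+x. ennreal (\<bar>potential_operator \<sigma> f x\<bar> powr Q) \<partial>lebesgue) (1 / Q) \<le> ennreal ((c powr Q * M) powr (1 / Q))"
        using Q M ennreal_rpow_mono[of _ "ennreal (c powr Q * M)" "1 / Q"] by (simp add: ennreal_rpow_ennreal)
      also have "(c powr Q * M) powr (1 / Q) = M powr (1 / Q) * c"
        using nonzero(1) M Q by (simp add: powr_mult powr_powr)
      finally show ?thesis
        using Q nonzero(1,2) by (simp add: Lp_norm_def ennreal_mult)
    qed
    moreover from this have "Lp_norm (ennreal Q) (potential_operator \<sigma> f) < \<infinity>"
      using f by (auto simp: Lp_space_def ennreal_mult_less_top intro: le_less_trans)
    ultimately show ?thesis
      using m by (simp add: Lp_space_def)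
  qed
  then show ?thesis
    unfolding bounded_Lp_Lq_def using M by (intro exI[of _ "M powr (1 / Q)"]) auto
qed

lemma bounded_Lp_Lq_infI:
  fixes \<sigma> :: real
  assumes \<sigma>: "0 < \<sigma>" and p: "1 \<le> p" and M: "0 < M"
    and H: "\<And>(g::real^'n \<Rightarrow> real) x. g \<in> unit_ball_Lp p \<Longrightarrow> potential_operator \<sigma> g x \<le> M"
  shows "bounded_Lp_Lq (potential_operator \<sigma> :: (real^'n \<Rightarrow> real) \<Rightarrow> _) p \<infinity>"
proof -
  have "potential_operator \<sigma> f \<in> Lp_space \<infinity> \<and>
    Lp_norm \<infinity> (potential_operator \<sigma> f) \<le> ennreal M * Lp_norm p f"
    if f: "f \<in> Lp_space p" for f :: "real^'n \<Rightarrow> real"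
  proof -
    have m [measurable]: "potential_operator \<sigma> f \<in> borel_measurable lebesgue"
      using f by (intro potential_operator_measurable) (simp add: Lp_space_def)
    have "Lp_norm \<infinity> (potential_operator \<sigma> f) \<le> ennreal M * Lp_norm p f"
      using \<sigma> f p
    proof (cases rule: Lp_space_cases)
      case zero
      then show ?thesis
        using esssup_I[of "\<lambda>_. 0 :: ennreal" "lebesgue :: (real^'n) measure" 0] by (simp add: Lp_norm_def)
    next
      case (nonzero c g)
      have "\<bar>potential_operator \<sigma> f x\<bar> \<le> M * c" for x
        using order_trans[OF nonzero(4) mult_left_mono[OF H[OF nonzero(3)]]] nonzero(1)
        by (simp add: mult.commute)
      then show ?thesis
        using nonzero(1,2) M
        by (auto simp: Lp_norm_def ennreal_mult[symmetric] intro!: esssup_I AE_I2 ennreal_leI)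
    qed
    moreover from this have "Lp_norm \<infinity> (potential_operator \<sigma> f) < \<infinity>"
      using f by (auto simp: Lp_space_def ennreal_mult_less_top intro: le_less_trans)
    ultimately show ?thesis
      using m by (simp add: Lp_space_def)
  qed
  then show ?thesis
    unfolding bounded_Lp_Lq_def using M by (intro exI[of _ M]) auto
qed

lemma weak_type_finiteI:
  fixes \<sigma> :: real
  assumes \<sigma>: "0 < \<sigma>" and p: "1 \<le> p" and Q: "1 \<le> Q" and M: "0 < M"
    and H: "\<And>(g::real^'n \<Rightarrow> real) s. g \<in> unit_ball_Lp p \<Longrightarrow> 0 < s \<Longrightarrow>
      emeasure lebesgue {x. s < potential_operator \<sigma> g x} \<le> ennreal (M * s powr (- Q))"
  shows "weak_type (potential_operator \<sigma> :: (real^'n \<Rightarrow> real) \<Rightarrow> _) p (ennreal Q)"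
proof -
  have "emeasure lebesgue {x. s < \<bar>potential_operator \<sigma> f x\<bar>} \<le>
      ennreal M * ennreal_rpow (Lp_norm p f / ennreal s) Q"
    if f: "f \<in> Lp_space p" and s: "0 < s" for f :: "real^'n \<Rightarrow> real" and s
    using \<sigma> f p
  proof (cases rule: Lp_space_cases)
    case zero
    then show ?thesis
      using s by simp
  next
    case (nonzero c g)
    have [measurable]: "potential_operator \<sigma> g \<in> borel_measurable lebesgue"
      using unit_ball_LpD[OF nonzero(3)] by (auto intro!: potential_operator_measurable)
    have "{x. s < \<bar>potential_operator \<sigma> f x\<bar>} \<subseteq> {x. s / c < potential_operator \<sigma> g x}"
      using nonzero(1,4) by (auto simp: divide_less_eq mult.commute intro: less_le_trans)
    then have "emeasure lebesgue {x. s < \<bar>potential_operator \<sigma> f x\<bar>} \<le> emeasure lebesgue {x. s / c < potential_operator \<sigma> g x}"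
    proof (rule emeasure_mono)
      have "{x \<in> space lebesgue. s / c < potential_operator \<sigma> g x} \<in> sets lebesgue"
        by measurable
      then show "{x. s / c < potential_operator \<sigma> g x} \<in> sets lebesgue"
        by simp
    qed
    also have "\<dots> \<le> ennreal (M * (s / c) powr (- Q))"
      using nonzero s by (intro H) auto
    also have "(s / c) powr (- Q) = (c / s) powr Q"
      using nonzero s by (simp add: powr_divide powr_minus field_simps)
    finally show ?thesis
      using nonzero s M by (simp add: divide_ennreal ennreal_rpow_ennreal ennreal_mult)
  qed
  then show ?thesis
    unfolding weak_type_def weak_type_bound_def using M Q by (intro exI[of _ M]) auto
qed


section \<open>Strong type away from the lower edge\<close>

lemma ennreal_less_top_bound: "x < (\<infinity>::ennreal) \<Longrightarrow> \<exists>M>0. x \<le> ennreal M"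
  by (cases x) (auto intro: exI[of _ "enn2real x + 1"])

lemma nn_integral_translate_reflect:
  fixes x :: "'a::euclidean_space"
  assumes [measurable]: "\<phi> \<in> borel_measurable borel"
  shows "(\<integral>\<^sup>+y. \<phi> (x - y) \<partial>lborel) = (\<integral>\<^sup>+z. \<phi> z \<partial>lborel)" (is ?a)
    and "(\<integral>\<^sup>+y. \<phi> (y - x) \<partial>lborel) = (\<integral>\<^sup>+z. \<phi> z \<partial>lborel)" (is ?b)
proof -
  have affine: "(\<integral>\<^sup>+y. \<phi> (t + c *\<^sub>R y) \<partial>lborel) = (\<integral>\<^sup>+z. \<phi> z \<partial>lborel)" if "\<bar>c\<bar> = 1" for t c
  proof -
    have "c \<noteq> 0" using that by auto
    have "(\<integral>\<^sup>+z. \<phi> z \<partial>lborel) = (\<integral>\<^sup>+z. \<phi> z \<partial>density (distr lborel borel (\<lambda>x. t + c *\<^sub>R x)) (\<lambda>_. \<bar>c\<bar> ^ DIM('a)))"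
      using lborel_affine[OF \<open>c \<noteq> 0\<close>, of t] by simp
    then show ?thesis
      by (simp add: that density_1 nn_integral_distr)
  qed
  show ?a
    using affine[of "- 1" x] by simp
  show ?b
    using affine[of 1 "- x"] by (simp add: add.commute)
qed

lemma nn_integral_convolution:
  fixes k g :: "'a::euclidean_space \<Rightarrow> ennreal"
  assumes [measurable]: "k \<in> borel_measurable borel" "g \<in> borel_measurable borel"
  shows "(\<integral>\<^sup>+x. \<integral>\<^sup>+y. k (x - y) * g y \<partial>lborel \<partial>lborel) = (\<integral>\<^sup>+z. k z \<partial>lborel) * (\<integral>\<^sup>+y. g y \<partial>lborel)"
proof -
  have "(\<integral>\<^sup>+x. \<integral>\<^sup>+y. k (x - y) * g y \<partial>lborel \<partial>lborel) = (\<integral>\<^sup>+y. \<integral>\<^sup>+x. k (x - y) * g y \<partial>lborel \<partial>lborel)"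
    by (rule lborel_pair.Fubini') measurable
  also have "\<dots> = (\<integral>\<^sup>+y. (\<integral>\<^sup>+z. k z \<partial>lborel) * g y \<partial>lborel)"
    by (simp add: nn_integral_multc nn_integral_translate_reflect(2))
  finally show ?thesis
    by (simp add: nn_integral_cmult)
qed

lemma nn_integral_powr_exp_finite:
  fixes b :: real
  assumes "b < DIM('a::euclidean_space)"
  shows "\<exists>M>0. (\<integral>\<^sup>+z. ennreal (norm (z::'a) powr (- b) * exp (- (norm z)\<^sup>2 / 16)) \<partial>lborel) \<le> ennreal M"
proof -
  \<comment> \<open>Chosen so that the Gaussian, traded for |z|^(-2\<kappa>) outside the unit ball,
    brings the decay to the integrable power -(d + 1).\<close>
  define \<kappa> where "\<kappa> = (DIM('a) + 1 - b) / 2"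
  have \<kappa>: "0 < \<kappa>" "2 * \<kappa> + b = real DIM('a) + 1" using assms by (auto simp: \<kappa>_def add_divide_distrib diff_divide_distrib)
  obtain C where C: "C > 0" "\<And>u. 0 < u \<Longrightarrow> exp (- (1/16 * u)) \<le> C * u powr (- \<kappa>)"
    using exp_minus_le_powr[of \<kappa> "1/16"] \<kappa> by auto
  let ?b = "real DIM('a) + 1"
  let ?A = "\<lambda>z::'a. ennreal (norm z powr (- b)) * indicator {0..1} (norm z)"
  let ?B = "\<lambda>z::'a. ennreal (norm z powr (- ?b)) * indicator {1..} (norm z)"
  have le: "ennreal (norm z powr (- b) * exp (- (norm z)\<^sup>2 / 16)) \<le> ?A z + ennreal C * ?B z" for z
  proof (cases "norm z \<le> 1")
    case True
    then have "ennreal (norm z powr (- b) * exp (- (norm z)\<^sup>2 / 16)) \<le> ?A z"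
      by (auto intro!: ennreal_leI mult_left_le)
    then show ?thesis
      by (rule order_trans) simp
  next
    case False
    then have n: "0 < norm z" "0 < (norm z)\<^sup>2" by (auto simp: zero_less_power2)
    have "exp (- (norm z)\<^sup>2 / 16) \<le> C * ((norm z)\<^sup>2) powr (- \<kappa>)"
      using C(2)[OF n(2)] by simp
    also have "((norm z)\<^sup>2) powr (- \<kappa>) = norm z powr (- 2 * \<kappa>)"
      using n by (simp add: powr_powr flip: powr_numeral)
    finally have "norm z powr (- b) * exp (- (norm z)\<^sup>2 / 16) \<le> norm z powr (- b) * (C * norm z powr (- 2 * \<kappa>))"
      by (rule mult_left_mono) simp
    also have "\<dots> = C * (norm z powr (- b) * norm z powr (- 2 * \<kappa>))"
      by simp
    also have "norm z powr (- b) * norm z powr (- 2 * \<kappa>) = norm z powr (- ?b)"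
    proof -
      have "- b + - 2 * \<kappa> = - ?b"
        using \<kappa>(2) by linarith
      then show ?thesis
        by (simp only: powr_add[symmetric])
    qed
    finally show ?thesis
      using False C by (simp add: ennreal_mult[symmetric] ennreal_leI)
  qed
  have "(\<integral>\<^sup>+z. ennreal (norm (z::'a) powr (- b) * exp (- (norm z)\<^sup>2 / 16)) \<partial>lborel) \<le> (\<integral>\<^sup>+z. ?A z + ennreal C * ?B z \<partial>lborel)"
    by (intro nn_integral_mono le)
  also have "\<dots> = (\<integral>\<^sup>+z. ?A z \<partial>lborel) + ennreal C * (\<integral>\<^sup>+z. ?B z \<partial>lborel)"
    by (simp add: nn_integral_add nn_integral_cmult)
  also have "\<dots> < \<infinity>"
    using nn_integral_powr_norm_le[where 'a='a, of b 1] nn_integral_powr_norm_ge[where 'a='a, of ?b 1] assms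
    by (simp add: ennreal_mult_less_top del: minus_add_distrib)
  finally have fin: "(\<integral>\<^sup>+z. ennreal (norm (z::'a) powr (- b) * exp (- (norm z)\<^sup>2 / 16)) \<partial>lborel) < \<infinity>" .
  then show ?thesis
    by (rule ennreal_less_top_bound)
qed

lemma AE_lborel_neq: "AE y in lborel. x \<noteq> (y :: 'a::euclidean_space)"
  by (rule AE_I[of _ _ "{x}"]) auto

text \<open>The condition on r is local integrability of the r-th power of |z|^(2(\<sigma> -
  \<theta>) - d) at the origin; the Gaussian takes care of infinity. The kernel is thus bounded by a
  weight in x times a convolution kernel in L^r, ready for Young's inequality.\<close>

lemma potential_kernel_dominated:
  fixes \<sigma> \<theta> r :: real
  assumes "0 < \<sigma>" "\<sigma> < real CARD('n) / 2" "0 \<le> \<theta>" "1 \<le> r"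
    and "r * (real CARD('n) - 2 * (\<sigma> - \<theta>)) < real CARD('n)"
  shows "\<exists>k M. k \<in> borel_measurable borel \<and> (\<forall>z::real^'n. 0 \<le> k z) \<and> 0 < M \<and>
    (\<integral>\<^sup>+z. ennreal (k z powr r) \<partial>lborel) \<le> ennreal M \<and>
    (\<forall>x y. x \<noteq> y \<longrightarrow> potential_kernel \<sigma> x y \<le> max 1 (norm x) powr (- 2 * \<theta>) * k (x - y))"
proof -
  define d where "d = real CARD('n)"
  obtain C where C: "C > 0" "\<And>(x::real^'n) y. x \<noteq> y \<Longrightarrow> potential_kernel \<sigma> x y \<le>
    C * max 1 (norm x) powr (- 2 * \<theta>) * norm (x - y) powr (2 * (\<sigma> - \<theta>) - d) *
      exp (- (norm (x - y))\<^sup>2 / 16)"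
    using potential_kernel_upper[OF assms(1-3)] unfolding d_def by blast
  define k where "k = (\<lambda>z::real^'n. C * (norm z powr (2 * (\<sigma> - \<theta>) - d) * exp (- (norm z)\<^sup>2 / 16)))"
  let ?b = "r * (d - 2 * (\<sigma> - \<theta>))"
  obtain M where M: "M > 0" "(\<integral>\<^sup>+z. ennreal (norm (z::real^'n) powr (- ?b) * exp (- (norm z)\<^sup>2 / 16)) \<partial>lborel) \<le> ennreal M"
    using nn_integral_powr_exp_finite[where 'a="real^'n", of ?b] assms(5) by (auto simp: d_def)
  have "k z powr r \<le> C powr r * (norm z powr (- ?b) * exp (- (norm z)\<^sup>2 / 16))" for z
  proof -
    have "k z powr r = C powr r * (norm z powr (- ?b) * exp (- (norm z)\<^sup>2 / 16) powr r)"
      using C by (simp add: k_def powr_mult powr_powr algebra_simps)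
    also have "exp (- (norm z)\<^sup>2 / 16) powr r = exp (r * (- (norm z)\<^sup>2 / 16))"
      by (simp add: exp_powr_real mult.commute)
    also have "\<dots> \<le> exp (- (norm z)\<^sup>2 / 16)"
      using assms(4) by (simp add: mult_le_cancel_right1)
    finally show ?thesis
      by (simp add: mult_left_mono)
  qed
  then have "(\<integral>\<^sup>+z. ennreal (k z powr r) \<partial>lborel) \<le>
    (\<integral>\<^sup>+z. ennreal (C powr r) * ennreal (norm (z::real^'n) powr (- ?b) * exp (- (norm z)\<^sup>2 / 16)) \<partial>lborel)"
    by (intro nn_integral_mono) (simp add: ennreal_mult[symmetric] ennreal_leI)
  also have "\<dots> \<le> ennreal (C powr r) * ennreal M"
    using M by (subst nn_integral_cmult) (auto intro: mult_left_mono)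
  also have "\<dots> = ennreal (C powr r * M)"
    using M by (simp add: ennreal_mult)
  finally have "(\<integral>\<^sup>+z. ennreal (k z powr r) \<partial>lborel) \<le> ennreal (C powr r * M)" .
  moreover have "k \<in> borel_measurable borel" "\<forall>z. 0 \<le> k z"
    using C by (auto simp: k_def)
  moreover have "0 < C powr r * M"
    using C M by simp
  moreover have "potential_kernel \<sigma> x y \<le> max 1 (norm x) powr (- 2 * \<theta>) * k (x - y)" if "x \<noteq> y" for x y :: "real^'n"
    using C(2)[OF that] by (simp add: k_def mult_ac)
  ultimately show ?thesis by blast
qed

lemma potential_operator_le_majorant:
  fixes g :: "real^'n \<Rightarrow> real"
  assumes "0 < \<sigma>" and [measurable]: "g \<in> borel_measurable borel" "k \<in> borel_measurable borel"
    and "\<And>y. 0 \<le> g y" "\<And>y. x \<noteq> y \<Longrightarrow> potential_kernel \<sigma> x y \<le> w * k (x - y)" "0 < w"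
  shows "ennreal (potential_operator \<sigma> g x / w) \<le> (\<integral>\<^sup>+y. ennreal (k (x - y) * g y) \<partial>lborel)"
proof -
  have "ennreal (potential_operator \<sigma> g x) \<le> (\<integral>\<^sup>+y. ennreal (potential_kernel \<sigma> x y * g y) \<partial>lborel)"
    by (rule potential_operator_le_nn_integral) (use assms in auto)
  also have "\<dots> \<le> (\<integral>\<^sup>+y. ennreal w * ennreal (k (x - y) * g y) \<partial>lborel)"
    using AE_lborel_neq[of x]
  proof (intro nn_integral_mono_AE, eventually_elim)
    case (elim y)
    then have "potential_kernel \<sigma> x y * g y \<le> w * k (x - y) * g y"
      using assms by (intro mult_right_mono) auto
    then show ?case
      using assms(6) by (simp add: ennreal_mult'[symmetric] mult.assoc ennreal_leI)
  qed
  also have "\<dots> = ennreal w * (\<integral>\<^sup>+y. ennreal (k (x - y) * g y) \<partial>lborel)"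
    by (rule nn_integral_cmult) measurable
  finally have "ennreal (1 / w) * ennreal (potential_operator \<sigma> g x) \<le> ennreal (1 / w) * (ennreal w * (\<integral>\<^sup>+y. ennreal (k (x - y) * g y) \<partial>lborel))"
    by (rule mult_left_mono) simp
  then show ?thesis
    using assms(6) by (simp add: mult.assoc[symmetric] ennreal_mult'[symmetric])
qed

text \<open>Jensen's inequality for the measure k dN of mass at most M, with the factor 2^P
  inherited from \<open>powr_le_holder\<close>: split k = k^(1/P) k^(1/P') and apply it to k^(1/P) g
  and k^(1/P'). P = 1 has no conjugate exponent and is trivial.\<close>

lemma powr_le_jensen:
  fixes k g :: "'a \<Rightarrow> real"
  assumes [measurable]: "k \<in> borel_measurable N" "g \<in> borel_measurable N"
    and nn: "\<And>y. 0 \<le> k y" "\<And>y. 0 \<le> g y"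
    and P: "1 \<le> P" and M: "0 < M" "(\<integral>\<^sup>+y. ennreal (k y) \<partial>N) \<le> ennreal M"
    and a: "0 \<le> a" "ennreal a \<le> (\<integral>\<^sup>+y. ennreal (k y * g y) \<partial>N)"
  shows "ennreal (a powr P) \<le> ennreal (2 powr P * M powr (P - 1)) * (\<integral>\<^sup>+y. ennreal (k y * g y powr P) \<partial>N)"
proof (cases "P = 1")
  case True
  have "ennreal a \<le> 1 * (\<integral>\<^sup>+y. ennreal (k y * g y) \<partial>N)"
    using a by simp
  also have "\<dots> \<le> ennreal 2 * (\<integral>\<^sup>+y. ennreal (k y * g y) \<partial>N)"
    by (rule mult_right_mono) auto
  finally show ?thesis
    using True a M nn by simp
next
  case False
  with P have P1: "1 < P" by simp
  define P' where "P' = P / (P - 1)"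
  have P': "1 < P'" "1 / P + 1 / P' = 1"
    using P1 by (auto simp: P'_def field_simps)
  have kk: "k y powr (1 / P) * k y powr (1 / P') = k y" for y
    using P' nn by (simp add: powr_add[symmetric])
  have "ennreal (a powr P) \<le> ennreal (2 powr P * M powr (P - 1)) *
    (\<integral>\<^sup>+y. ennreal ((k y powr (1 / P) * g y) powr P) \<partial>N)"
  proof (rule powr_le_holder[where \<psi> = "\<lambda>y. k y powr (1 / P')" and q' = P'])
    show "(\<integral>\<^sup>+y. ennreal ((k y powr (1 / P')) powr P') \<partial>N) \<le> ennreal M"
      using M P' nn by (simp add: powr_powr)
    show "ennreal a \<le> (\<integral>\<^sup>+y. ennreal (k y powr (1 / P) * g y * k y powr (1 / P')) \<partial>N)"
      using a(2) kk by (simp add: mult.assoc mult.left_commute[of _ "g _"] mult.commute[of _ "g _"])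
  qed (use nn P1 P' M a in auto)
  then show ?thesis
    using nn P1 by (simp add: powr_mult powr_powr)
qed


lemma unit_ball_Lp_ennreal:
  assumes "1 \<le> P" "g \<in> unit_ball_Lp (ennreal P)"
  shows "(\<integral>\<^sup>+x. ennreal (g x powr P) \<partial>lborel) \<le> 1"
  using assms by (simp add: unit_ball_Lp_def)

lemma unit_ball_Lp_infinity:
  assumes "g \<in> unit_ball_Lp \<infinity>"
  shows "g x \<le> 1"
  using assms by (simp add: unit_ball_Lp_def)

lemma weight_powr_finite:
  fixes b :: real
  assumes "DIM('a::euclidean_space) < b"
  shows "\<exists>M>0. (\<integral>\<^sup>+x. ennreal (max 1 (norm (x::'a)) powr (- b)) \<partial>lborel) \<le> ennreal M"
proof -
  let ?A = "\<lambda>z::'a. indicator (cball 0 1) z :: ennreal"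
  let ?B = "\<lambda>z::'a. ennreal (norm z powr (- b)) * indicator {1..} (norm z)"
  let ?I = "\<integral>\<^sup>+x. ennreal (max 1 (norm (x::'a)) powr (- b)) \<partial>lborel"
  have "?I \<le> (\<integral>\<^sup>+x. ?A x + ?B x \<partial>lborel)"
    by (intro nn_integral_mono) (auto simp: indicator_def max_def)
  also have "\<dots> = emeasure lborel (cball 0 1 :: 'a set) + (\<integral>\<^sup>+x. ?B x \<partial>lborel)"
    by (subst nn_integral_add) (auto intro!: borel_measurable_indicator borel_closed)
  also have "\<dots> < \<infinity>"
    using nn_integral_powr_norm_ge[where 'a='a, of b 1] assms
    by (simp add: emeasure_cball)
  finally show ?thesis
    by (rule ennreal_less_top_bound)
qed

text \<open>Young's inequality with the conjugate exponents s/Q and P/Q. Integrated in x, it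
  replaces Hoelder's inequality for weight times convolution, since for normalised functions only a
  bound for both integrals matters.\<close>

lemma mult_powr_le_sum:
  fixes w a P Q s :: real
  assumes "0 \<le> w" "0 \<le> a" "0 < P" "0 < Q" "0 < s" "1 / Q = 1 / P + 1 / s"
  shows "(w * a) powr Q \<le> w powr s + a powr P"
proof (cases "w = 0 \<or> a = 0")
  case False
  with assms have pos: "0 < w" "0 < a" by auto
  have sum: "Q / s + Q / P = 1"
  proof -
    have "Q * (1 / Q) = Q * (1 / P) + Q * (1 / s)"
      unfolding assms(6) by (rule distrib_left)
    then show ?thesis
      using assms(4) by simp
  qed
  have "(w * a) powr Q = (w powr s) powr (Q / s) * (a powr P) powr (Q / P)"
    using assms pos by (simp add: powr_mult powr_powr)
  also have "\<dots> \<le> Q / s * w powr s + Q / P * a powr P"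
    using assms pos sum by (intro Youngs_inequality_0) auto
  also have "\<dots> \<le> 1 * w powr s + 1 * a powr P"
  proof (intro add_mono mult_right_mono)
    have "0 \<le> Q / s" "0 \<le> Q / P" using assms by auto
    then show "Q / s \<le> 1" "Q / P \<le> 1" using sum by linarith+
  qed auto
  finally show ?thesis by simp
qed auto

text \<open>Pointwise \<open>I g \<le> W * (k \<star> g)\<close> with \<open>W\<close> in \<open>L\<^sup>s\<close>, \<open>1/Q = 1/P + 1/s\<close>; on the diagonal there is no
  such \<open>s\<close>, and \<open>s = 0\<close> encodes this case.\<close>

lemma bounded_above_diagonal:
  fixes \<sigma> P Q :: real
  assumes \<sigma>: "0 < \<sigma>" "\<sigma> < real CARD('n) / 2" and PQ: "1 \<le> P" "1 \<le> Q"
    and le: "1 / P \<le> 1 / Q" and lt: "1 / Q < 1 / P + 2 * \<sigma> / real CARD('n)"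
  shows "bounded_Lp_Lq (potential_operator \<sigma> :: (real^'n \<Rightarrow> real) \<Rightarrow> _) (ennreal P) (ennreal Q)"
proof -
  define d where "d = real CARD('n)"
  have d: "0 < d" by (simp add: d_def)
  define \<theta> where "\<theta> = (if P = Q then 0 else (d * (1 / Q - 1 / P) / 2 + \<sigma>) / 2)"
  have lt': "d * (1 / Q - 1 / P) / 2 < \<sigma>"
    using lt d by (simp add: d_def[symmetric] field_simps)
  have \<theta>: "0 \<le> \<theta>" "\<theta> < \<sigma>"
    using le lt' \<sigma> d by (auto simp: \<theta>_def)
  obtain k M where k [measurable]: "k \<in> borel_measurable borel" and k0: "\<And>z::real^'n. 0 \<le> k z"
    and M: "0 < M" "(\<integral>\<^sup>+z. ennreal (k z powr 1) \<partial>lborel) \<le> ennreal M"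
    and K: "\<And>x y. x \<noteq> y \<Longrightarrow> potential_kernel \<sigma> x y \<le> max 1 (norm x) powr (- 2 * \<theta>) * k (x - y)"
    using potential_kernel_dominated[OF \<sigma> \<theta>(1), of 1] \<theta> by auto
  have M': "(\<integral>\<^sup>+z. ennreal (k z) \<partial>lborel) \<le> ennreal M"
    using M k0 by simp
  have "\<exists>s N. 0 < N \<and> (\<forall>w a. 0 \<le> w \<longrightarrow> w \<le> 1 \<longrightarrow> 0 \<le> a \<longrightarrow> (w * a) powr Q \<le> indicator {0<..} s * w powr s + a powr P) \<and>
     (\<integral>\<^sup>+x. ennreal (indicator {0<..} s * (max 1 (norm (x::real^'n)) powr (- 2 * \<theta>)) powr s) \<partial>lborel) \<le> ennreal N"
  proof (cases "P = Q")
    case True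
    have "(w * a) powr Q \<le> a powr P" if "0 \<le> w" "w \<le> 1" "0 \<le> a" for w a
      unfolding True using that PQ by (intro powr_mono2) (auto simp: mult_left_le_one_le)
    then show ?thesis
      by (intro exI[of _ 0] exI[of _ 1]) auto
  next
    case False
    define s where "s = 1 / (1 / Q - 1 / P)"
    have QP: "0 < 1 / Q - 1 / P"
      using False le PQ by (simp add: field_simps)
    then have s: "0 < s" "1 / Q = 1 / P + 1 / s"
      by (auto simp: s_def)
    have "d < 2 * \<theta> * s"
    proof -
      have "d * (1 / Q - 1 / P) < 2 * \<theta>"
        using False lt' by (simp add: \<theta>_def)
      then show ?thesis
        using QP by (simp add: s_def pos_less_divide_eq mult.commute)
    qed
    then obtain N where "0 < N" "(\<integral>\<^sup>+x. ennreal (max 1 (norm (x::real^'n)) powr (- (2 * \<theta> * s))) \<partial>lborel) \<le> ennreal N"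
      using weight_powr_finite[where 'a="real^'n", of "2 * \<theta> * s"] by (auto simp: d_def)
    then show ?thesis
      using s PQ mult_powr_le_sum[of _ _ P Q s]
      by (intro exI[of _ s] exI[of _ N]) (auto simp: powr_powr)
  qed
  then obtain s N where N: "0 < N"
    and pt: "\<And>w a. 0 \<le> w \<Longrightarrow> w \<le> 1 \<Longrightarrow> 0 \<le> a \<Longrightarrow> (w * a) powr Q \<le> indicator {0<..} s * w powr s + a powr P"
    and W: "(\<integral>\<^sup>+x. ennreal (indicator {0<..} s * (max 1 (norm (x::real^'n)) powr (- 2 * \<theta>)) powr s) \<partial>lborel) \<le> ennreal N"
    by blast
  define B where "B = 2 powr P * M powr (P - 1)"
  have B: "0 < B" using M by (simp add: B_def)
  show ?thesis
  proof (rule bounded_Lp_Lq_finiteI[OF \<sigma>(1), where M = "N + B * M"])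
    fix g :: "real^'n \<Rightarrow> real"
    assume g: "g \<in> unit_ball_Lp (ennreal P)"
    note [measurable] = unit_ball_LpD(1)[OF g]
    note g0 = unit_ball_LpD(3)[OF g]
    have "(\<integral>\<^sup>+x. ennreal (potential_operator \<sigma> g x powr Q) \<partial>lebesgue) \<le>
      (\<integral>\<^sup>+x. ennreal (indicator {0<..} s * (max 1 (norm (x::real^'n)) powr (- 2 * \<theta>)) powr s) +
         ennreal B * (\<integral>\<^sup>+y. ennreal (k (x - y)) * ennreal (g y powr P) \<partial>lborel) \<partial>lebesgue)"
    proof (rule nn_integral_mono)
      fix x :: "real^'n"
      define w where "w = max 1 (norm x) powr (- 2 * \<theta>)"
      have w: "0 < w" "w \<le> 1"
        using \<theta> powr_mono2'[of "- 2 * \<theta>" 1 "max 1 (norm x)"] by (auto simp: w_def)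
      define a where "a = potential_operator \<sigma> g x / w"
      have a: "0 \<le> a"
        using w potential_operator_nonneg[OF \<sigma>(1), of g x, OF g0] by (simp add: a_def)
      have "ennreal a \<le> (\<integral>\<^sup>+y. ennreal (k (x - y) * g y) \<partial>lborel)"
        unfolding a_def using w K g0 by (intro potential_operator_le_majorant[OF \<sigma>(1)]) (auto simp: w_def)
      then have "ennreal (a powr P) \<le> ennreal B * (\<integral>\<^sup>+y. ennreal (k (x - y) * g y powr P) \<partial>lborel)"
        unfolding B_def using k0 g0 PQ M a M'
        by (intro powr_le_jensen) (auto simp: nn_integral_translate_reflect(1)[where \<phi> = "\<lambda>z. ennreal (k z)"])
      then have le: "ennreal (indicator {0<..} s * w powr s) + ennreal (a powr P) \<le> ennreal (indicator {0<..} s * w powr s) +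
         ennreal B * (\<integral>\<^sup>+y. ennreal (k (x - y) * g y powr P) \<partial>lborel)"
        by (rule add_left_mono)
      have "ennreal (potential_operator \<sigma> g x powr Q) \<le> ennreal (indicator {0<..} s * w powr s + a powr P)"
        using pt[of w a] w a by (intro ennreal_leI) (simp add: a_def)
      also have "\<dots> = ennreal (indicator {0<..} s * w powr s) + ennreal (a powr P)"
        by (intro ennreal_plus) auto
      also note le
      finally have "ennreal (potential_operator \<sigma> g x powr Q) \<le> ennreal (indicator {0<..} s * w powr s) +
         ennreal B * (\<integral>\<^sup>+y. ennreal (k (x - y) * g y powr P) \<partial>lborel)" .
      then show "ennreal (potential_operator \<sigma> g x powr Q) \<le>
        ennreal (indicator {0<..} s * (max 1 (norm x) powr (- 2 * \<theta>)) powr s) +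
         ennreal B * (\<integral>\<^sup>+y. ennreal (k (x - y)) * ennreal (g y powr P) \<partial>lborel)"
        using k0 unfolding w_def[symmetric] by (simp add: ennreal_mult)
    qed
    also have "\<dots> = (\<integral>\<^sup>+x. ennreal (indicator {0<..} s * (max 1 (norm (x::real^'n)) powr (- 2 * \<theta>)) powr s) \<partial>lborel) +
       ennreal B * (\<integral>\<^sup>+x. \<integral>\<^sup>+y. ennreal (k (x - y)) * ennreal (g y powr P) \<partial>lborel \<partial>lborel)"
      by (simp add: nn_integral_completion nn_integral_add nn_integral_cmult)
    also have "\<dots> \<le> ennreal N + ennreal B * (ennreal M * 1)"
    proof (intro add_mono mult_left_mono W)
      have "(\<integral>\<^sup>+x. \<integral>\<^sup>+y. ennreal (k (x - y)) * ennreal (g y powr P) \<partial>lborel \<partial>lborel) =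
        (\<integral>\<^sup>+z. ennreal (k z) \<partial>lborel) * (\<integral>\<^sup>+y. ennreal (g y powr P) \<partial>lborel)"
        by (rule nn_integral_convolution[where k = "\<lambda>z. ennreal (k z)" and g = "\<lambda>y. ennreal (g y powr P)"]) measurable
      also have "\<dots> \<le> ennreal M * 1"
        by (intro mult_mono M' unit_ball_Lp_ennreal[OF PQ(1) g]) auto
      finally show "(\<integral>\<^sup>+x. \<integral>\<^sup>+y. ennreal (k (x - y)) * ennreal (g y powr P) \<partial>lborel \<partial>lborel) \<le> ennreal M * 1" .
    qed simp
    also have "\<dots> = ennreal (N + B * M)"
      using N B M by (simp add: ennreal_mult)
    finally show "(\<integral>\<^sup>+x. ennreal (potential_operator \<sigma> g x powr Q) \<partial>lebesgue) \<le> ennreal (N + B * M)" .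
  qed (use PQ N B M in \<open>auto intro: add_pos_pos\<close>)
qed

text \<open>Since g \<le> 1, the potential is at most the weight times the mass of the convolution
  kernel, which is finite because \<theta> < \<sigma>. The limit exponent \<sigma> is out of reach
  here and is the content of \<open>potential_operator_decay\<close>.\<close>

lemma potential_operator_unit_ball_infinity:
  fixes \<sigma> \<theta> :: real
  assumes \<sigma>: "0 < \<sigma>" "\<sigma> < real CARD('n) / 2" and \<theta>: "0 \<le> \<theta>" "\<theta> < \<sigma>"
  shows "\<exists>M>0. \<forall>g\<in>unit_ball_Lp \<infinity>. \<forall>x::real^'n. potential_operator \<sigma> g x \<le> M * max 1 (norm x) powr (- 2 * \<theta>)"
proof -
  obtain k M where k [measurable]: "k \<in> borel_measurable borel" and k0: "\<And>z::real^'n. 0 \<le> k z"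
    and M: "0 < M" "(\<integral>\<^sup>+z. ennreal (k z powr 1) \<partial>lborel) \<le> ennreal M"
    and K: "\<And>x y. x \<noteq> y \<Longrightarrow> potential_kernel \<sigma> x y \<le> max 1 (norm x) powr (- 2 * \<theta>) * k (x - y)"
    using potential_kernel_dominated[OF \<sigma> \<theta>(1), of 1] \<theta> by auto
  have "potential_operator \<sigma> g x \<le> M * max 1 (norm x) powr (- 2 * \<theta>)" if g: "g \<in> unit_ball_Lp \<infinity>" for g and x :: "real^'n"
  proof -
    note [measurable] = unit_ball_LpD(1)[OF g]
    define w where "w = max 1 (norm x) powr (- 2 * \<theta>)"
    have w: "0 < w" by (simp add: w_def)
    have "ennreal (potential_operator \<sigma> g x / w) \<le> (\<integral>\<^sup>+y. ennreal (k (x - y) * g y) \<partial>lborel)"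
      using w K unit_ball_LpD[OF g] by (intro potential_operator_le_majorant[OF \<sigma>(1)]) (auto simp: w_def)
    also have "\<dots> \<le> (\<integral>\<^sup>+y. ennreal (k (x - y)) \<partial>lborel)"
      using k0 unit_ball_Lp_infinity[OF g] by (intro nn_integral_mono ennreal_leI mult_left_le) auto
    also have "\<dots> \<le> ennreal M"
      using M k0 by (simp add: nn_integral_translate_reflect(1)[where \<phi> = "\<lambda>z. ennreal (k z)"])
    finally have "potential_operator \<sigma> g x \<le> M * w"
      using w M by (simp add: divide_le_eq)
    then show ?thesis
      by (simp add: w_def)
  qed
  then show ?thesis using M by blast
qed

lemma bounded_from_Linfinity:
  fixes \<sigma> Q :: real
  assumes \<sigma>: "0 < \<sigma>" "\<sigma> < real CARD('n) / 2" and Q: "1 \<le> Q" "1 / Q < 2 * \<sigma> / real CARD('n)"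
  shows "bounded_Lp_Lq (potential_operator \<sigma> :: (real^'n \<Rightarrow> real) \<Rightarrow> _) \<infinity> (ennreal Q)"
proof -
  \<comment> \<open>Midpoint of d/(2Q) and \<sigma>: above the first value the Q-th power of the
    weight is integrable, below the second the pointwise bound holds.\<close>
  define \<theta> where "\<theta> = (real CARD('n) / (2 * Q) + \<sigma>) / 2"
  have "real CARD('n) / (2 * Q) < \<sigma>"
    using Q by (simp add: field_simps)
  then have \<theta>: "0 \<le> \<theta>" "\<theta> < \<sigma>" "real CARD('n) < 2 * \<theta> * Q"
    using \<sigma> Q by (auto simp: \<theta>_def field_simps)
  obtain M where M: "0 < M" "\<And>g (x::real^'n). g \<in> unit_ball_Lp \<infinity> \<Longrightarrow> potential_operator \<sigma> g x \<le> M * max 1 (norm x) powr (- 2 * \<theta>)"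
    using potential_operator_unit_ball_infinity[OF \<sigma> \<theta>(1,2)] by blast
  obtain N where N: "0 < N" "(\<integral>\<^sup>+x. ennreal (max 1 (norm (x::real^'n)) powr (- (2 * \<theta> * Q))) \<partial>lborel) \<le> ennreal N"
    using weight_powr_finite[where 'a="real^'n", of "2 * \<theta> * Q"] \<theta> by auto
  show ?thesis
  proof (rule bounded_Lp_Lq_finiteI[OF \<sigma>(1), where M = "M powr Q * N"])
    fix g :: "real^'n \<Rightarrow> real"
    assume g: "g \<in> unit_ball_Lp \<infinity>"
    have "(\<integral>\<^sup>+x. ennreal (potential_operator \<sigma> g x powr Q) \<partial>lebesgue) \<le>
      (\<integral>\<^sup>+x. ennreal (M powr Q) * ennreal (max 1 (norm (x::real^'n)) powr (- (2 * \<theta> * Q))) \<partial>lebesgue)"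
    proof (rule nn_integral_mono)
      fix x
      have "potential_operator \<sigma> g x powr Q \<le> (M * max 1 (norm x) powr (- 2 * \<theta>)) powr Q"
        using M g Q potential_operator_nonneg[OF \<sigma>(1) unit_ball_LpD(3)[OF g]] by (intro powr_mono2) auto
      then show "ennreal (potential_operator \<sigma> g x powr Q) \<le> ennreal (M powr Q) * ennreal (max 1 (norm x) powr (- (2 * \<theta> * Q)))"
        using M by (simp add: powr_mult powr_powr ennreal_mult[symmetric] ennreal_leI)
    qed
    also have "\<dots> \<le> ennreal (M powr Q) * ennreal N"
      using N by (simp add: nn_integral_completion nn_integral_cmult mult_left_mono)
    finally show "(\<integral>\<^sup>+x. ennreal (potential_operator \<sigma> g x powr Q) \<partial>lebesgue) \<le> ennreal (M powr Q * N)"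
      using N by (simp add: ennreal_mult)
  qed (use Q M N in auto)
qed

lemma bounded_Linfinity_Linfinity:
  fixes \<sigma> :: real
  assumes \<sigma>: "0 < \<sigma>" "\<sigma> < real CARD('n) / 2"
  shows "bounded_Lp_Lq (potential_operator \<sigma> :: (real^'n \<Rightarrow> real) \<Rightarrow> _) \<infinity> \<infinity>"
proof -
  obtain M where M: "0 < M" "\<And>g (x::real^'n). g \<in> unit_ball_Lp \<infinity> \<Longrightarrow> potential_operator \<sigma> g x \<le> M * max 1 (norm x) powr (- 2 * 0)"
    using potential_operator_unit_ball_infinity[OF \<sigma>, of 0] \<sigma> by blast
  have "potential_operator \<sigma> g x \<le> M" if "g \<in> unit_ball_Lp \<infinity>" for g and x :: "real^'n"
  proof -
    have "max 1 (norm x) \<noteq> 0" by linarith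
    then show ?thesis using M(2)[OF that, of x] by simp
  qed
  then show ?thesis
    using M by (intro bounded_Lp_Lq_infI \<sigma>) auto
qed

text \<open>Hoelder's inequality with the conjugate exponent r of P, in the additive form kg \<le>
  k^r + g^P. The strict inequality between 1/P and 2\<sigma>/d says that r(d - 2\<sigma>) < d, which
  puts the Riesz singularity into L^r locally.\<close>

lemma bounded_to_Linfinity:
  fixes \<sigma> P :: real
  assumes \<sigma>: "0 < \<sigma>" "\<sigma> < real CARD('n) / 2" and P: "1 \<le> P" "1 / P < 2 * \<sigma> / real CARD('n)"
  shows "bounded_Lp_Lq (potential_operator \<sigma> :: (real^'n \<Rightarrow> real) \<Rightarrow> _) (ennreal P) \<infinity>"
proof -
  have "P \<noteq> 1" using P \<sigma> by auto
  with P have P1: "1 < P" by simp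
  define r where "r = P / (P - 1)"
  have r: "1 < r" "1 / r + 1 / P = 1"
    using P1 by (auto simp: r_def field_simps)
  have "r * (1 - 2 * \<sigma> / real CARD('n)) < r * (1 - 1 / P)"
    using r P by (intro mult_strict_left_mono) auto
  also have "r * (1 - 1 / P) = 1"
    using r by (simp add: field_simps)
  finally have "real CARD('n) * (r * (1 - 2 * \<sigma> / real CARD('n))) < real CARD('n)"
    by simp
  moreover have "real CARD('n) * (r * (1 - 2 * \<sigma> / real CARD('n))) = r * (real CARD('n) - 2 * (\<sigma> - 0))"
    by (simp add: field_simps)
  ultimately have rd: "r * (real CARD('n) - 2 * (\<sigma> - 0)) < real CARD('n)"
    by simp
  obtain k M where k [measurable]: "k \<in> borel_measurable borel" and k0: "\<And>z::real^'n. 0 \<le> k z"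
    and M: "0 < M" "(\<integral>\<^sup>+z. ennreal (k z powr r) \<partial>lborel) \<le> ennreal M"
    and K: "\<And>x y. x \<noteq> y \<Longrightarrow> potential_kernel \<sigma> x y \<le> max 1 (norm x) powr (- 2 * 0) * k (x - y)"
    using potential_kernel_dominated[OF \<sigma> order_refl less_imp_le[OF r(1)] rd] by auto
  have K1: "potential_kernel \<sigma> x y \<le> 1 * k (x - y)" if "x \<noteq> y" for x y :: "real^'n"
  proof -
    have "max 1 (norm x) \<noteq> 0" by linarith
    then show ?thesis using K[OF that] by simp
  qed
  have "potential_operator \<sigma> g x \<le> M + 1" if g: "g \<in> unit_ball_Lp (ennreal P)" for g and x :: "real^'n"
  proof -
    note [measurable] = unit_ball_LpD(1)[OF g]
    note g0 = unit_ball_LpD(3)[OF g]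
    have "ennreal (potential_operator \<sigma> g x / 1) \<le> (\<integral>\<^sup>+y. ennreal (k (x - y) * g y) \<partial>lborel)"
      using K1 g0 by (intro potential_operator_le_majorant[OF \<sigma>(1)]) auto
    also have "\<dots> \<le> (\<integral>\<^sup>+y. ennreal (k (x - y) powr r) + ennreal (g y powr P) \<partial>lborel)"
    proof (rule nn_integral_mono)
      fix y
      have "k (x - y) * g y \<le> k (x - y) powr r / r + g y powr P / P"
        using r P1 k0 g0 by (intro Youngs_inequality) auto
      also have "\<dots> \<le> k (x - y) powr r + g y powr P"
        using r P1 by (intro add_mono) (auto simp: divide_le_eq mult_le_cancel_left1)
      finally show "ennreal (k (x - y) * g y) \<le> ennreal (k (x - y) powr r) + ennreal (g y powr P)"
        by (simp add: ennreal_plus[symmetric] ennreal_leI del: ennreal_plus)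
    qed
    also have "\<dots> = (\<integral>\<^sup>+y. ennreal (k (x - y) powr r) \<partial>lborel) + (\<integral>\<^sup>+y. ennreal (g y powr P) \<partial>lborel)"
      by (simp add: nn_integral_add)
    also have "\<dots> \<le> ennreal M + 1"
      using M unit_ball_Lp_ennreal[OF P(1) g]
      by (intro add_mono) (auto simp: nn_integral_translate_reflect(1)[where \<phi> = "\<lambda>z. ennreal (k z powr r)"])
    also have "\<dots> = ennreal (M + 1)"
      using M by simp
    finally show ?thesis
      using M by (simp del: ennreal_plus)
  qed
  then show ?thesis
    using M P by (intro bounded_Lp_Lq_infI[where M = "M + 1"] \<sigma>) auto
qed

text \<open>Young's convolution inequality with 1/r = 1 + 1/Q - 1/P; the distance from the lower
  edge is the condition r(d - 2\<sigma>) < d. With kg split into k^(r/Q) g^(P/Q) and the rest,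
  Hoelder with exponents Q and Q' leaves a second factor bounded uniformly in x, and the first one
  is a convolution of integrable functions.\<close>

lemma bounded_below_diagonal:
  fixes \<sigma> P Q :: real
  assumes \<sigma>: "0 < \<sigma>" "\<sigma> < real CARD('n) / 2" and PQ: "1 \<le> P" "P < Q"
    and lt: "1 / P - 2 * \<sigma> / real CARD('n) < 1 / Q"
  shows "bounded_Lp_Lq (potential_operator \<sigma> :: (real^'n \<Rightarrow> real) \<Rightarrow> _) (ennreal P) (ennreal Q)"
proof -
  have Q1: "1 < Q" using PQ by simp
  define r where "r = 1 / (1 + 1 / Q - 1 / P)"
  have u: "0 < 1 + 1 / Q - 1 / P" "1 + 1 / Q - 1 / P \<le> 1"
  proof -
    have "0 < 1 / Q" "1 / Q \<le> 1 / P" "1 / P \<le> 1"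
      using PQ by (auto simp: frac_le)
    then show "0 < 1 + 1 / Q - 1 / P" "1 + 1 / Q - 1 / P \<le> 1"
      by linarith+
  qed
  have r: "1 \<le> r" "1 / r = 1 + 1 / Q - 1 / P"
    using u by (auto simp: r_def)
  have "r * (1 - 2 * \<sigma> / real CARD('n)) < r * (1 / r)"
    using r lt by (intro mult_strict_left_mono) auto
  then have "real CARD('n) * (r * (1 - 2 * \<sigma> / real CARD('n))) < real CARD('n)"
    using r(1) by simp
  moreover have "real CARD('n) * (r * (1 - 2 * \<sigma> / real CARD('n))) = r * (real CARD('n) - 2 * (\<sigma> - 0))"
    by (simp add: field_simps)
  ultimately have rd: "r * (real CARD('n) - 2 * (\<sigma> - 0)) < real CARD('n)"
    by simp
  obtain k M where k [measurable]: "k \<in> borel_measurable borel" and k0: "\<And>z::real^'n. 0 \<le> k z"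
    and M: "0 < M" "(\<integral>\<^sup>+z. ennreal (k z powr r) \<partial>lborel) \<le> ennreal M"
    and K: "\<And>x y. x \<noteq> y \<Longrightarrow> potential_kernel \<sigma> x y \<le> max 1 (norm x) powr (- 2 * 0) * k (x - y)"
    using potential_kernel_dominated[OF \<sigma> order_refl r(1) rd] by auto
  have K1: "potential_kernel \<sigma> x y \<le> 1 * k (x - y)" if "x \<noteq> y" for x y :: "real^'n"
  proof -
    have "max 1 (norm x) \<noteq> 0" by linarith
    then show ?thesis using K[OF that] by simp
  qed
  define Q' where "Q' = Q / (Q - 1)"
  have Q': "1 < Q'" "1 / Q + 1 / Q' = 1"
    using Q1 by (auto simp: Q'_def field_simps)
  \<comment> \<open>\<open>\<beta>\<close> is read off from the exponent of g, (1 - P/Q) Q' = P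
    \<beta>. The definition of r then gives the exponent r (1 - \<beta>) for k, so that weighted
    Young bounds the product by k^r + g^P.\<close>
  define \<beta> where "\<beta> = (Q - P) / (P * (Q - 1))"
  have \<beta>0: "0 \<le> \<beta>" using PQ Q1 by (simp add: \<beta>_def)
  have \<beta>1: "1 - \<beta> = Q * (P - 1) / (P * (Q - 1))"
    using PQ Q1 by (simp add: \<beta>_def field_simps)
  have "0 \<le> 1 - \<beta>" unfolding \<beta>1 using PQ Q1 by simp
  have e1: "(1 - P / Q) * Q' = P * \<beta>"
    using PQ Q1 by (simp add: \<beta>_def Q'_def field_simps)
  have e2: "(1 - r / Q) * Q' = r * (1 - \<beta>)"
  proof -
    have "(1 - r / Q) * Q' = (Q - r) / (Q - 1)"
      using PQ Q1 by (simp add: Q'_def field_simps)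
    also have "Q - r = r * (Q * (1 / r) - 1)"
      using r(1) by (simp add: right_diff_distrib)
    also have "Q * (1 / r) - 1 = Q * (P - 1) / P"
      unfolding r(2) using PQ by (simp add: field_simps)
    finally show ?thesis
      unfolding \<beta>1 by simp
  qed
  define B where "B = 2 powr Q * (M + 1) powr (Q - 1)"
  have B: "0 < B" using M by (simp add: B_def)
  show ?thesis
  proof (rule bounded_Lp_Lq_finiteI[OF \<sigma>(1), where M = "B * M"])
    fix g :: "real^'n \<Rightarrow> real"
    assume g: "g \<in> unit_ball_Lp (ennreal P)"
    note [measurable] = unit_ball_LpD(1)[OF g]
    note g0 = unit_ball_LpD(3)[OF g]
    have "(\<integral>\<^sup>+x. ennreal (potential_operator \<sigma> g x powr Q) \<partial>lebesgue) \<le>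
      (\<integral>\<^sup>+x. ennreal B * (\<integral>\<^sup>+y. ennreal (k (x - y) powr r) * ennreal (g y powr P) \<partial>lborel) \<partial>lebesgue)"
    proof (rule nn_integral_mono)
      fix x
      define a where "a = potential_operator \<sigma> g x"
      have a: "0 \<le> a"
        using potential_operator_nonneg[OF \<sigma>(1), of g x, OF g0] by (simp add: a_def)
      have "ennreal (a / 1) \<le> (\<integral>\<^sup>+y. ennreal (k (x - y) * g y) \<partial>lborel)"
        unfolding a_def using K1 g0 by (intro potential_operator_le_majorant[OF \<sigma>(1)]) auto
      also have "\<dots> = (\<integral>\<^sup>+y. ennreal ((k (x - y) powr (r / Q) * g y powr (P / Q)) *
          (k (x - y) powr (1 - r / Q) * g y powr (1 - P / Q))) \<partial>lborel)"
      proof (intro nn_integral_cong arg_cong[where f = ennreal])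
        fix y
        have "k (x - y) powr (r / Q) * k (x - y) powr (1 - r / Q) = k (x - y)"
          "g y powr (P / Q) * g y powr (1 - P / Q) = g y"
          using k0 g0 by (simp_all add: powr_add[symmetric])
        then have "k (x - y) * g y = (k (x - y) powr (r / Q) * k (x - y) powr (1 - r / Q)) *
          (g y powr (P / Q) * g y powr (1 - P / Q))"
          by (simp only:)
        then show "k (x - y) * g y = (k (x - y) powr (r / Q) * g y powr (P / Q)) *
          (k (x - y) powr (1 - r / Q) * g y powr (1 - P / Q))"
          by (simp only: ac_simps)
      qed
      finally have aint: "ennreal a \<le> (\<integral>\<^sup>+y. ennreal ((k (x - y) powr (r / Q) * g y powr (P / Q)) *
          (k (x - y) powr (1 - r / Q) * g y powr (1 - P / Q))) \<partial>lborel)" by simp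
      have "ennreal (a powr Q) \<le> ennreal B * (\<integral>\<^sup>+y. ennreal ((k (x - y) powr (r / Q) * g y powr (P / Q)) powr Q) \<partial>lborel)"
        unfolding B_def
      proof (rule powr_le_holder[OF _ _ _ _ Q1 Q' _ _ a aint])
        have "(\<integral>\<^sup>+y. ennreal ((k (x - y) powr (1 - r / Q) * g y powr (1 - P / Q)) powr Q') \<partial>lborel) \<le>
          (\<integral>\<^sup>+y. ennreal (k (x - y) powr r) + ennreal (g y powr P) \<partial>lborel)"
        proof (rule nn_integral_mono)
          fix y
          have "(k (x - y) powr (1 - r / Q) * g y powr (1 - P / Q)) powr Q' = k (x - y) powr (r * (1 - \<beta>)) * g y powr (P * \<beta>)"
            by (simp add: powr_mult powr_powr e1 e2)
          also have "\<dots> \<le> k (x - y) powr r + g y powr P"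
          proof (cases "k (x - y) = 0 \<or> g y = 0")
            case False
            then have pos: "0 < k (x - y)" "0 < g y" using k0[of "x - y"] g0[of y] by auto
            have "k (x - y) powr (r * (1 - \<beta>)) * g y powr (P * \<beta>) = (k (x - y) powr r) powr (1 - \<beta>) * (g y powr P) powr \<beta>"
              by (simp add: powr_powr)
            also have "\<dots> \<le> (1 - \<beta>) * k (x - y) powr r + \<beta> * g y powr P"
              using pos \<beta>0 \<open>0 \<le> 1 - \<beta>\<close> by (intro Youngs_inequality_0) auto
            also have "\<dots> \<le> 1 * k (x - y) powr r + 1 * g y powr P"
              using \<beta>0 \<open>0 \<le> 1 - \<beta>\<close> by (intro add_mono mult_right_mono) auto
            finally show ?thesis by simp
          qed auto
          finally show "ennreal ((k (x - y) powr (1 - r / Q) * g y powr (1 - P / Q)) powr Q') \<le>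
            ennreal (k (x - y) powr r) + ennreal (g y powr P)"
            by (simp add: ennreal_plus[symmetric] ennreal_leI del: ennreal_plus)
        qed
        also have "\<dots> = (\<integral>\<^sup>+y. ennreal (k (x - y) powr r) \<partial>lborel) + (\<integral>\<^sup>+y. ennreal (g y powr P) \<partial>lborel)"
          by (simp add: nn_integral_add)
        also have "\<dots> \<le> ennreal M + 1"
          using M unit_ball_Lp_ennreal[OF PQ(1) g]
          by (intro add_mono) (auto simp: nn_integral_translate_reflect(1)[where \<phi> = "\<lambda>z. ennreal (k z powr r)"])
        also have "\<dots> = ennreal (M + 1)"
          using M by simp
        finally show "(\<integral>\<^sup>+y. ennreal ((k (x - y) powr (1 - r / Q) * g y powr (1 - P / Q)) powr Q') \<partial>lborel) \<le> ennreal (M + 1)" .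
      qed (use M in auto)
      then show "ennreal (potential_operator \<sigma> g x powr Q) \<le> ennreal B * (\<integral>\<^sup>+y. ennreal (k (x - y) powr r) * ennreal (g y powr P) \<partial>lborel)"
        using Q1 by (simp add: a_def powr_mult powr_powr ennreal_mult)
    qed
    also have "\<dots> = ennreal B * (\<integral>\<^sup>+x. \<integral>\<^sup>+y. ennreal (k (x - y) powr r) * ennreal (g y powr P) \<partial>lborel \<partial>lborel)"
      by (simp add: nn_integral_completion nn_integral_cmult)
    also have "\<dots> \<le> ennreal B * (ennreal M * 1)"
    proof (rule mult_left_mono)
      have "(\<integral>\<^sup>+x. \<integral>\<^sup>+y. ennreal (k (x - y) powr r) * ennreal (g y powr P) \<partial>lborel \<partial>lborel) =
        (\<integral>\<^sup>+z. ennreal (k z powr r) \<partial>lborel) * (\<integral>\<^sup>+y. ennreal (g y powr P) \<partial>lborel)"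
        by (rule nn_integral_convolution[where k = "\<lambda>z. ennreal (k z powr r)" and g = "\<lambda>y. ennreal (g y powr P)"]) measurable
      also have "\<dots> \<le> ennreal M * 1"
        by (intro mult_mono M unit_ball_Lp_ennreal[OF PQ(1) g]) auto
      finally show "(\<integral>\<^sup>+x. \<integral>\<^sup>+y. ennreal (k (x - y) powr r) * ennreal (g y powr P) \<partial>lborel \<partial>lborel) \<le> ennreal M * 1" .
    qed simp
    also have "\<dots> = ennreal (B * M)"
      using B M by (simp add: ennreal_mult)
    finally show "(\<integral>\<^sup>+x. ennreal (potential_operator \<sigma> g x powr Q) \<partial>lebesgue) \<le> ennreal (B * M)" .
  qed (use PQ B M in auto)
qed


section \<open>Riesz potentials and the end points\<close>

text \<open>Splitting at \<rho> = m^(1/d): inside, the kernel is integrated over a ball; outside, it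
  is at most \<rho>^(\<beta> - d) on a set of measure at most \<rho>^d. Both parts are of order
  \<rho>^\<beta>. This single estimate carries all the positive results on the lower edge.\<close>

lemma riesz_indicator_bound:
  fixes \<beta> :: real
  assumes \<beta>: "0 < \<beta>" "\<beta> < DIM('a::euclidean_space)"
  shows "\<exists>C>0. \<forall>(E::'a set) m. E \<in> sets borel \<longrightarrow> 0 < m \<longrightarrow> emeasure lborel E \<le> ennreal m \<longrightarrow>
    (\<forall>x. (\<integral>\<^sup>+y. ennreal (norm (x - y) powr (\<beta> - DIM('a))) * indicator E y \<partial>lborel) \<le> ennreal (C * m powr (\<beta> / DIM('a))))"
proof -
  define d where "d = real DIM('a)"
  have d: "0 < d" by (simp add: d_def)
  define A where "A = d * unit_ball_vol d / \<beta>"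
  have A: "0 \<le> A" using \<beta> d by (simp add: A_def)
  have "(\<integral>\<^sup>+y. ennreal (norm (x - y) powr (\<beta> - d)) * indicator E y \<partial>lborel) \<le> ennreal ((A + 1) * m powr (\<beta> / d))"
    if E [measurable]: "E \<in> sets borel" and m: "0 < m" "emeasure lborel E \<le> ennreal m" for E :: "'a set" and m x
  proof -
    define \<rho> where "\<rho> = m powr (1 / d)"
    have \<rho>: "0 < \<rho>" using m by (simp add: \<rho>_def)
    let ?\<phi> = "\<lambda>z::'a. ennreal (norm z powr (- (d - \<beta>))) * indicator {0..\<rho>} (norm z)"
    have "(\<integral>\<^sup>+y. ennreal (norm (x - y) powr (\<beta> - d)) * indicator E y \<partial>lborel) \<le>
      (\<integral>\<^sup>+y. ?\<phi> (x - y) + ennreal (\<rho> powr (\<beta> - d)) * indicator E y \<partial>lborel)"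
    proof (rule nn_integral_mono)
      fix y
      show "ennreal (norm (x - y) powr (\<beta> - d)) * indicator E y \<le> ?\<phi> (x - y) + ennreal (\<rho> powr (\<beta> - d)) * indicator E y"
      proof (cases "norm (x - y) \<le> \<rho>")
        case True
        then show ?thesis
          by (auto simp: indicator_def intro: order_trans[OF _ add_increasing2])
      next
        case False
        then have "norm (x - y) powr (\<beta> - d) \<le> \<rho> powr (\<beta> - d)"
          using \<rho> \<beta> by (intro powr_mono2') (auto simp: d_def)
        then show ?thesis
          using False by (auto simp: indicator_def intro!: ennreal_leI)
      qed
    qed
    also have "\<dots> = (\<integral>\<^sup>+z. ?\<phi> z \<partial>lborel) + ennreal (\<rho> powr (\<beta> - d)) * emeasure lborel E"
    proof -
      have "(\<integral>\<^sup>+y. ?\<phi> (x - y) \<partial>lborel) = (\<integral>\<^sup>+z. ?\<phi> z \<partial>lborel)"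
        by (rule nn_integral_translate_reflect(1)) measurable
      then show ?thesis
        by (subst nn_integral_add) (auto simp: nn_integral_cmult_indicator)
    qed
    also have "(\<integral>\<^sup>+z. ?\<phi> z \<partial>lborel) = ennreal (A * \<rho> powr \<beta>)"
      using nn_integral_powr_norm_le[where 'a='a, of "d - \<beta>" \<rho>] \<beta> \<rho> by (simp add: d_def[symmetric] A_def)
    also have "ennreal (A * \<rho> powr \<beta>) + ennreal (\<rho> powr (\<beta> - d)) * emeasure lborel E \<le>
        ennreal (A * \<rho> powr \<beta>) + ennreal (\<rho> powr (\<beta> - d)) * ennreal m"
      using m by (intro add_left_mono mult_left_mono) auto
    also have "\<dots> = ennreal (A * \<rho> powr \<beta> + \<rho> powr (\<beta> - d) * m)"
      using A m by (simp add: ennreal_mult)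
    also have "m = \<rho> powr d"
      using m d by (simp add: \<rho>_def powr_powr)
    also have "A * \<rho> powr \<beta> + \<rho> powr (\<beta> - d) * \<rho> powr d = (A + 1) * (\<rho> powr \<beta>)"
      by (simp add: powr_add[symmetric] algebra_simps)
    also have "\<rho> powr \<beta> = m powr (\<beta> / d)"
      using m d by (simp add: \<rho>_def powr_powr)
    also have "m = \<rho> powr d"
      using m d by (simp add: \<rho>_def powr_powr)
    finally show ?thesis
      using m d by (simp add: \<rho>_def powr_powr)
  qed
  then show ?thesis
    using A unfolding d_def by (intro exI[of _ "A + 1"]) auto
qed

text \<open>Layer cake: the truncation at B is at most the integral over 0 < b \<le> B of the
  indicators of the sets h \<ge> b. Chebyshev gives these sets measure at most b^(-R), hence
  potentials at most C b^(-\<beta> R / d), and \<beta> R < d makes this integrable at b = 0.\<close>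

lemma riesz_truncated_bound:
  fixes \<beta> R :: real
  assumes \<beta>: "0 < \<beta>" "\<beta> < DIM('a::euclidean_space)" and R: "1 \<le> R" "\<beta> * R < DIM('a)"
  shows "\<exists>C>0. \<forall>h::'a \<Rightarrow> real. h \<in> borel_measurable borel \<longrightarrow> (\<forall>y. 0 \<le> h y) \<longrightarrow>
    (\<integral>\<^sup>+y. ennreal (h y powr R) \<partial>lborel) \<le> 1 \<longrightarrow>
    (\<forall>x. \<forall>B\<ge>0. (\<integral>\<^sup>+y. ennreal (norm (x - y) powr (\<beta> - DIM('a))) * (ennreal (h y) * indicator {..B} (h y)) \<partial>lborel)
      \<le> ennreal (C * B powr (1 - \<beta> * R / DIM('a))))"
proof -
  define d where "d = real DIM('a)"
  have d: "0 < d" by (simp add: d_def)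
  obtain C where C: "0 < C" "\<And>(E::'a set) m x. E \<in> sets borel \<Longrightarrow> 0 < m \<Longrightarrow> emeasure lborel E \<le> ennreal m \<Longrightarrow>
    (\<integral>\<^sup>+y. ennreal (norm (x - y) powr (\<beta> - d)) * indicator E y \<partial>lborel) \<le> ennreal (C * m powr (\<beta> / d))"
    using riesz_indicator_bound[OF \<beta>] unfolding d_def by blast
  define e where "e = 1 - \<beta> * R / d"
  have e: "0 < e" using R d by (simp add: e_def d_def)
  have "(\<integral>\<^sup>+y. ennreal (norm (x - y) powr (\<beta> - d)) * (ennreal (h y) * indicator {..B} (h y)) \<partial>lborel)
      \<le> ennreal (C / e * B powr e)"
    if [measurable]: "h \<in> borel_measurable borel" and h0: "\<And>y. 0 \<le> h y"
      and h: "(\<integral>\<^sup>+y. ennreal (h y powr R) \<partial>lborel) \<le> 1" and B: "0 \<le> B"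
    for h :: "'a \<Rightarrow> real" and x B
  proof -
    let ?k = "\<lambda>y. ennreal (norm (x - y) powr (\<beta> - d))"
    have "(\<integral>\<^sup>+y. ?k y * (ennreal (h y) * indicator {..B} (h y)) \<partial>lborel) \<le>
      (\<integral>\<^sup>+y. \<integral>\<^sup>+b. ?k y * (indicator {0<..B} b * indicator {b..} (h y)) \<partial>lborel \<partial>lborel)"
    proof (rule nn_integral_mono)
      fix y
      have "ennreal (h y) * indicator {..B} (h y) \<le> (\<integral>\<^sup>+b. indicator {0<..B} b * indicator {b..} (h y) \<partial>lborel)"
      proof (cases "h y \<le> B")
        case True
        have "(\<integral>\<^sup>+b. indicator {0<..B} b * indicator {b..} (h y) \<partial>lborel) = (\<integral>\<^sup>+b. indicator {0<..h y} b \<partial>lborel)"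
          using True by (intro nn_integral_cong) (auto simp: indicator_def)
        then show ?thesis
          using True h0 by simp
      qed auto
      then show "?k y * (ennreal (h y) * indicator {..B} (h y)) \<le> (\<integral>\<^sup>+b. ?k y * (indicator {0<..B} b * indicator {b..} (h y)) \<partial>lborel)"
        by (subst nn_integral_cmult) (auto intro!: mult_left_mono simp: indicator_def)
    qed
    also have "\<dots> = (\<integral>\<^sup>+b. \<integral>\<^sup>+y. ?k y * (indicator {0<..B} b * indicator {b..} (h y)) \<partial>lborel \<partial>lborel)"
      by (rule lborel_pair.Fubini') (unfold indicator_def atLeast_iff greaterThanAtMost_iff, measurable)
    also have "\<dots> \<le> (\<integral>\<^sup>+b. ennreal C * (ennreal (b powr (e - 1)) * indicator {0..B} b) \<partial>lborel)"
    proof (rule nn_integral_mono)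
      fix b :: real
      show "(\<integral>\<^sup>+y. ?k y * (indicator {0<..B} b * indicator {b..} (h y)) \<partial>lborel) \<le> ennreal C * (ennreal (b powr (e - 1)) * indicator {0..B} b)"
      proof (cases "0 < b \<and> b \<le> B")
        case True
        define E where "E = {y. b \<le> h y}"
        have [measurable]: "E \<in> sets borel" unfolding E_def by measurable
        have "emeasure lborel E \<le> ennreal (b powr (- R)) * (\<integral>\<^sup>+y. ennreal (h y powr R) \<partial>lborel)"
        proof -
          have "emeasure lborel E = (\<integral>\<^sup>+y. indicator E y \<partial>lborel)"
            by simp
          also have "\<dots> \<le> (\<integral>\<^sup>+y. ennreal (b powr (- R)) * ennreal (h y powr R) \<partial>lborel)"
          proof (rule nn_integral_mono)
            fix y
            show "indicator E y \<le> ennreal (b powr (- R)) * ennreal (h y powr R)"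
            proof (cases "b \<le> h y")
              case le: True
              then have "b powr R \<le> h y powr R"
                using True R by (intro powr_mono2) auto
              then have "1 \<le> b powr (- R) * h y powr R"
                using True by (simp add: powr_minus field_simps)
              then show ?thesis
                by (simp add: E_def le ennreal_mult[symmetric] indicator_def)
            qed (simp add: E_def)
          qed
          finally show ?thesis
            by (simp add: nn_integral_cmult)
        qed
        also have "\<dots> \<le> ennreal (b powr (- R)) * 1"
          by (intro mult_left_mono h) auto
        finally have "emeasure lborel E \<le> ennreal (b powr (- R))" by simp
        then have "(\<integral>\<^sup>+y. ?k y * indicator E y \<partial>lborel) \<le> ennreal (C * (b powr (- R)) powr (\<beta> / d))"
          using True by (intro C) auto
        also have "(b powr (- R)) powr (\<beta> / d) = b powr (e - 1)"
          by (simp add: powr_powr e_def mult.commute)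
        finally show ?thesis
          using True C by (simp add: E_def indicator_def ennreal_mult)
      qed auto
    qed
    also have "\<dots> = ennreal C * ennreal (B powr e / e)"
      using nn_integral_has_integral_lebesgue'[OF _ has_integral_powr_from_0[of "e - 1" B]] e B
      by (subst nn_integral_cmult) auto
    finally show ?thesis
      using C e by (simp add: ennreal_mult'[symmetric])
  qed
  then show ?thesis
    using C e unfolding d_def[symmetric] e_def[symmetric] by (intro exI[of _ "C / e"]) auto
qed

text \<open>On the part where \<open>h x \<le> f y powr (P / R)\<close> the inner integral over \<open>x\<close> sees only a truncation of \<open>h\<close>;
  on the rest the roles of \<open>f\<close> and \<open>h\<close> are exchanged.\<close>

lemma riesz_bilinear_bound:
  fixes \<beta> P R :: real
  assumes \<beta>: "0 < \<beta>" "\<beta> < DIM('a::euclidean_space)" and P: "1 < P" and R: "1 < R"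
    and PR: "1 / P + 1 / R = 1 + \<beta> / DIM('a)"
  shows "\<exists>C>0. \<forall>(f::'a \<Rightarrow> real) h. f \<in> borel_measurable borel \<longrightarrow> h \<in> borel_measurable borel \<longrightarrow>
    (\<forall>y. 0 \<le> f y) \<longrightarrow> (\<forall>y. 0 \<le> h y) \<longrightarrow>
    (\<integral>\<^sup>+y. ennreal (f y powr P) \<partial>lborel) \<le> 1 \<longrightarrow> (\<integral>\<^sup>+y. ennreal (h y powr R) \<partial>lborel) \<le> 1 \<longrightarrow>
    (\<integral>\<^sup>+x. \<integral>\<^sup>+y. ennreal (norm (x - y) powr (\<beta> - DIM('a))) * (ennreal (f y) * ennreal (h x)) \<partial>lborel \<partial>lborel) \<le> ennreal C"
proof -
  define d where "d = real DIM('a)"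
  have d: "0 < d" by (simp add: d_def)
  have PR': "1 / P + 1 / R = 1 + \<beta> / d"
    using PR by (simp add: d_def)
  \<comment> \<open>P > 1 and R > 1 enter here: through the scaling relation, 1/R < 1 becomes
    \<beta>/d < 1/P, and likewise with P and R exchanged. At each end point of the edge one of the
    two inequalities fails.\<close>
  have lt: "\<beta> * P < d" "\<beta> * R < d"
  proof -
    have "1 / P < 1" "1 / R < 1" using P R by auto
    then have "\<beta> / d < 1 / P" "\<beta> / d < 1 / R" using PR' by linarith+
    then show "\<beta> * P < d" "\<beta> * R < d" using d P R by (auto simp: field_simps)
  qed
  \<comment> \<open>With the truncation level B = f(y)^(S/T), the potential bound C B^(1 - \<beta> T
    / d) becomes C f(y)^(S - 1); the remaining factor f(y) completes it to f(y)^S, whose integral is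
    at most 1.\<close>
  have expo: "S / T * (1 - \<beta> * T / d) = S - 1"
    if "1 < S" "1 < T" "1 / S + 1 / T = 1 + \<beta> / d" for S T
  proof -
    have "S / T * (1 - \<beta> * T / d) = S * (1 / T - \<beta> / d)"
      using that d by (simp add: right_diff_distrib)
    also have "1 / T - \<beta> / d = 1 - 1 / S"
      using that by linarith
    also have "S * (1 - 1 / S) = S - 1"
      using that by (simp add: right_diff_distrib)
    finally show ?thesis .
  qed
  have one_side: "\<exists>C>0. \<forall>(f::'a \<Rightarrow> real) h. f \<in> borel_measurable borel \<longrightarrow> h \<in> borel_measurable borel \<longrightarrow>
    (\<forall>y. 0 \<le> f y) \<longrightarrow> (\<forall>y. 0 \<le> h y) \<longrightarrow>
    (\<integral>\<^sup>+y. ennreal (f y powr S) \<partial>lborel) \<le> 1 \<longrightarrow> (\<integral>\<^sup>+y. ennreal (h y powr T) \<partial>lborel) \<le> 1 \<longrightarrow>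
    (\<integral>\<^sup>+y. \<integral>\<^sup>+x. ennreal (norm (y - x) powr (\<beta> - d)) * (ennreal (f y) * (ennreal (h x) * indicator {..f y powr (S / T)} (h x))) \<partial>lborel \<partial>lborel) \<le> ennreal C"
    if ST: "1 < S" "1 < T" "1 / S + 1 / T = 1 + \<beta> / d" "\<beta> * T < d" for S T
  proof -
    obtain C where C: "0 < C" "\<And>(h::'a \<Rightarrow> real) x B. h \<in> borel_measurable borel \<Longrightarrow> (\<forall>y. 0 \<le> h y) \<Longrightarrow>
      (\<integral>\<^sup>+y. ennreal (h y powr T) \<partial>lborel) \<le> 1 \<Longrightarrow> 0 \<le> B \<Longrightarrow>
      (\<integral>\<^sup>+y. ennreal (norm (x - y) powr (\<beta> - d)) * (ennreal (h y) * indicator {..B} (h y)) \<partial>lborel)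
        \<le> ennreal (C * B powr (1 - \<beta> * T / d))"
      using riesz_truncated_bound[OF \<beta> less_imp_le[OF ST(2)]] ST unfolding d_def by blast
    have "(\<integral>\<^sup>+y. \<integral>\<^sup>+x. ennreal (norm (y - x) powr (\<beta> - d)) * (ennreal (f y) * (ennreal (h x) * indicator {..f y powr (S / T)} (h x))) \<partial>lborel \<partial>lborel) \<le> ennreal C"
      if [measurable]: "f \<in> borel_measurable borel" "h \<in> borel_measurable borel"
      and nn: "\<forall>y. 0 \<le> f y" "\<forall>y. 0 \<le> h y"
      and f: "(\<integral>\<^sup>+y. ennreal (f y powr S) \<partial>lborel) \<le> 1" and h: "(\<integral>\<^sup>+y. ennreal (h y powr T) \<partial>lborel) \<le> 1"
      for f h :: "'a \<Rightarrow> real"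
    proof -
      have "(\<integral>\<^sup>+y. \<integral>\<^sup>+x. ennreal (norm (y - x) powr (\<beta> - d)) * (ennreal (f y) * (ennreal (h x) * indicator {..f y powr (S / T)} (h x))) \<partial>lborel \<partial>lborel)
        \<le> (\<integral>\<^sup>+y. ennreal C * ennreal (f y powr S) \<partial>lborel)"
      proof (rule nn_integral_mono)
        fix y
        have "(\<integral>\<^sup>+x. ennreal (norm (y - x) powr (\<beta> - d)) * (ennreal (f y) * (ennreal (h x) * indicator {..f y powr (S / T)} (h x))) \<partial>lborel) =
          ennreal (f y) * (\<integral>\<^sup>+x. ennreal (norm (y - x) powr (\<beta> - d)) * (ennreal (h x) * indicator {..f y powr (S / T)} (h x)) \<partial>lborel)"
          by (subst nn_integral_cmult[symmetric]) (auto simp: ac_simps)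
        also have "\<dots> \<le> ennreal (f y) * ennreal (C * (f y powr (S / T)) powr (1 - \<beta> * T / d))"
          using nn h by (intro mult_left_mono C) auto
        also have "(f y powr (S / T)) powr (1 - \<beta> * T / d) = f y powr (S - 1)"
          by (simp only: powr_powr expo[OF ST(1-3)])
        also have "ennreal (f y) * ennreal (C * f y powr (S - 1)) = ennreal (C * (f y powr 1 * f y powr (S - 1)))"
          using nn C by (simp add: ennreal_mult'[symmetric] mult.left_commute)
        also have "f y powr 1 * f y powr (S - 1) = f y powr S"
          unfolding powr_add[symmetric] by simp
        finally show "(\<integral>\<^sup>+x. ennreal (norm (y - x) powr (\<beta> - d)) * (ennreal (f y) * (ennreal (h x) * indicator {..f y powr (S / T)} (h x))) \<partial>lborel)
          \<le> ennreal C * ennreal (f y powr S)"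
          using C by (simp add: ennreal_mult)
      qed
      also have "\<dots> = ennreal C * (\<integral>\<^sup>+y. ennreal (f y powr S) \<partial>lborel)"
        by (rule nn_integral_cmult) measurable
      also have "\<dots> \<le> ennreal C * 1"
        by (rule mult_left_mono[OF f]) simp
      finally show ?thesis by simp
    qed
    then show ?thesis using C(1) by blast
  qed
  obtain C1 where C1: "0 < C1" "\<And>(f::'a \<Rightarrow> real) h. f \<in> borel_measurable borel \<Longrightarrow> h \<in> borel_measurable borel \<Longrightarrow>
    (\<forall>y. 0 \<le> f y) \<Longrightarrow> (\<forall>y. 0 \<le> h y) \<Longrightarrow>
    (\<integral>\<^sup>+y. ennreal (f y powr P) \<partial>lborel) \<le> 1 \<Longrightarrow> (\<integral>\<^sup>+y. ennreal (h y powr R) \<partial>lborel) \<le> 1 \<Longrightarrow>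
    (\<integral>\<^sup>+y. \<integral>\<^sup>+x. ennreal (norm (y - x) powr (\<beta> - d)) * (ennreal (f y) * (ennreal (h x) * indicator {..f y powr (P / R)} (h x))) \<partial>lborel \<partial>lborel) \<le> ennreal C1"
    using one_side[OF P R PR' lt(2)] by blast
  have RP: "1 / R + 1 / P = 1 + \<beta> / d" using PR' by simp
  obtain C2 where C2: "0 < C2" "\<And>(f::'a \<Rightarrow> real) h. f \<in> borel_measurable borel \<Longrightarrow> h \<in> borel_measurable borel \<Longrightarrow>
    (\<forall>y. 0 \<le> f y) \<Longrightarrow> (\<forall>y. 0 \<le> h y) \<Longrightarrow>
    (\<integral>\<^sup>+y. ennreal (f y powr R) \<partial>lborel) \<le> 1 \<Longrightarrow> (\<integral>\<^sup>+y. ennreal (h y powr P) \<partial>lborel) \<le> 1 \<Longrightarrow>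
    (\<integral>\<^sup>+y. \<integral>\<^sup>+x. ennreal (norm (y - x) powr (\<beta> - d)) * (ennreal (f y) * (ennreal (h x) * indicator {..f y powr (R / P)} (h x))) \<partial>lborel \<partial>lborel) \<le> ennreal C2"
    using one_side[OF R P RP lt(1)] by blast
  have "(\<integral>\<^sup>+x. \<integral>\<^sup>+y. ennreal (norm (x - y) powr (\<beta> - d)) * (ennreal (f y) * ennreal (h x)) \<partial>lborel \<partial>lborel) \<le> ennreal (C1 + C2)"
    if m [measurable]: "f \<in> borel_measurable borel" "h \<in> borel_measurable borel"
      and nn: "\<forall>y. 0 \<le> f y" "\<forall>y. 0 \<le> h y"
      and f: "(\<integral>\<^sup>+y. ennreal (f y powr P) \<partial>lborel) \<le> 1" and h: "(\<integral>\<^sup>+y. ennreal (h y powr R) \<partial>lborel) \<le> 1"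
      for f h :: "'a \<Rightarrow> real"
  proof -
    let ?k = "\<lambda>x y::'a. ennreal (norm (x - y) powr (\<beta> - d))"
    let ?U = "\<lambda>x y. ?k y x * (ennreal (f y) * (ennreal (h x) * indicator {..f y powr (P / R)} (h x)))"
    let ?V = "\<lambda>x y. ?k x y * (ennreal (h x) * (ennreal (f y) * indicator {..h x powr (R / P)} (f y)))"
    have [measurable]: "(\<lambda>(x, y). ?U x y) \<in> borel_measurable (lborel \<Otimes>\<^sub>M lborel)" "(\<lambda>(x, y). ?V x y) \<in> borel_measurable (lborel \<Otimes>\<^sub>M lborel)"
      unfolding indicator_def atMost_iff by measurable
    have "(\<integral>\<^sup>+x. \<integral>\<^sup>+y. ?k x y * (ennreal (f y) * ennreal (h x)) \<partial>lborel \<partial>lborel) \<le>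
      (\<integral>\<^sup>+x. \<integral>\<^sup>+y. ?U x y + ?V x y \<partial>lborel \<partial>lborel)"
    proof (intro nn_integral_mono)
      fix x y
      show "?k x y * (ennreal (f y) * ennreal (h x)) \<le> ?U x y + ?V x y"
      proof (cases "h x \<le> f y powr (P / R)")
        case True
        then show ?thesis
          by (intro add_increasing2) (auto simp: norm_minus_commute)
      next
        case False
        then have "(f y powr (P / R)) powr (R / P) \<le> h x powr (R / P)"
          using P R by (intro powr_mono2) auto
        then have "f y \<le> h x powr (R / P)"
          using P R nn by (simp add: powr_powr)
        then show ?thesis
          by (intro add_increasing) (auto simp: mult.commute[of "ennreal (h x)"])
      qed
    qed
    also have "\<dots> = (\<integral>\<^sup>+x. \<integral>\<^sup>+y. ?U x y \<partial>lborel \<partial>lborel) + (\<integral>\<^sup>+x. \<integral>\<^sup>+y. ?V x y \<partial>lborel \<partial>lborel)"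
      by (subst nn_integral_add[symmetric]) (auto intro!: nn_integral_cong nn_integral_add lborel.borel_measurable_nn_integral)
    also have "(\<integral>\<^sup>+x. \<integral>\<^sup>+y. ?U x y \<partial>lborel \<partial>lborel) = (\<integral>\<^sup>+y. \<integral>\<^sup>+x. ?U x y \<partial>lborel \<partial>lborel)"
      by (rule lborel_pair.Fubini') measurable
    also have "\<dots> + (\<integral>\<^sup>+x. \<integral>\<^sup>+y. ?V x y \<partial>lborel \<partial>lborel) \<le> ennreal C1 + ennreal C2"
      by (intro add_mono C1(2)[OF m nn f h] C2(2)[OF m(2,1) nn(2,1) h f])
    also have "\<dots> = ennreal (C1 + C2)"
      using C1 C2 by simp
    finally show ?thesis .
  qed
  then show ?thesis
    using C1(1) C2(1) unfolding d_def by (intro exI[of _ "C1 + C2"]) auto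
qed


section \<open>Comparison of the operator with the Riesz potential\<close>

lemma potential_kernel_le_riesz:
  fixes \<sigma> :: real
  assumes "0 < \<sigma>" "\<sigma> < real CARD('n) / 2"
  shows "\<exists>C>0. \<forall>(x::real^'n) y. x \<noteq> y \<longrightarrow> potential_kernel \<sigma> x y \<le> C * norm (x - y) powr (2 * \<sigma> - real CARD('n))"
proof -
  obtain C where C: "C > 0" "\<And>(x::real^'n) y. x \<noteq> y \<Longrightarrow> potential_kernel \<sigma> x y \<le>
    C * max 1 (norm x) powr (- 2 * 0) * norm (x - y) powr (2 * (\<sigma> - 0) - real CARD('n)) *
      exp (- (norm (x - y))\<^sup>2 / 16)"
    using potential_kernel_upper[OF assms order_refl] by blast
  have "potential_kernel \<sigma> x y \<le> C * norm (x - y) powr (2 * \<sigma> - real CARD('n))" if "x \<noteq> y" for x y :: "real^'n"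
  proof -
    have "max 1 (norm x) \<noteq> 0" by linarith
    then have "potential_kernel \<sigma> x y \<le> C * norm (x - y) powr (2 * \<sigma> - real CARD('n)) * exp (- (norm (x - y))\<^sup>2 / 16)"
      using C(2)[OF that] by simp
    also have "\<dots> \<le> C * norm (x - y) powr (2 * \<sigma> - real CARD('n)) * 1"
      using C(1) by (intro mult_left_mono) auto
    finally show ?thesis by simp
  qed
  then show ?thesis using C(1) by blast
qed

lemma potential_operator_le_riesz:
  fixes \<sigma> :: real
  assumes \<sigma>: "0 < \<sigma>" "\<sigma> < real CARD('n) / 2"
  shows "\<exists>C>0. \<forall>g. g \<in> borel_measurable borel \<longrightarrow> (\<forall>y. 0 \<le> g y) \<longrightarrow> (\<forall>x::real^'n. ennreal (potential_operator \<sigma> g x) \<le>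
    ennreal C * (\<integral>\<^sup>+y. ennreal (norm (x - y) powr (2 * \<sigma> - real CARD('n))) * ennreal (g y) \<partial>lborel))"
proof -
  obtain C where C: "C > 0" "\<And>(x::real^'n) y. x \<noteq> y \<Longrightarrow> potential_kernel \<sigma> x y \<le> C * norm (x - y) powr (2 * \<sigma> - real CARD('n))"
    using potential_kernel_le_riesz[OF \<sigma>] by blast
  have "ennreal (potential_operator \<sigma> g x) \<le>
    ennreal C * (\<integral>\<^sup>+y. ennreal (norm (x - y) powr (2 * \<sigma> - real CARD('n))) * ennreal (g y) \<partial>lborel)"
    if [measurable]: "g \<in> borel_measurable borel" and g: "\<And>y. 0 \<le> g y" for g and x :: "real^'n"
  proof -
    have "ennreal (potential_operator \<sigma> g x) \<le> (\<integral>\<^sup>+y. ennreal (potential_kernel \<sigma> x y * g y) \<partial>lborel)"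
      by (rule potential_operator_le_nn_integral) (use \<sigma> g in auto)
    also have "\<dots> \<le> (\<integral>\<^sup>+y. ennreal C * (ennreal (norm (x - y) powr (2 * \<sigma> - real CARD('n))) * ennreal (g y)) \<partial>lborel)"
      using AE_lborel_neq[of x]
    proof (intro nn_integral_mono_AE, eventually_elim)
      case (elim y)
      have "potential_kernel \<sigma> x y * g y \<le> (C * norm (x - y) powr (2 * \<sigma> - real CARD('n))) * g y"
        by (intro mult_right_mono C(2) elim g)
      then show ?case
        using C(1) g by (simp add: ennreal_mult'[symmetric] mult.assoc ennreal_leI)
    qed
    also have "\<dots> = ennreal C * (\<integral>\<^sup>+y. ennreal (norm (x - y) powr (2 * \<sigma> - real CARD('n))) * ennreal (g y) \<partial>lborel)"
      by (rule nn_integral_cmult) measurable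
    finally show ?thesis .
  qed
  then show ?thesis using C(1) by blast
qed

text \<open>Truncation and Tonelli are carried out with Borel functions and \<open>lborel\<close>,
  whereas \<open>potential_operator_measurable\<close> supplies Lebesgue measurability. Replacing G
  by max(0, G) gives the sign at every point.\<close>

lemma potential_operator_borel_representative:
  fixes g :: "real^'n \<Rightarrow> real"
  assumes "0 < \<sigma>" "g \<in> borel_measurable borel" "\<And>y. 0 \<le> g y"
  obtains G where "G \<in> borel_measurable borel" "\<And>x. 0 \<le> G x" "AE x in lebesgue. potential_operator \<sigma> g x = G x"
proof -
  have "potential_operator \<sigma> g \<in> borel_measurable lebesgue"
    using assms(2) by (intro potential_operator_measurable measurable_completion) simp
  then obtain G where G: "G \<in> borel_measurable borel" "AE x in lebesgue. potential_operator \<sigma> g x = G x"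
    by (rule lebesgue_borel_representative)
  show thesis
  proof (rule that[of "\<lambda>x. max 0 (G x)"])
    show "AE x in lebesgue. potential_operator \<sigma> g x = max 0 (G x)"
      using G(2)
    proof eventually_elim
      case (elim x)
      then show ?case
        using potential_operator_nonneg[OF assms(1), of g x] assms(3) by (metis max.absorb2)
    qed
  qed (use G in auto)
qed

lemma AE_lebesgue_iff_lborel: "(AE x in lebesgue. P x) \<longleftrightarrow> (AE x in lborel. P (x :: 'a::euclidean_space))"
  by (auto simp: AE_completion_iff)

text \<open>Duality by testing with \<open>b\<^bsup>Q - 1\<^esup>\<close>, where the truncation \<open>b\<close> of the potential to a ball
  makes the norm to be estimated finite.\<close>

lemma bounded_hardy_littlewood_sobolev:
  fixes \<sigma> P Q :: real
  assumes \<sigma>: "0 < \<sigma>" "\<sigma> < real CARD('n) / 2" and P: "1 < P" and Q: "0 < Q"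
    and PQ: "1 / Q = 1 / P - 2 * \<sigma> / real CARD('n)"
  shows "bounded_Lp_Lq (potential_operator \<sigma> :: (real^'n \<Rightarrow> real) \<Rightarrow> _) (ennreal P) (ennreal Q)"
proof -
  define d where "d = real CARD('n)"
  have d: "0 < d" "real DIM(real^'n) = d" by (simp_all add: d_def)
  have "1 / Q < 1 / P" using PQ \<sigma> by simp
  then have "P < Q" using P Q by (simp add: field_simps)
  then have Q1: "1 < Q" using P by simp
  \<comment> \<open>Conjugate exponent of Q; the relation between P and Q is then the scaling
    relation of the bilinear bound.\<close>
  define R where "R = Q / (Q - 1)"
  have R: "1 < R" "1 / R = 1 - 1 / Q" "(Q - 1) * R = Q"
    using Q1 by (auto simp: R_def field_simps)
  have PR: "1 / P + 1 / R = 1 + 2 * \<sigma> / DIM(real^'n)"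
    using R PQ by simp
  have \<beta>: "0 < 2 * \<sigma>" "2 * \<sigma> < DIM(real^'n)" using \<sigma> by auto
  obtain B where B: "0 < B" "\<And>(f::real^'n \<Rightarrow> real) h. f \<in> borel_measurable borel \<Longrightarrow> h \<in> borel_measurable borel \<Longrightarrow>
    (\<forall>y. 0 \<le> f y) \<Longrightarrow> (\<forall>y. 0 \<le> h y) \<Longrightarrow>
    (\<integral>\<^sup>+y. ennreal (f y powr P) \<partial>lborel) \<le> 1 \<Longrightarrow> (\<integral>\<^sup>+y. ennreal (h y powr R) \<partial>lborel) \<le> 1 \<Longrightarrow>
    (\<integral>\<^sup>+x. \<integral>\<^sup>+y. ennreal (norm (x - y) powr (2 * \<sigma> - d)) * (ennreal (f y) * ennreal (h x)) \<partial>lborel \<partial>lborel) \<le> ennreal B"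
    using riesz_bilinear_bound[OF \<beta> P R(1) PR] unfolding d(2) by blast
  obtain C where C: "C > 0" "\<And>g (x::real^'n). g \<in> borel_measurable borel \<Longrightarrow> (\<forall>y. 0 \<le> g y) \<Longrightarrow> ennreal (potential_operator \<sigma> g x) \<le>
    ennreal C * (\<integral>\<^sup>+y. ennreal (norm (x - y) powr (2 * \<sigma> - d)) * ennreal (g y) \<partial>lborel)"
    using potential_operator_le_riesz[OF \<sigma>] unfolding d_def by blast
  show ?thesis
  proof (rule bounded_Lp_Lq_finiteI[OF \<sigma>(1), where M = "(C * B) powr Q"])
    fix g :: "real^'n \<Rightarrow> real"
    assume g: "g \<in> unit_ball_Lp (ennreal P)"
    note gm [measurable] = unit_ball_LpD(1)[OF g]
    note g0 = unit_ball_LpD(3)[OF g]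
    note g1 = unit_ball_Lp_ennreal[OF less_imp_le[OF P] g]
    obtain G where G [measurable]: "G \<in> borel_measurable borel" and G0: "\<And>x. 0 \<le> G x"
      and GI: "AE x in lebesgue. potential_operator \<sigma> g x = G x"
      using potential_operator_borel_representative[OF \<sigma>(1) gm g0] by blast
    have Gle: "AE x in lborel. ennreal (G x) \<le> ennreal C * (\<integral>\<^sup>+y. ennreal (norm (x - y) powr (2 * \<sigma> - d)) * ennreal (g y) \<partial>lborel)"
      using GI unfolding AE_lebesgue_iff_lborel
    proof eventually_elim
      case (elim x)
      then show ?case using C(2)[OF gm, of x] g0 by metis
    qed
    define b where "b = (\<lambda>n x. min (G x) (real n) * indicat_real (cball 0 (real n)) x)"
    have [measurable]: "b n \<in> borel_measurable borel" for n
      unfolding b_def by (intro borel_measurable_times borel_measurable_indicator borel_closed) measurable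
    have b0: "0 \<le> b n x" "b n x \<le> G x" "b n x \<le> real n" for n x
      using G0[of x] by (auto simp: b_def indicator_def)
    have bound: "(\<integral>\<^sup>+x. ennreal (b n x powr Q) \<partial>lborel) \<le> ennreal ((C * B) powr Q)" for n
    proof -
      \<comment> \<open>A crude bound by n^Q times the volume of the ball; it makes \<eta> finite,
        which allows the division by \<open>c\<close> below.\<close>
      have "(\<integral>\<^sup>+x. ennreal (b n x powr Q) \<partial>lborel) \<le> (\<integral>\<^sup>+x. ennreal (real n powr Q) * indicator (cball 0 (real n)) (x::real^'n) \<partial>lborel)"
      proof (rule nn_integral_mono)
        fix x :: "real^'n"
        have "b n x powr Q \<le> real n powr Q" "x \<notin> cball 0 (real n) \<Longrightarrow> b n x = 0"
          using b0 Q by (auto intro!: powr_mono2 simp: b_def)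
        then show "ennreal (b n x powr Q) \<le> ennreal (real n powr Q) * indicator (cball 0 (real n)) x"
          by (cases "x \<in> cball 0 (real n)") (auto intro!: ennreal_leI)
      qed
      also have "\<dots> < \<infinity>"
        by (subst nn_integral_cmult_indicator) (auto simp: emeasure_cball ennreal_mult_less_top)
      finally obtain \<eta> where \<eta>: "0 \<le> \<eta>" "(\<integral>\<^sup>+x. ennreal (b n x powr Q) \<partial>lborel) = ennreal \<eta>"
        by (cases "\<integral>\<^sup>+x. ennreal (b n x powr Q) \<partial>lborel") auto
      show ?thesis
      proof (cases "\<eta> = 0")
        case False
        with \<eta> have \<eta>0: "0 < \<eta>" by simp
        \<comment> \<open>\<open>c\<close> is the L^R norm of b^(Q - 1), as (Q - 1) R = Q. Testing
          against the normalised \<open>h\<close> gives \<eta> \<le> c C B, and \<eta> / c =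
          \<eta>^(1/Q).\<close>
        define c where "c = \<eta> powr (1 / R)"
        have c: "0 < c" using \<eta>0 by (simp add: c_def)
        define h where "h = (\<lambda>x. b n x powr (Q - 1) / c)"
        have hm [measurable]: "h \<in> borel_measurable borel" unfolding h_def by measurable
        have h0: "0 \<le> h x" for x using c by (simp add: h_def)
        have "(\<integral>\<^sup>+x. ennreal (h x powr R) \<partial>lborel) = (\<integral>\<^sup>+x. ennreal (1 / \<eta>) * ennreal (b n x powr Q) \<partial>lborel)"
        proof (rule nn_integral_cong)
          fix x
          have "c powr R = \<eta>"
            using \<eta>0 R(1) by (simp add: c_def powr_powr)
          then have "h x powr R = b n x powr Q / \<eta>"
            using c by (simp add: h_def powr_divide powr_powr R(3))
          then show "ennreal (h x powr R) = ennreal (1 / \<eta>) * ennreal (b n x powr Q)"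
            using \<eta>0 by (simp add: ennreal_mult[symmetric])
        qed
        also have "\<dots> = ennreal (1 / \<eta>) * ennreal \<eta>"
          by (simp add: nn_integral_cmult \<eta>(2))
        also have "\<dots> = 1"
          using \<eta>0 by (simp add: ennreal_mult[symmetric])
        finally have h1: "(\<integral>\<^sup>+x. ennreal (h x powr R) \<partial>lborel) \<le> 1" by simp
        have "ennreal \<eta> \<le> (\<integral>\<^sup>+x. ennreal c * (ennreal C * (\<integral>\<^sup>+y. ennreal (norm (x - y) powr (2 * \<sigma> - d)) * (ennreal (g y) * ennreal (h x)) \<partial>lborel)) \<partial>lborel)"
          unfolding \<eta>(2)[symmetric] using Gle
        proof (intro nn_integral_mono_AE, eventually_elim)
          case (elim x)
          have "b n x powr Q = b n x powr 1 * b n x powr (Q - 1)"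
            unfolding powr_add[symmetric] by simp
          also have "\<dots> \<le> G x * (c * h x)"
            using b0[of n x] c by (intro mult_mono) (auto simp: h_def)
          finally have "ennreal (b n x powr Q) \<le> ennreal (G x) * (ennreal c * ennreal (h x))"
            using c h0 G0 by (simp add: ennreal_mult[symmetric] ennreal_leI)
          also have "\<dots> \<le> (ennreal C * (\<integral>\<^sup>+y. ennreal (norm (x - y) powr (2 * \<sigma> - d)) * ennreal (g y) \<partial>lborel)) * (ennreal c * ennreal (h x))"
            by (intro mult_right_mono elim) auto
          also have "\<dots> = ennreal c * (ennreal C * ((\<integral>\<^sup>+y. ennreal (norm (x - y) powr (2 * \<sigma> - d)) * ennreal (g y) \<partial>lborel) * ennreal (h x)))"
            by (simp only: ac_simps)
          also have "(\<integral>\<^sup>+y. ennreal (norm (x - y) powr (2 * \<sigma> - d)) * ennreal (g y) \<partial>lborel) * ennreal (h x) =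
            (\<integral>\<^sup>+y. ennreal (norm (x - y) powr (2 * \<sigma> - d)) * (ennreal (g y) * ennreal (h x)) \<partial>lborel)"
            by (subst nn_integral_multc[symmetric]) (auto simp: mult.assoc)
          finally show ?case .
        qed
        also have "\<dots> = ennreal c * (ennreal C * (\<integral>\<^sup>+x. \<integral>\<^sup>+y. ennreal (norm (x - y) powr (2 * \<sigma> - d)) * (ennreal (g y) * ennreal (h x)) \<partial>lborel \<partial>lborel))"
          by (simp add: nn_integral_cmult)
        also have "\<dots> \<le> ennreal c * (ennreal C * ennreal B)"
          using g0 h0 by (intro mult_left_mono B gm hm g1 h1) auto
        also have "\<dots> = ennreal (c * (C * B))"
          using c C B by (simp add: ennreal_mult)
        finally have "\<eta> \<le> c * (C * B)"
          using c C B by (simp add: ennreal_le_iff)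
        then have "\<eta> powr 1 / c \<le> C * B"
          using c \<eta>0 by (simp add: divide_le_eq mult.commute)
        moreover have "\<eta> powr 1 / c = \<eta> powr (1 / Q)"
          unfolding c_def powr_diff[symmetric] R(2) by simp
        ultimately have "(\<eta> powr (1 / Q)) powr Q \<le> (C * B) powr Q"
          using Q by (intro powr_mono2) auto
        then show ?thesis
          using \<eta> \<eta>0 Q by (simp add: powr_powr ennreal_leI)
      qed (simp add: \<eta>)
    qed
    have "(\<integral>\<^sup>+x. ennreal (potential_operator \<sigma> g x powr Q) \<partial>lebesgue) = (\<integral>\<^sup>+x. ennreal (G x powr Q) \<partial>lebesgue)"
      by (rule nn_integral_cong_AE) (use GI in eventually_elim, simp)
    also have "\<dots> = (\<integral>\<^sup>+x. ennreal (G x powr Q) \<partial>lborel)"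
      by (simp add: nn_integral_completion)
    also have "\<dots> \<le> (\<integral>\<^sup>+x. (SUP n. ennreal (b n x powr Q)) \<partial>lborel)"
    proof (rule nn_integral_mono)
      fix x
      \<comment> \<open>The truncations reach \<open>G x\<close> after finitely many steps, so no
        limit has to be taken at a fixed point.\<close>
      obtain n where n: "max (G x) (norm x) \<le> real n" using real_arch_simple by blast
      then have "b n x = G x" by (simp add: b_def)
      then show "ennreal (G x powr Q) \<le> (SUP n. ennreal (b n x powr Q))"
        by (metis SUP_upper UNIV_I)
    qed
    also have "\<dots> = (SUP n. \<integral>\<^sup>+x. ennreal (b n x powr Q) \<partial>lborel)"
    proof (rule nn_integral_monotone_convergence_SUP)
      have "b n x \<le> b m x" if "n \<le> m" for n m x
        using that G0[of x] by (auto simp: b_def indicator_def min_def)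
      then show "incseq (\<lambda>n x. ennreal (b n x powr Q))"
        using b0 Q by (intro incseq_SucI le_funI ennreal_leI powr_mono2) auto
    qed measurable
    also have "\<dots> \<le> ennreal ((C * B) powr Q)"
      by (intro SUP_least bound)
    finally show "(\<integral>\<^sup>+x. ennreal (potential_operator \<sigma> g x powr Q) \<partial>lebesgue) \<le> ennreal ((C * B) powr Q)" .
  qed (use P Q1 B C in auto)
qed

text \<open>Tonelli moves the potential from g to the level set F: s |F| is at most C times the
  integral of g times the Riesz potential of F, hence at most C B |F|^(2\<sigma>/d). Dividing by
  |F|^(2\<sigma>/d) requires |F| to be finite, so F is first cut off by balls.\<close>

lemma weak_type_from_L1:
  fixes \<sigma> Q :: real
  assumes \<sigma>: "0 < \<sigma>" "\<sigma> < real CARD('n) / 2" and Q: "0 < Q" "1 / Q = 1 - 2 * \<sigma> / real CARD('n)"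
  shows "weak_type (potential_operator \<sigma> :: (real^'n \<Rightarrow> real) \<Rightarrow> _) 1 (ennreal Q)"
proof -
  define d where "d = real CARD('n)"
  have d: "0 < d" "real DIM(real^'n) = d" by (simp_all add: d_def)
  define \<alpha> where "\<alpha> = 2 * \<sigma> / d"
  have \<alpha>: "0 < \<alpha>" "1 / Q = 1 - \<alpha>" using \<sigma> Q d by (auto simp: \<alpha>_def d_def)
  have "1 / Q < 1" using \<alpha> by simp
  then have Q1: "1 < Q" using Q(1) by (simp add: divide_less_eq)
  have \<beta>: "0 < 2 * \<sigma>" "2 * \<sigma> < DIM(real^'n)" using \<sigma> by auto
  obtain B where B: "0 < B" "\<And>(E::(real^'n) set) m x. E \<in> sets borel \<Longrightarrow> 0 < m \<Longrightarrow> emeasure lborel E \<le> ennreal m \<Longrightarrow>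
    (\<integral>\<^sup>+y. ennreal (norm (x - y) powr (2 * \<sigma> - d)) * indicator E y \<partial>lborel) \<le> ennreal (B * m powr \<alpha>)"
    using riesz_indicator_bound[OF \<beta>] unfolding d(2) \<alpha>_def by blast
  obtain C where C: "C > 0" "\<And>g (x::real^'n). g \<in> borel_measurable borel \<Longrightarrow> (\<forall>y. 0 \<le> g y) \<Longrightarrow> ennreal (potential_operator \<sigma> g x) \<le>
    ennreal C * (\<integral>\<^sup>+y. ennreal (norm (x - y) powr (2 * \<sigma> - d)) * ennreal (g y) \<partial>lborel)"
    using potential_operator_le_riesz[OF \<sigma>] unfolding d_def by blast
  show ?thesis
  proof (rule weak_type_finiteI[OF \<sigma>(1), where M = "(C * B) powr Q"])
    fix g :: "real^'n \<Rightarrow> real" and s :: real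
    assume g: "g \<in> unit_ball_Lp 1" and s: "0 < s"
    note gm [measurable] = unit_ball_LpD(1)[OF g]
    note g0 = unit_ball_LpD(3)[OF g]
    have g1: "(\<integral>\<^sup>+x. ennreal (g x) \<partial>lborel) \<le> 1"
      using unit_ball_Lp_ennreal[of 1 g] g g0 by simp
    obtain G where G [measurable]: "G \<in> borel_measurable borel" and G0: "\<And>x. 0 \<le> G x"
      and GI: "AE x in lebesgue. potential_operator \<sigma> g x = G x"
      using potential_operator_borel_representative[OF \<sigma>(1) gm g0] by blast
    have Gle: "AE x in lborel. ennreal (G x) \<le> ennreal C * (\<integral>\<^sup>+y. ennreal (norm (x - y) powr (2 * \<sigma> - d)) * ennreal (g y) \<partial>lborel)"
      using GI unfolding AE_lebesgue_iff_lborel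
    proof eventually_elim
      case (elim x)
      then show ?case using C(2)[OF gm, of x] g0 by metis
    qed
    define F where "F = (\<lambda>n. {x. s < G x} \<inter> cball 0 (real n))"
    have Fm [measurable]: "F n \<in> sets borel" for n
      unfolding F_def by (rule sets.Int[OF _ borel_closed]) (simp_all add: G)
    have bound: "emeasure lborel (F n) \<le> ennreal ((C * B) powr Q * s powr (- Q))" for n
    proof -
      have "emeasure lborel (F n) \<le> emeasure lborel (cball 0 (real n) :: (real^'n) set)"
        by (intro emeasure_mono) (auto simp: F_def)
      also have "\<dots> < \<infinity>" by (simp add: emeasure_cball)
      finally obtain m where m: "0 \<le> m" "emeasure lborel (F n) = ennreal m"
        by (cases "emeasure lborel (F n)") auto
      show ?thesis
      proof (cases "m = 0")
        case False
        with m have m0: "0 < m" by simp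
        have "ennreal (s * m) = (\<integral>\<^sup>+x. ennreal s * indicator (F n) x \<partial>lborel)"
          using s by (simp add: nn_integral_cmult_indicator m ennreal_mult'[symmetric])
        also have "\<dots> \<le> (\<integral>\<^sup>+x. ennreal C * (\<integral>\<^sup>+y. ennreal (norm (y - x) powr (2 * \<sigma> - d)) * (ennreal (g y) * indicator (F n) x) \<partial>lborel) \<partial>lborel)"
          using Gle
        proof (intro nn_integral_mono_AE, eventually_elim)
          case (elim x)
          show ?case
          proof (cases "x \<in> F n")
            case True
            then have "ennreal s \<le> ennreal (G x)"
              by (intro ennreal_leI) (simp add: F_def)
            also note elim(2)
            finally show ?thesis
              using True by (simp add: norm_minus_commute)
          qed simp
        qed
        also have "\<dots> = ennreal C * (\<integral>\<^sup>+x. \<integral>\<^sup>+y. ennreal (norm (y - x) powr (2 * \<sigma> - d)) * (ennreal (g y) * indicator (F n) x) \<partial>lborel \<partial>lborel)"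
          by (simp add: nn_integral_cmult)
        also have "(\<integral>\<^sup>+x. \<integral>\<^sup>+y. ennreal (norm (y - x) powr (2 * \<sigma> - d)) * (ennreal (g y) * indicator (F n) x) \<partial>lborel \<partial>lborel) =
          (\<integral>\<^sup>+y. \<integral>\<^sup>+x. ennreal (norm (y - x) powr (2 * \<sigma> - d)) * (ennreal (g y) * indicator (F n) x) \<partial>lborel \<partial>lborel)"
          by (rule lborel_pair.Fubini') measurable
        also have "\<dots> \<le> (\<integral>\<^sup>+y. ennreal (B * m powr \<alpha>) * ennreal (g y) \<partial>lborel)"
        proof (rule nn_integral_mono)
          fix y
          have "(\<integral>\<^sup>+x. ennreal (norm (y - x) powr (2 * \<sigma> - d)) * (ennreal (g y) * indicator (F n) x) \<partial>lborel) =
            (\<integral>\<^sup>+x. ennreal (norm (y - x) powr (2 * \<sigma> - d)) * indicator (F n) x \<partial>lborel) * ennreal (g y)"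
            by (subst nn_integral_multc[symmetric]) (auto simp: ac_simps)
          also have "\<dots> \<le> ennreal (B * m powr \<alpha>) * ennreal (g y)"
            by (intro mult_right_mono B(2)[OF Fm m0]) (auto simp: m)
          finally show "(\<integral>\<^sup>+x. ennreal (norm (y - x) powr (2 * \<sigma> - d)) * (ennreal (g y) * indicator (F n) x) \<partial>lborel) \<le> \<dots>" .
        qed
        also have "\<dots> = ennreal (B * m powr \<alpha>) * (\<integral>\<^sup>+y. ennreal (g y) \<partial>lborel)"
          by (rule nn_integral_cmult) measurable
        also have "\<dots> \<le> ennreal (B * m powr \<alpha>) * 1"
          by (rule mult_left_mono[OF g1]) simp
        finally have "ennreal (s * m) \<le> ennreal C * (ennreal (B * m powr \<alpha>) * 1)"
          by (simp add: mult_left_mono)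
        then have "ennreal (s * m) \<le> ennreal (C * (B * m powr \<alpha>))"
          using C B by (simp add: ennreal_mult')
        then have "s * m \<le> C * B * m powr \<alpha>"
          using C B by (simp add: mult.assoc)
        then have "m powr 1 / m powr \<alpha> \<le> C * B / s"
          using m0 s by (simp add: field_simps)
        also have "m powr 1 / m powr \<alpha> = m powr (1 / Q)"
          unfolding powr_diff[symmetric] \<alpha>(2) by simp
        finally have "(m powr (1 / Q)) powr Q \<le> (C * B / s) powr Q"
          using Q by (intro powr_mono2) auto
        moreover have "(m powr (1 / Q)) powr Q = m"
          using m0 Q(1) by (simp add: powr_powr)
        moreover have "(C * B / s) powr Q = (C * B) powr Q * s powr (- Q)"
          unfolding powr_divide powr_minus by (simp add: divide_inverse)
        ultimately have "m \<le> (C * B) powr Q * s powr (- Q)"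
          by simp
        then show ?thesis by (simp add: m ennreal_leI)
      qed (simp add: m)
    qed
    have "emeasure lebesgue {x. s < potential_operator \<sigma> g x} = emeasure lebesgue {x. s < G x}"
    proof (rule emeasure_eq_AE)
      show "AE x in lebesgue. x \<in> {x. s < potential_operator \<sigma> g x} \<longleftrightarrow> x \<in> {x. s < G x}"
        using GI by eventually_elim simp
      have "potential_operator \<sigma> g \<in> borel_measurable lebesgue"
        using unit_ball_LpD(2)[OF g] by (rule potential_operator_measurable)
      then have "{x \<in> space lebesgue. s < potential_operator \<sigma> g x} \<in> sets lebesgue"
        by measurable
      then show "{x. s < potential_operator \<sigma> g x} \<in> sets lebesgue" by simp
      show "{x. s < G x} \<in> sets lebesgue"
        by (intro sets_completionI_sets) simp
    qed
    also have "{x. s < G x} = (\<Union>n. F n)"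
      unfolding F_def using real_arch_simple by (auto simp: F_def)
    also have "emeasure lebesgue (\<Union>n. F n) = (SUP n. emeasure lborel (F n))"
    proof -
      have "incseq F"
        by (auto simp: F_def incseq_def)
      then have "(SUP n. emeasure lborel (F n)) = emeasure lborel (\<Union>n. F n)"
        by (intro SUP_emeasure_incseq) auto
      then show ?thesis by simp
    qed
    also have "\<dots> \<le> ennreal ((C * B) powr Q * s powr (- Q))"
      by (intro SUP_least bound)
    finally show "emeasure lebesgue {x. s < potential_operator \<sigma> g x} \<le> ennreal ((C * B) powr Q * s powr (- Q))" .
  qed (use Q1 B C in auto)
qed

text \<open>With \<rho> = 1/|x| the inner part is of order \<rho>^(2\<sigma>), the outer one
  |x|^(-2\<theta>) \<rho>^(2(\<sigma> - \<theta>)), and both equal |x|^(-2\<sigma>) for every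
  \<theta> > \<sigma>. The choice \<theta> = 2\<sigma> gives both radial integrals the same constant
  \<open>A\<close>. Unlike the weight argument, this reaches the full exponent.\<close>

lemma potential_operator_decay:
  fixes \<sigma> :: real
  assumes \<sigma>: "0 < \<sigma>" "\<sigma> < real CARD('n) / 2"
  shows "\<exists>C>0. \<forall>g\<in>unit_ball_Lp \<infinity>. \<forall>x::real^'n. 1 \<le> norm x \<longrightarrow> potential_operator \<sigma> g x \<le> C * norm x powr (- 2 * \<sigma>)"
proof -
  define d where "d = real CARD('n)"
  have d: "0 < d" "real DIM(real^'n) = d" by (simp_all add: d_def)
  obtain C1 where C1: "C1 > 0" "\<And>(x::real^'n) y. x \<noteq> y \<Longrightarrow> potential_kernel \<sigma> x y \<le> C1 * norm (x - y) powr (2 * \<sigma> - d)"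
    using potential_kernel_le_riesz[OF \<sigma>] unfolding d_def by blast
  have s2: "0 \<le> 2 * \<sigma>" using \<sigma> by simp
  obtain C2 where C2: "C2 > 0" "\<And>(x::real^'n) y. x \<noteq> y \<Longrightarrow> potential_kernel \<sigma> x y \<le>
    C2 * max 1 (norm x) powr (- 2 * (2 * \<sigma>)) * norm (x - y) powr (2 * (\<sigma> - 2 * \<sigma>) - d) *
      exp (- (norm (x - y))\<^sup>2 / 16)"
    using potential_kernel_upper[OF \<sigma> s2] unfolding d_def by blast
  define A where "A = d * unit_ball_vol d / (2 * \<sigma>)"
  have A: "0 \<le> A" using \<sigma> d by (simp add: A_def)
  have "potential_operator \<sigma> g x \<le> (C1 * A + C2 * A + 1) * norm x powr (- 2 * \<sigma>)"
    if g: "g \<in> unit_ball_Lp \<infinity>" and x: "1 \<le> norm x" for g and x :: "real^'n"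
  proof -
    note gm [measurable] = unit_ball_LpD(1)[OF g]
    note g0 = unit_ball_LpD(3)[OF g]
    define \<rho> where "\<rho> = 1 / norm x"
    have \<rho>: "0 < \<rho>" using x unfolding \<rho>_def by (intro divide_pos_pos) linarith+
    let ?\<phi> = "\<lambda>z::real^'n. ennreal (norm z powr (- (d - 2 * \<sigma>))) * indicator {0..\<rho>} (norm z)"
    let ?\<psi> = "\<lambda>z::real^'n. ennreal (norm z powr (- (d + 2 * \<sigma>))) * indicator {\<rho>..} (norm z)"
    define c where "c = C2 * norm x powr (- 4 * \<sigma>)"
    have c: "0 \<le> c" using C2 by (simp add: c_def)
    have "ennreal (potential_operator \<sigma> g x) \<le> (\<integral>\<^sup>+y. ennreal (potential_kernel \<sigma> x y * g y) \<partial>lborel)"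
      by (rule potential_operator_le_nn_integral) (use \<sigma> g0 in auto)
    also have "\<dots> \<le> (\<integral>\<^sup>+y. ennreal C1 * ?\<phi> (x - y) + ennreal c * ?\<psi> (x - y) \<partial>lborel)"
      using AE_lborel_neq[of x]
    proof (intro nn_integral_mono_AE, eventually_elim)
      case (elim y)
      have "potential_kernel \<sigma> x y * g y \<le> potential_kernel \<sigma> x y"
        using unit_ball_Lp_infinity[OF g, of y] potential_kernel_nonneg[OF \<sigma>(1), of x y] g0 by (intro mult_left_le) auto
      then have le: "ennreal (potential_kernel \<sigma> x y * g y) \<le> ennreal (potential_kernel \<sigma> x y)"
        by (rule ennreal_leI)
      have "ennreal (potential_kernel \<sigma> x y) \<le> ennreal C1 * ?\<phi> (x - y) + ennreal c * ?\<psi> (x - y)"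
      proof (cases "norm (x - y) \<le> \<rho>")
        case True
        have "ennreal (potential_kernel \<sigma> x y) \<le> ennreal C1 * ?\<phi> (x - y)"
          using C1(1) C1(2)[OF elim(2)] True by (simp add: ennreal_mult[symmetric] ennreal_leI)
        then show ?thesis
          by (rule add_increasing2[rotated]) simp
      next
        case False
        have m: "max 1 (norm x) = norm x" using x by simp
        have e1: "2 * (\<sigma> - 2 * \<sigma>) - d = - (d + 2 * \<sigma>)" and e2: "- 2 * (2 * \<sigma>) = - 4 * \<sigma>"
          by simp_all
        have "potential_kernel \<sigma> x y \<le> c * norm (x - y) powr (- (d + 2 * \<sigma>)) * exp (- (norm (x - y))\<^sup>2 / 16)"
          using C2(2)[OF elim(2)] unfolding m c_def e1 e2 .
        also have "\<dots> \<le> c * norm (x - y) powr (- (d + 2 * \<sigma>)) * 1"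
          using c by (intro mult_left_mono) auto
        finally have "ennreal (potential_kernel \<sigma> x y) \<le> ennreal c * ?\<psi> (x - y)"
          using c False by (simp add: ennreal_mult[symmetric] ennreal_leI)
        then show ?thesis
          by (rule add_increasing[rotated]) simp
      qed
      with le show ?case by (rule order_trans)
    qed
    also have "\<dots> = ennreal C1 * (\<integral>\<^sup>+y. ?\<phi> (x - y) \<partial>lborel) + ennreal c * (\<integral>\<^sup>+y. ?\<psi> (x - y) \<partial>lborel)"
      by (subst nn_integral_add) (auto simp: nn_integral_cmult)
    also have "(\<integral>\<^sup>+y. ?\<phi> (x - y) \<partial>lborel) = (\<integral>\<^sup>+z. ?\<phi> z \<partial>lborel)"
      by (rule nn_integral_translate_reflect(1)) measurable
    also have "\<dots> = ennreal (A * norm x powr (- 2 * \<sigma>))"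
      using nn_integral_powr_norm_le[where 'a="real^'n", of "d - 2 * \<sigma>" \<rho>] \<sigma> \<rho> unfolding d(2)
      by (simp add: A_def \<rho>_def powr_divide powr_minus field_simps)
    also have "(\<integral>\<^sup>+y. ?\<psi> (x - y) \<partial>lborel) = (\<integral>\<^sup>+z. ?\<psi> z \<partial>lborel)"
      by (rule nn_integral_translate_reflect(1)) measurable
    also have "\<dots> = ennreal (A * norm x powr (2 * \<sigma>))"
      using nn_integral_powr_norm_ge[where 'a="real^'n", of "d + 2 * \<sigma>" \<rho>] \<sigma> \<rho> unfolding d(2)
      by (simp add: A_def \<rho>_def powr_divide powr_minus field_simps)
    also have "ennreal C1 * ennreal (A * norm x powr (- 2 * \<sigma>)) + ennreal c * ennreal (A * norm x powr (2 * \<sigma>)) =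
      ennreal (C1 * (A * norm x powr (- 2 * \<sigma>)) + c * (A * norm x powr (2 * \<sigma>)))"
      using C1(1) c A by (simp add: ennreal_mult[symmetric] ennreal_plus[symmetric] del: ennreal_plus)
    also have "c * (A * norm x powr (2 * \<sigma>)) = C2 * A * (norm x powr (- 4 * \<sigma>) * norm x powr (2 * \<sigma>))"
      by (simp add: c_def)
    also have "norm x powr (- 4 * \<sigma>) * norm x powr (2 * \<sigma>) = norm x powr (- 2 * \<sigma>)"
      by (simp add: powr_add[symmetric])
    finally have "potential_operator \<sigma> g x \<le> C1 * (A * norm x powr (- 2 * \<sigma>)) + C2 * A * norm x powr (- 2 * \<sigma>)"
      using C1(1) C2(1) A by (subst (asm) ennreal_le_iff) auto
    also have "\<dots> \<le> (C1 * A + C2 * A + 1) * norm x powr (- 2 * \<sigma>)"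
      by (simp add: algebra_simps)
    finally show ?thesis .
  qed
  moreover have "0 < C1 * A + C2 * A + 1"
    using C1(1) C2(1) A by (intro add_nonneg_pos add_nonneg_nonneg) auto
  ultimately show ?thesis by blast
qed

text \<open>The set where the potential exceeds s lies in a ball of radius (C/s)^(1/(2\<sigma>)),
  whose volume is a multiple of s^(-d/(2\<sigma>)) = s^(-Q).\<close>

lemma weak_type_from_Linfinity:
  fixes \<sigma> Q :: real
  assumes \<sigma>: "0 < \<sigma>" "\<sigma> < real CARD('n) / 2" and Q: "0 < Q" "1 / Q = 2 * \<sigma> / real CARD('n)"
  shows "weak_type (potential_operator \<sigma> :: (real^'n \<Rightarrow> real) \<Rightarrow> _) \<infinity> (ennreal Q)"
proof -
  define d where "d = real CARD('n)"
  have d: "0 < d" "real DIM(real^'n) = d" by (simp_all add: d_def)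
  have "1 / Q < 1" using Q \<sigma> by simp
  then have Q1: "1 < Q" using Q(1) by (simp add: divide_less_eq)
  have dQ: "d / (2 * \<sigma>) = Q"
    using Q \<sigma> d unfolding d_def by (simp add: field_simps)
  obtain C1 where C1: "0 < C1" "\<And>g (x::real^'n). g \<in> unit_ball_Lp \<infinity> \<Longrightarrow> 1 \<le> norm x \<Longrightarrow> potential_operator \<sigma> g x \<le> C1 * norm x powr (- 2 * \<sigma>)"
    using potential_operator_decay[OF \<sigma>] by blast
  obtain C2 where C2: "0 < C2" "\<And>g (x::real^'n). g \<in> unit_ball_Lp \<infinity> \<Longrightarrow> potential_operator \<sigma> g x \<le> C2 * max 1 (norm x) powr (- 2 * 0)"
    using potential_operator_unit_ball_infinity[OF \<sigma> order_refl \<sigma>(1)] by blast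
  define C where "C = C1 + C2"
  have C: "0 < C" using C1 C2 by (simp add: C_def)
  \<comment> \<open>Inside the unit ball plain boundedness is enough, as |x|^(-2\<sigma>) \<ge> 1
    there. The origin is left out because \<open>0 powr b = 0\<close>; it lies in every ball about 0
    anyway.\<close>
  have le: "potential_operator \<sigma> g x \<le> C * norm x powr (- 2 * \<sigma>)" if g: "g \<in> unit_ball_Lp \<infinity>" and "x \<noteq> 0" for g and x :: "real^'n"
  proof (cases "1 \<le> norm x")
    case True
    then show ?thesis
      using C1(2)[OF g True] C2(1) by (simp add: C_def algebra_simps add_increasing2)
  next
    case False
    have "max 1 (norm x) \<noteq> 0" by linarith
    then have "potential_operator \<sigma> g x \<le> C2 * 1"
      using C2(2)[OF g, of x] by simp
    also have "\<dots> \<le> C * norm x powr (- 2 * \<sigma>)"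
      using False that \<sigma> C1 C2 powr_mono2'[of "- 2 * \<sigma>" "norm x" 1] by (intro mult_mono) (auto simp: C_def)
    finally show ?thesis .
  qed
  define M where "M = (unit_ball_vol d + 1) * C powr Q"
  have M: "0 < M" using C by (simp add: M_def add_nonneg_pos d less_imp_le)
  show ?thesis
  proof (rule weak_type_finiteI[OF \<sigma>(1), where M = M])
    fix g :: "real^'n \<Rightarrow> real" and s :: real
    assume g: "g \<in> unit_ball_Lp \<infinity>" and s: "0 < s"
    define \<rho> where "\<rho> = (C / s) powr (1 / (2 * \<sigma>))"
    have \<rho>: "0 < \<rho>" using C s by (simp add: \<rho>_def)
    have "x \<in> cball 0 \<rho>" if "s < potential_operator \<sigma> g x" for x
    proof (cases "x = 0")
      case False
      then have n: "0 < norm x" by simp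
      have "s < C * norm x powr (- 2 * \<sigma>)"
        using that le[OF g False] by simp
      then have "norm x powr (2 * \<sigma>) \<le> C / s"
        using n s by (simp add: powr_minus field_simps)
      then have "(norm x powr (2 * \<sigma>)) powr (1 / (2 * \<sigma>)) \<le> \<rho>"
        unfolding \<rho>_def using \<sigma> by (intro powr_mono2) auto
      then show ?thesis
        using \<sigma> n by (simp add: powr_powr)
    qed (use \<rho> in simp)
    then have "emeasure lebesgue {x. s < potential_operator \<sigma> g x} \<le> emeasure lebesgue (cball 0 \<rho> :: (real^'n) set)"
      by (intro emeasure_mono) auto
    also have "\<dots> = ennreal (unit_ball_vol d * \<rho> ^ CARD('n))"
      using \<rho> by (simp add: emeasure_cball d_def)
    also have "\<rho> ^ CARD('n) = \<rho> powr d"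
      using \<rho> by (simp add: d_def powr_realpow)
    also have "\<rho> powr d = (C / s) powr Q"
      unfolding \<rho>_def powr_powr using dQ by simp
    also have "(C / s) powr Q = C powr Q * s powr (- Q)"
      using C s by (simp add: powr_divide powr_minus field_simps)
    also have "ennreal (unit_ball_vol d * (C powr Q * s powr (- Q))) \<le> ennreal (M * s powr (- Q))"
      by (intro ennreal_leI) (simp add: M_def algebra_simps)
    finally show "emeasure lebesgue {x. s < potential_operator \<sigma> g x} \<le> ennreal (M * s powr (- Q))" .
  qed (use Q1 M in auto)
qed

lemma Lp_norm_indicator:
  fixes P :: real
  assumes "0 < P" "E \<in> lmeasurable"
  shows "Lp_norm (ennreal P) (indicat_real E :: real^'n \<Rightarrow> real) = ennreal (measure lebesgue E powr (1 / P))"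
proof -
  have "(\<integral>\<^sup>+x. ennreal (\<bar>indicat_real E x\<bar> powr P) \<partial>lebesgue) = (\<integral>\<^sup>+x. indicator E x \<partial>lebesgue)"
    using assms(1) by (intro nn_integral_cong) (auto simp: indicator_def)
  also have "\<dots> = ennreal (measure lebesgue E)"
    using assms(2) by (simp add: fmeasurableD emeasure_eq_measure2)
  finally show ?thesis
    using assms(1) by (simp add: Lp_norm_def ennreal_rpow_ennreal)
qed

text \<open>The potential of a set E is at most a multiple of |E|^(2\<sigma>/d), and this power is
  the L^P norm of its indicator. \<open>riesz_indicator_bound\<close> speaks of Borel sets and m >
  0, so E is replaced by its Borel main part and null sets are treated apart.\<close>

lemma restricted_weak_type_to_Linfinity:
  fixes \<sigma> P :: real
  assumes \<sigma>: "0 < \<sigma>" "\<sigma> < real CARD('n) / 2" and P: "0 < P" "1 / P = 2 * \<sigma> / real CARD('n)"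
  shows "restricted_weak_type (potential_operator \<sigma> :: (real^'n \<Rightarrow> real) \<Rightarrow> _) (ennreal P) \<infinity>"
proof -
  define d where "d = real CARD('n)"
  have d: "0 < d" "real DIM(real^'n) = d" by (simp_all add: d_def)
  have \<beta>: "0 < 2 * \<sigma>" "2 * \<sigma> < DIM(real^'n)" using \<sigma> by auto
  obtain B where B: "0 < B" "\<And>(E::(real^'n) set) m x. E \<in> sets borel \<Longrightarrow> 0 < m \<Longrightarrow> emeasure lborel E \<le> ennreal m \<Longrightarrow>
    (\<integral>\<^sup>+y. ennreal (norm (x - y) powr (2 * \<sigma> - d)) * indicator E y \<partial>lborel) \<le> ennreal (B * m powr (2 * \<sigma> / d))"
    using riesz_indicator_bound[OF \<beta>] unfolding d(2) by blast
  obtain C where C: "C > 0" "\<And>g (x::real^'n). g \<in> borel_measurable borel \<Longrightarrow> (\<forall>y. 0 \<le> g y) \<Longrightarrow> ennreal (potential_operator \<sigma> g x) \<le>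
    ennreal C * (\<integral>\<^sup>+y. ennreal (norm (x - y) powr (2 * \<sigma> - d)) * ennreal (g y) \<partial>lborel)"
    using potential_operator_le_riesz[OF \<sigma>] unfolding d_def by blast
  have "Lp_norm \<infinity> (potential_operator \<sigma> (indicat_real E)) \<le> ennreal (C * B) * Lp_norm (ennreal P) (indicat_real E)"
    if E: "E \<in> lmeasurable" for E :: "(real^'n) set"
  proof -
    define m where "m = measure lebesgue E"
    have Es: "E \<in> sets lebesgue" using E by (rule fmeasurableD)
    define A where "A = main_part lborel E"
    have Am [measurable]: "A \<in> sets borel"
      using main_part_sets[OF Es] by (simp add: A_def)
    have As: "A \<in> sets lebesgue"
      using Am by (intro sets_completionI_sets) simp
    have AE_eq: "AE x in lebesgue. indicat_real E x = indicat_real A x"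
    proof -
      have "E = A \<union> null_part lborel E"
        using main_part_null_part_Un[OF Es] by (simp add: A_def)
      moreover have "AE x in lborel. x \<notin> null_part lborel E"
        using null_part[OF Es] by (auto simp: eventually_ae_filter)
      ultimately show ?thesis
        unfolding AE_lebesgue_iff_lborel by (auto elim!: eventually_mono simp: indicator_def)
    qed
    have eq: "potential_operator \<sigma> (indicat_real E) = potential_operator \<sigma> (indicat_real A)"
      by (intro potential_operator_cong_AE AE_eq borel_measurable_indicator Es As)
    have emA: "emeasure lborel A = ennreal m"
    proof -
      have "emeasure lborel A = emeasure lebesgue E"
        by (simp add: A_def emeasure_completion[OF Es])
      then show ?thesis
        using E by (simp add: m_def emeasure_eq_measure2)
    qed
    have "potential_operator \<sigma> (indicat_real A) x \<le> C * B * m powr (2 * \<sigma> / d)" for x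
    proof (cases "m = 0")
      case True
      then have "AE x in lborel. x \<notin> A"
        using emA by (intro AE_not_in) (auto simp: null_sets_def)
      then have "AE x in lebesgue. indicat_real A x = 0"
        unfolding AE_lebesgue_iff_lborel by eventually_elim simp
      then have "potential_operator \<sigma> (indicat_real A) = potential_operator \<sigma> (\<lambda>_. 0)"
        by (intro potential_operator_cong_AE borel_measurable_indicator As) auto
      then show ?thesis
        using C(1) B(1) by (simp add: potential_operator_def)
    next
      case False
      then have m0: "0 < m" by (simp add: m_def zero_less_measure_iff)
      have "ennreal (potential_operator \<sigma> (indicat_real A) x) \<le>
        ennreal C * (\<integral>\<^sup>+y. ennreal (norm (x - y) powr (2 * \<sigma> - d)) * ennreal (indicat_real A y) \<partial>lborel)"
        by (intro C(2)) auto
      also have "\<dots> \<le> ennreal C * ennreal (B * m powr (2 * \<sigma> / d))"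
        using B(2)[OF Am m0] emA by (intro mult_left_mono) (auto simp: ennreal_indicator)
      also have "\<dots> = ennreal (C * B * m powr (2 * \<sigma> / d))"
        using C(1) B(1) by (simp add: ennreal_mult'[symmetric] mult.assoc)
      finally show ?thesis
        using C(1) B(1) by (subst (asm) ennreal_le_iff) auto
    qed
    then have le: "\<bar>potential_operator \<sigma> (indicat_real A) x\<bar> \<le> C * B * m powr (2 * \<sigma> / d)" for x
      using potential_operator_nonneg[OF \<sigma>(1), of "indicat_real A" x] by simp
    have [measurable]: "potential_operator \<sigma> (indicat_real A) \<in> borel_measurable lebesgue"
      by (intro potential_operator_measurable borel_measurable_indicator As)
    have "esssup lebesgue (\<lambda>x. ennreal \<bar>potential_operator \<sigma> (indicat_real A) x\<bar>) \<le> ennreal (C * B * m powr (2 * \<sigma> / d))"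
    proof (rule esssup_I)
      show "(\<lambda>x. ennreal \<bar>potential_operator \<sigma> (indicat_real A) x\<bar>) \<in> borel_measurable lebesgue"
        by measurable
    qed (intro AE_I2 ennreal_leI le)
    then have "Lp_norm \<infinity> (potential_operator \<sigma> (indicat_real E)) \<le> ennreal (C * B * m powr (2 * \<sigma> / d))"
      by (simp add: eq Lp_norm_def)
    then show ?thesis
      using E P C(1) B(1) by (simp add: Lp_norm_indicator m_def d_def ennreal_mult'[symmetric])
  qed
  then show ?thesis
    unfolding restricted_weak_type_def weak_type_bound_def using C(1) B(1)
    by (intro exI[of _ "C * B"]) auto
qed


section \<open>Necessary conditions\<close>

lemma powr_unbounded:
  fixes e K B :: real
  assumes "0 < e"
  shows "\<exists>L\<ge>B. 0 < L \<and> K < L powr e"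
proof -
  define L where "L = max (max B 1) ((max K 0 + 1) powr (1 / e))"
  have "K < ((max K 0 + 1) powr (1 / e)) powr e"
    using assms by (simp add: powr_powr)
  also have "\<dots> \<le> L powr e"
    using assms by (intro powr_mono2) (auto simp: L_def)
  finally have "K < L powr e" .
  moreover have "B \<le> L" "1 \<le> L"
    unfolding L_def by linarith+
  ultimately show ?thesis
    by (intro exI[of _ L]) auto
qed

lemma nn_integral_potential_kernel_finite:
  fixes x :: "real^'n"
  assumes "0 < \<sigma>"
  shows "(\<integral>\<^sup>+y. ennreal \<bar>potential_kernel \<sigma> x y\<bar> \<partial>lborel) < \<infinity>"
proof -
  have "(\<integral>\<^sup>+y. ennreal \<bar>potential_kernel \<sigma> x y\<bar> \<partial>lborel) \<le> (\<integral>\<^sup>+y. ennreal (1 / Gamma \<sigma>) * gaussian_majorant \<sigma> x y \<partial>lborel)"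
    by (intro nn_integral_mono potential_kernel_le assms)
  also have "\<dots> = ennreal (1 / Gamma \<sigma>) * (\<integral>\<^sup>+t. ennreal (time_weight \<sigma> CARD('n) t) \<partial>lborel)"
    by (subst nn_integral_cmult) (auto simp: gaussian_majorant_integral)
  also have "\<dots> < \<infinity>"
    using time_weight_finite[OF assms, of "CARD('n)"] by (simp add: ennreal_mult_less_top Suc_leI)
  finally show ?thesis .
qed

text \<open>Boundedness of g makes the integral converge at every x, because the kernel is
  integrable in y. Lower bounds need this equality, where upper bounds manage with an
  inequality.\<close>

lemma potential_operator_eq_nn_integral:
  fixes g :: "real^'n \<Rightarrow> real"
  assumes \<sigma>: "0 < \<sigma>" and [measurable]: "g \<in> borel_measurable borel" and g: "\<And>y. 0 \<le> g y" "\<And>y. g y \<le> M"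
  shows "ennreal (potential_operator \<sigma> g x) = (\<integral>\<^sup>+y. ennreal (potential_kernel \<sigma> x y * g y) \<partial>lborel)"
proof -
  have nn: "0 \<le> potential_kernel \<sigma> x y * g y" for y
    by (intro mult_nonneg_nonneg g potential_kernel_nonneg[OF \<sigma>])
  have m: "(\<lambda>y. potential_kernel \<sigma> x y * g y) \<in> borel_measurable lborel"
    by measurable
  have "(\<integral>\<^sup>+y. ennreal (potential_kernel \<sigma> x y * g y) \<partial>lborel) \<le> (\<integral>\<^sup>+y. ennreal M * ennreal \<bar>potential_kernel \<sigma> x y\<bar> \<partial>lborel)"
  proof (rule nn_integral_mono)
    fix y
    have M: "0 \<le> M" using g order_trans by blast
    have "potential_kernel \<sigma> x y * g y \<le> M * potential_kernel \<sigma> x y"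
      using g potential_kernel_nonneg[OF \<sigma>, of x y] mult_right_mono[of "g y" M "potential_kernel \<sigma> x y"] by (simp add: mult.commute)
    then show "ennreal (potential_kernel \<sigma> x y * g y) \<le> ennreal M * ennreal \<bar>potential_kernel \<sigma> x y\<bar>"
      using M potential_kernel_nonneg[OF \<sigma>, of x y] by (simp add: ennreal_mult[symmetric] ennreal_leI)
  qed
  also have "\<dots> < \<infinity>"
    using nn_integral_potential_kernel_finite[OF \<sigma>, of x]
    by (subst nn_integral_cmult) (auto simp: ennreal_mult_less_top)
  finally have "integrable lborel (\<lambda>y. potential_kernel \<sigma> x y * g y)"
    using m nn by (intro integrableI_nonneg) auto
  then have "(\<integral>\<^sup>+y. ennreal (potential_kernel \<sigma> x y * g y) \<partial>lborel) = ennreal (LINT y|lborel. potential_kernel \<sigma> x y * g y)"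
    using nn by (intro nn_integral_eq_integral) auto
  also have "(LINT y|lborel. potential_kernel \<sigma> x y * g y) = potential_operator \<sigma> g x"
    unfolding potential_operator_def by (rule integral_completion[OF m, symmetric])
  finally show ?thesis by simp
qed

text \<open>For y in the ball, |x + y| \<le> 2|x| + \<rho>, so the condition on \<rho> puts the
  whole ball into the region of the kernel's lower bound. There the kernel is at least a multiple of
  \<rho>^(2\<sigma> - d), as 2\<sigma> < d, and the ball has volume of order \<rho>^d. The bound
  \<open>M\<close> secures convergence; \<open>c\<close> is independent of it.\<close>

lemma potential_operator_ge_ball:
  fixes \<sigma> :: real
  assumes \<sigma>: "0 < \<sigma>" "\<sigma> < real CARD('n) / 2"
  shows "\<exists>c>0. \<forall>(g::real^'n \<Rightarrow> real) M x \<rho> m. g \<in> borel_measurable borel \<longrightarrow> (\<forall>y. 0 \<le> g y \<and> g y \<le> M) \<longrightarrow>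
    0 < \<rho> \<longrightarrow> \<rho> \<le> 1 \<longrightarrow> \<rho> * (2 * norm x + \<rho>) \<le> 3 \<longrightarrow> 0 \<le> m \<longrightarrow> (\<forall>y\<in>cball x \<rho>. m \<le> g y) \<longrightarrow>
    c * \<rho> powr (2 * \<sigma>) * m \<le> potential_operator \<sigma> g x"
proof -
  define d where "d = real CARD('n)"
  have d: "0 < d" "real DIM(real^'n) = d" by (simp_all add: d_def)
  obtain c where c: "0 < c" "\<And>(x::real^'n) y. x \<noteq> y \<Longrightarrow> norm (x - y) \<le> 1 \<Longrightarrow> norm (x - y) * norm (x + y) \<le> 3 \<Longrightarrow>
    c * norm (x - y) powr (2 * \<sigma> - d) \<le> potential_kernel \<sigma> x y"
    using potential_kernel_lower[OF \<sigma>] unfolding d_def by blast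
  have "c * unit_ball_vol d * \<rho> powr (2 * \<sigma>) * m \<le> potential_operator \<sigma> g x"
    if gm: "g \<in> borel_measurable borel" and g: "\<And>y. 0 \<le> g y" "\<And>y. g y \<le> M" and \<rho>: "0 < \<rho>" "\<rho> \<le> 1" "\<rho> * (2 * norm x + \<rho>) \<le> 3"
      and m: "0 \<le> m" "\<And>y. y \<in> cball x \<rho> \<Longrightarrow> m \<le> g y" for g :: "real^'n \<Rightarrow> real" and M x \<rho> m
  proof -
    have "ennreal (c * \<rho> powr (2 * \<sigma> - d) * m) * emeasure lborel (cball x \<rho>) =
      (\<integral>\<^sup>+y. ennreal (c * \<rho> powr (2 * \<sigma> - d) * m) * indicator (cball x \<rho>) y \<partial>lborel)"
      by (subst nn_integral_cmult_indicator) auto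
    also have "\<dots> \<le> (\<integral>\<^sup>+y. ennreal (potential_kernel \<sigma> x y * g y) \<partial>lborel)"
    proof (rule nn_integral_mono_AE)
      show "AE y in lborel. ennreal (c * \<rho> powr (2 * \<sigma> - d) * m) * indicator (cball x \<rho>) y \<le> ennreal (potential_kernel \<sigma> x y * g y)"
        using AE_lborel_neq[of x]
      proof eventually_elim
        case (elim y)
        show ?case
        proof (cases "y \<in> cball x \<rho>")
          case True
          then have n: "0 < norm (x - y)" "norm (x - y) \<le> \<rho>"
            using elim by (auto simp: dist_norm)
          have "x + y = 2 *\<^sub>R x - (x - y)"
            by (simp add: scaleR_2)
          then have "norm (x + y) \<le> norm (2 *\<^sub>R x) + norm (x - y)"
            by (simp only: norm_triangle_ineq4)
          then have "norm (x + y) \<le> 2 * norm x + \<rho>"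
            using n by simp
          then have "norm (x - y) * norm (x + y) \<le> \<rho> * (2 * norm x + \<rho>)"
            using n \<rho> by (intro mult_mono) auto
          then have le: "c * norm (x - y) powr (2 * \<sigma> - d) \<le> potential_kernel \<sigma> x y"
            using n \<rho> elim by (intro c(2)) auto
          have "\<rho> powr (2 * \<sigma> - d) \<le> norm (x - y) powr (2 * \<sigma> - d)"
            using n \<sigma> by (intro powr_mono2') (auto simp: d_def)
          then have "c * \<rho> powr (2 * \<sigma> - d) \<le> c * norm (x - y) powr (2 * \<sigma> - d)"
            using c(1) by (intro mult_left_mono) auto
          also note le
          finally have "c * \<rho> powr (2 * \<sigma> - d) \<le> potential_kernel \<sigma> x y" .
          then have "c * \<rho> powr (2 * \<sigma> - d) * m \<le> potential_kernel \<sigma> x y * g y"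
            using m(1) m(2)[OF True] potential_kernel_nonneg[OF \<sigma>(1)] by (intro mult_mono) auto
          then show ?thesis
            using True by (simp add: ennreal_leI)
        qed simp
      qed
    qed
    also have "\<dots> = ennreal (potential_operator \<sigma> g x)"
      using potential_operator_eq_nn_integral[OF \<sigma>(1) gm g] by simp
    also have "emeasure lborel (cball x \<rho>) = ennreal (unit_ball_vol d * \<rho> powr d)"
      using \<rho> by (simp add: emeasure_cball d_def powr_realpow)
    finally have "ennreal (c * \<rho> powr (2 * \<sigma> - d) * m * (unit_ball_vol d * \<rho> powr d)) \<le> ennreal (potential_operator \<sigma> g x)"
      using c(1) m(1) d by (simp add: ennreal_mult)
    then have "c * \<rho> powr (2 * \<sigma> - d) * m * (unit_ball_vol d * \<rho> powr d) \<le> potential_operator \<sigma> g x"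
      using potential_operator_nonneg[OF \<sigma>(1), of g x] g by (subst (asm) ennreal_le_iff) auto
    moreover have "c * \<rho> powr (2 * \<sigma> - d) * m * (unit_ball_vol d * \<rho> powr d) = c * unit_ball_vol d * (\<rho> powr (2 * \<sigma> - d) * \<rho> powr d) * m"
      by simp
    moreover have "\<rho> powr (2 * \<sigma> - d) * \<rho> powr d = \<rho> powr (2 * \<sigma>)"
      by (simp add: powr_add[symmetric])
    ultimately show ?thesis by simp
  qed
  moreover have "0 < c * unit_ball_vol d"
    using c d by simp
  ultimately show ?thesis by blast
qed

lemma Lp_norm_indicator_eq:
  assumes p: "1 \<le> p" and E: "E \<in> lmeasurable" "0 < measure lebesgue E"
  shows "Lp_norm p (indicat_real E :: real^'n \<Rightarrow> real) = ennreal (measure lebesgue E powr enn2real (1 / p))"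
proof (cases "p = \<infinity>")
  case False
  then obtain P where P: "p = ennreal P" "1 \<le> P"
    using p by (cases p) (auto simp: one_ennreal_def[symmetric] ennreal_le_iff2)
  have "enn2real (1 / p) = 1 / P"
    using P by (simp add: divide_ennreal ennreal_1[symmetric] del: ennreal_1)
  then show ?thesis
    using P E by (simp add: Lp_norm_indicator)
next
  case True
  have [measurable]: "E \<in> sets lebesgue" using E(1) by (rule fmeasurableD)
  have m: "(\<lambda>x. ennreal \<bar>indicat_real E x\<bar>) \<in> borel_measurable lebesgue"
    by measurable
  have "esssup lebesgue (\<lambda>x. ennreal \<bar>indicat_real E x\<bar>) = 1"
  proof (rule antisym)
    show "esssup lebesgue (\<lambda>x. ennreal \<bar>indicat_real E x\<bar>) \<le> 1"
      by (intro esssup_I m AE_I2) (simp add: indicator_def)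
    show "1 \<le> esssup lebesgue (\<lambda>x. ennreal \<bar>indicat_real E x\<bar>)"
    proof (rule ccontr)
      assume "\<not> ?thesis"
      then have lt: "esssup lebesgue (\<lambda>x. ennreal \<bar>indicat_real E x\<bar>) < 1" by simp
      have "AE x in lebesgue. ennreal \<bar>indicat_real E x\<bar> \<le> esssup lebesgue (\<lambda>x. ennreal \<bar>indicat_real E x\<bar>)"
        by (rule esssup_AE)
      then have "AE x in lebesgue. x \<notin> E"
        by eventually_elim (use lt in \<open>auto simp: indicator_def\<close>)
      then have "emeasure lebesgue E = 0"
        using AE_iff_measurable[of E lebesgue "\<lambda>x. x \<notin> E"] E(1) by (simp add: fmeasurableD)
      then show False using E by (simp add: measure_def)
    qed
  qed
  then show ?thesis
    using True E by (simp add: Lp_norm_def)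
qed

text \<open>One inequality for all q, finite or not. The level t/2 makes the strict level set
  contain S, which gives the 2; \<open>max C 1\<close> dominates the root C^(1/Q). At q =
  \<infinity> the measure of S enters with exponent 0, but it must be positive for the essential
  supremum to see S.\<close>

lemma weak_type_bound_lower:
  fixes T :: "(real^'n \<Rightarrow> real) \<Rightarrow> real^'n \<Rightarrow> real"
  assumes wt: "weak_type_bound C T p q f" and C: "0 < C" and q: "1 \<le> q"
    and \<nu>: "Lp_norm p f \<le> ennreal \<nu>" "0 \<le> \<nu>"
    and Tm [measurable]: "T f \<in> borel_measurable lebesgue"
    and S: "S \<in> sets lebesgue" "ennreal m \<le> emeasure lebesgue S" "0 < m"
    and t: "0 < t" "\<And>x. x \<in> S \<Longrightarrow> t \<le> \<bar>T f x\<bar>"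
  shows "t * m powr enn2real (1 / q) \<le> 2 * max C 1 * \<nu>"
proof (cases "q = \<infinity>")
  case True
  have "Lp_norm \<infinity> (T f) \<le> ennreal C * Lp_norm p f"
    using wt True by (simp add: weak_type_bound_def)
  also have "\<dots> \<le> ennreal C * ennreal \<nu>"
    by (intro mult_left_mono \<nu>) simp
  finally have le: "esssup lebesgue (\<lambda>x. ennreal \<bar>T f x\<bar>) \<le> ennreal (C * \<nu>)"
    using C \<nu> by (simp add: Lp_norm_def ennreal_mult)
  have "t \<le> C * \<nu>"
  proof (rule ccontr)
    assume lt: "\<not> t \<le> C * \<nu>"
    have "AE x in lebesgue. ennreal \<bar>T f x\<bar> \<le> esssup lebesgue (\<lambda>x. ennreal \<bar>T f x\<bar>)"
      by (rule esssup_AE)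
    then have "AE x in lebesgue. ennreal \<bar>T f x\<bar> \<le> ennreal (C * \<nu>)"
      by eventually_elim (use le in auto)
    then have "AE x in lebesgue. x \<notin> S"
      by eventually_elim (use lt t(2) C \<nu> in \<open>force simp: ennreal_le_iff\<close>)
    then have "emeasure lebesgue S = 0"
      using AE_iff_measurable[of S lebesgue "\<lambda>x. x \<notin> S"] S(1) by simp
    then show False using S by simp
  qed
  also have "\<dots> \<le> 2 * max C 1 * \<nu>"
    using C \<nu> by (intro mult_right_mono) auto
  finally show ?thesis
    using True S by simp
next
  case False
  then obtain Q where Q: "q = ennreal Q" "1 \<le> Q"
    using q by (cases q) (auto simp: one_ennreal_def[symmetric] ennreal_le_iff2)
  have e: "enn2real (1 / q) = 1 / Q"
    using Q by (simp add: divide_ennreal ennreal_1[symmetric] del: ennreal_1)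
  have "ennreal m \<le> emeasure lebesgue {x. \<bar>T f x\<bar> > t / 2}"
  proof (rule order_trans[OF S(2) emeasure_mono])
    show "S \<subseteq> {x. \<bar>T f x\<bar> > t / 2}"
      using t by (force dest: t(2))
    have "{x \<in> space lebesgue. \<bar>T f x\<bar> > t / 2} \<in> sets lebesgue"
      by measurable
    then show "{x. \<bar>T f x\<bar> > t / 2} \<in> sets lebesgue" by simp
  qed
  also have "\<dots> \<le> ennreal C * ennreal_rpow (Lp_norm p f / ennreal (t / 2)) Q"
  proof -
    have "emeasure lebesgue {x. \<bar>T f x\<bar> > s} \<le> ennreal C * ennreal_rpow (Lp_norm p f / ennreal s) Q" if "0 < s" for s
      using wt Q that by (simp add: weak_type_bound_def)
    from this[of "t / 2"] t(1) show ?thesis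
      by (simp only: half_gt_zero)
  qed
  also have "\<dots> \<le> ennreal C * ennreal_rpow (ennreal \<nu> / ennreal (t / 2)) Q"
    using Q \<nu> by (intro mult_left_mono ennreal_rpow_mono divide_right_mono_ennreal) auto
  also have "\<dots> = ennreal (C * (2 * \<nu> / t) powr Q)"
    using t \<nu> C by (simp add: divide_ennreal ennreal_rpow_ennreal ennreal_mult mult.commute)
  finally have "m \<le> C * (2 * \<nu> / t) powr Q"
    using C by (subst (asm) ennreal_le_iff) auto
  then have "m powr (1 / Q) \<le> (C * (2 * \<nu> / t) powr Q) powr (1 / Q)"
    using S Q by (intro powr_mono2) auto
  also have "\<dots> = C powr (1 / Q) * (2 * \<nu> / t)"
    using C Q \<nu> t by (simp add: powr_mult powr_powr)
  also have "\<dots> \<le> max C 1 * (2 * \<nu> / t)"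
  proof (rule mult_right_mono)
    have "C powr (1 / Q) \<le> max C 1 powr (1 / Q)"
      using C Q by (intro powr_mono2) auto
    also have "\<dots> \<le> max C 1 powr 1"
      using Q by (intro powr_mono) auto
    finally show "C powr (1 / Q) \<le> max C 1" using C by simp
  qed (use \<nu> t in auto)
  finally show ?thesis
    using t by (simp add: e field_simps)
qed

text \<open>Tested on balls about the origin. For small r the potential is at least of order
  r^(2\<sigma>) on the half-size ball and the bound reads r^(2\<sigma> + dv) \<le> C r^(du); for
  large r it is at least of order r^(-2\<sigma>) on a ball of comparable size and the bound reads
  r^(dv - 2\<sigma>) \<le> C r^(du). Letting r tend to 0 and to infinity compares the
  exponents.\<close>

lemma restricted_weak_type_necessary:
  fixes \<sigma> :: real
  assumes \<sigma>: "0 < \<sigma>" "\<sigma> < real CARD('n) / 2" and p: "1 \<le> p" and q: "1 \<le> q"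
    and R: "restricted_weak_type (potential_operator \<sigma> :: (real^'n \<Rightarrow> real) \<Rightarrow> _) p q"
  shows "enn2real (1 / p) - 2 * \<sigma> / real CARD('n) \<le> enn2real (1 / q)"
    and "enn2real (1 / q) \<le> enn2real (1 / p) + 2 * \<sigma> / real CARD('n)"
proof -
  define d where "d = real CARD('n)"
  have d: "0 < d" by (simp add: d_def)
  define u where "u = enn2real (1 / p)"
  define v where "v = enn2real (1 / q)"
  define \<omega> where "\<omega> = unit_ball_vol d"
  have \<omega>: "0 < \<omega>" using d by (simp add: \<omega>_def)
  obtain C where C: "0 < C" "\<And>E::(real^'n) set. E \<in> lmeasurable \<Longrightarrow> weak_type_bound C (potential_operator \<sigma>) p q (indicat_real E)"
    using R by (auto simp: restricted_weak_type_def)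
  define C' where "C' = 2 * max C 1"
  obtain c where c: "0 < c" "\<And>(g::real^'n \<Rightarrow> real) M x \<rho> m. g \<in> borel_measurable borel \<Longrightarrow> (\<forall>y. 0 \<le> g y \<and> g y \<le> M) \<Longrightarrow>
    0 < \<rho> \<Longrightarrow> \<rho> \<le> 1 \<Longrightarrow> \<rho> * (2 * norm x + \<rho>) \<le> 3 \<Longrightarrow> 0 \<le> m \<Longrightarrow> (\<forall>y\<in>cball x \<rho>. m \<le> g y) \<Longrightarrow>
    c * \<rho> powr (2 * \<sigma>) * m \<le> potential_operator \<sigma> g x"
    using potential_operator_ge_ball[OF \<sigma>] by blast
  have meas: "measure lebesgue (cball a \<rho> :: (real^'n) set) = \<omega> * \<rho> powr d" if "0 < \<rho>" for a \<rho>
    using that by (simp add: content_cball \<omega>_def d_def powr_realpow)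
  have key: "t * (\<omega> * \<rho> powr d) powr v \<le> C' * (\<omega> * r powr d) powr u"
    if r: "0 < r" "0 < \<rho>" "0 < t" and t: "\<And>x. x \<in> cball a \<rho> \<Longrightarrow> t \<le> potential_operator \<sigma> (indicat_real (cball 0 r)) x"
    for r \<rho> t and a :: "real^'n"
    unfolding C'_def v_def
  proof (rule weak_type_bound_lower[OF C(2) C(1) q])
    show "Lp_norm p (indicat_real (cball 0 r :: (real^'n) set)) \<le> ennreal ((\<omega> * r powr d) powr u)"
    proof -
      have "0 < measure lebesgue (cball 0 r :: (real^'n) set)"
        unfolding meas[OF r(1)] using r \<omega> by simp
      then show ?thesis
        by (subst Lp_norm_indicator_eq[OF p]) (simp_all only: meas[OF r(1)] u_def order_refl lmeasurable_cball)
    qed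
    show "potential_operator \<sigma> (indicat_real (cball 0 r :: (real^'n) set)) \<in> borel_measurable lebesgue"
      by (intro potential_operator_measurable borel_measurable_indicator) auto
    show "ennreal (\<omega> * \<rho> powr d) \<le> emeasure lebesgue (cball a \<rho>)"
      using meas[OF r(2), of a] by (simp add: emeasure_eq_measure2)
    show "t \<le> \<bar>potential_operator \<sigma> (indicat_real (cball 0 r)) x\<bar>" if "x \<in> cball a \<rho>" for x
      using t[OF that] by linarith
  qed (use r \<omega> in auto)
  have ind: "indicat_real (cball 0 r :: (real^'n) set) \<in> borel_measurable borel" for r
    by (intro borel_measurable_indicator borel_closed closed_cball)
  show "enn2real (1 / p) - 2 * \<sigma> / real CARD('n) \<le> enn2real (1 / q)"
  proof (rule ccontr)
    assume "\<not> ?thesis"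
    then have e: "0 < d * (u - v) - 2 * \<sigma>"
      using d by (simp add: u_def v_def d_def[symmetric] field_simps)
    define A where "A = c * 2 powr (- (2 * \<sigma>)) * (\<omega> * 2 powr (- d)) powr v"
    have A: "0 < A" using c \<omega> by (simp add: A_def)
    \<comment> \<open>\<open>L\<close> is 1/r, so that a small radius is found by the same lemma as
      a large one.\<close>
    obtain L where L: "2 \<le> L" "C' * \<omega> powr u / A < L powr (d * (u - v) - 2 * \<sigma>)"
      using powr_unbounded[OF e] by blast
    define r where "r = 1 / L"
    have r: "0 < r" "r \<le> 1 / 2" using L(1) by (auto simp: r_def field_simps)
    have "(c * (r / 2) powr (2 * \<sigma>)) * (\<omega> * (r / 2) powr d) powr v \<le> C' * (\<omega> * r powr d) powr u"
    proof (rule key[where a = 0])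
      fix x :: "real^'n"
      assume x: "x \<in> cball 0 (r / 2)"
      have "c * (r / 2) powr (2 * \<sigma>) * 1 \<le> potential_operator \<sigma> (indicat_real (cball 0 r)) x"
      proof (rule c(2)[where M = 1, OF ind])
        have "r / 2 * (2 * norm x + r / 2) \<le> 1 * 3"
          using x r by (intro mult_mono) auto
        then show "r / 2 * (2 * norm x + r / 2) \<le> 3" by simp
        show "\<forall>y\<in>cball x (r / 2). 1 \<le> indicat_real (cball 0 r) y"
        proof
          fix y assume "y \<in> cball x (r / 2)"
          then have "norm y \<le> r"
            using x norm_triangle_sub[of y x] by (simp add: dist_norm norm_minus_commute)
          then show "1 \<le> indicat_real (cball 0 r) y" by simp
        qed
      qed (use r in auto)
      then show "c * (r / 2) powr (2 * \<sigma>) \<le> potential_operator \<sigma> (indicat_real (cball 0 r)) x" by simp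
    qed (use r c in auto)
    moreover have "(c * (r / 2) powr (2 * \<sigma>)) * (\<omega> * (r / 2) powr d) powr v = A * r powr (2 * \<sigma> + d * v)"
    proof -
      have half: "(r / 2) powr x = r powr x * 2 powr (- x)" for x
        by (simp add: powr_divide powr_minus_divide)
      have "(\<omega> * (r / 2) powr d) powr v = ((\<omega> * 2 powr (- d)) * r powr d) powr v"
        unfolding half by (simp only: ac_simps)
      also have "\<dots> = (\<omega> * 2 powr (- d)) powr v * r powr (d * v)"
        unfolding powr_mult powr_powr by simp
      finally show ?thesis
        unfolding A_def half powr_add by (simp only: ac_simps)
    qed
    moreover have "C' * (\<omega> * r powr d) powr u = C' * \<omega> powr u * r powr (d * u)"
      by (simp add: powr_mult powr_powr)
    ultimately have "A * r powr (2 * \<sigma> + d * v) \<le> C' * \<omega> powr u * r powr (d * u)"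
      by simp
    then have "r powr (2 * \<sigma> + d * v) / r powr (d * u) \<le> C' * \<omega> powr u / A"
      using r A by (simp add: divide_simps mult.commute)
    also have "r powr (2 * \<sigma> + d * v) / r powr (d * u) = r powr (- (d * (u - v) - 2 * \<sigma>))"
      unfolding powr_diff[symmetric] by (simp add: algebra_simps)
    also have "\<dots> = L powr (d * (u - v) - 2 * \<sigma>)"
      unfolding r_def powr_divide powr_minus_divide by simp
    finally show False using L by simp
  qed
  show "enn2real (1 / q) \<le> enn2real (1 / p) + 2 * \<sigma> / real CARD('n)"
  proof (rule ccontr)
    assume "\<not> ?thesis"
    then have e: "0 < d * (v - u) - 2 * \<sigma>"
      using d by (simp add: u_def v_def d_def[symmetric] field_simps)
    define A where "A = c * 2 powr (2 * \<sigma>) * (\<omega> * 8 powr (- d)) powr v"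
    have A: "0 < A" using c \<omega> by (simp add: A_def)
    obtain r where r: "4 \<le> r" "C' * \<omega> powr u / A < r powr (d * (v - u) - 2 * \<sigma>)"
      using powr_unbounded[OF e] by blast
    \<comment> \<open>The ball of radius r/8 about \<open>a\<close> lies in r/4 \<le> |x| \<le> r/2,
      away from the origin, so the radius 1/|x| used at x is at most 1, as r \<ge> 4, and at least
      2/r.\<close>
    define a :: "real^'n" where "a = (3 * r / 8) *\<^sub>R (SOME b. b \<in> Basis)"
    have na: "norm a = 3 * r / 8"
      using r by (simp add: a_def norm_Basis SOME_Basis)
    have "(c * (2 / r) powr (2 * \<sigma>)) * (\<omega> * (r / 8) powr d) powr v \<le> C' * (\<omega> * r powr d) powr u"
    proof (rule key[where a = a])
      fix x :: "real^'n"
      assume "x \<in> cball a (r / 8)"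
      then have x: "r / 4 \<le> norm x" "norm x \<le> r / 2"
        using norm_triangle_sub[of a x] norm_triangle_sub[of x a] na by (auto simp: dist_norm norm_minus_commute)
      then have x1: "1 \<le> norm x" using r by simp
      then have nx: "0 < norm x" by linarith
      have "c * (2 / r) powr (2 * \<sigma>) \<le> c * (1 / norm x) powr (2 * \<sigma>) * 1"
        using c \<sigma> x nx r by (auto intro!: powr_mono2 simp: field_simps)
      also have "\<dots> \<le> potential_operator \<sigma> (indicat_real (cball 0 r)) x"
      proof (rule c(2)[where M = 1, OF ind])
        have "1 / norm x * (1 / norm x) \<le> 1 * 1"
          using x1 nx by (intro mult_mono) auto
        then show "1 / norm x * (2 * norm x + 1 / norm x) \<le> 3"
          using nx by (simp add: distrib_left)
        show "\<forall>y\<in>cball x (1 / norm x). 1 \<le> indicat_real (cball 0 r) y"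
        proof
          fix y assume "y \<in> cball x (1 / norm x)"
          then have "norm (x - y) \<le> 1 / norm x" by (simp add: dist_norm)
          also have "\<dots> \<le> 1" using x1 nx by simp
          finally have "norm y \<le> r"
            using x r norm_triangle_sub[of y x] by (simp add: norm_minus_commute)
          then show "1 \<le> indicat_real (cball 0 r) y" by simp
        qed
      qed (use nx x1 in auto)
      finally show "c * (2 / r) powr (2 * \<sigma>) \<le> potential_operator \<sigma> (indicat_real (cball 0 r)) x" .
    qed (use r c in auto)
    moreover have "(c * (2 / r) powr (2 * \<sigma>)) * (\<omega> * (r / 8) powr d) powr v = A * r powr (d * v - 2 * \<sigma>)"
    proof -
      have "(r / 8) powr d = r powr d * 8 powr (- d)"
        by (simp add: powr_divide powr_minus_divide)
      then have "(\<omega> * (r / 8) powr d) powr v = ((\<omega> * 8 powr (- d)) * r powr d) powr v"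
        by (simp only: ac_simps)
      also have "\<dots> = (\<omega> * 8 powr (- d)) powr v * r powr (d * v)"
        unfolding powr_mult powr_powr by simp
      finally show ?thesis
        unfolding A_def powr_diff powr_divide by simp
    qed
    moreover have "C' * (\<omega> * r powr d) powr u = C' * \<omega> powr u * r powr (d * u)"
      by (simp add: powr_mult powr_powr)
    ultimately have "A * r powr (d * v - 2 * \<sigma>) \<le> C' * \<omega> powr u * r powr (d * u)"
      by simp
    then have "r powr (d * v - 2 * \<sigma>) / r powr (d * u) \<le> C' * \<omega> powr u / A"
      using r A by (simp add: divide_simps mult.commute)
    also have "r powr (d * v - 2 * \<sigma>) / r powr (d * u) = r powr (d * (v - u) - 2 * \<sigma>)"
      unfolding powr_diff[symmetric] by (simp add: algebra_simps)
    finally show False using r by simp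
  qed
qed


section \<open>Logarithmic failure on the excluded part of the boundary\<close>

lemma bounded_Lp_Lq_lower:
  fixes T :: "(real^'n \<Rightarrow> real) \<Rightarrow> real^'n \<Rightarrow> real"
  assumes T: "\<And>f. f \<in> Lp_space p \<Longrightarrow> Lp_norm (ennreal Q) (T f) \<le> ennreal C * Lp_norm p f"
    and "0 < C" "0 < Q" and f: "f \<in> borel_measurable lebesgue" "Lp_norm p f \<le> ennreal \<nu>" "0 \<le> \<nu>"
    and A: "ennreal A \<le> (\<integral>\<^sup>+x. ennreal (\<bar>T f x\<bar> powr Q) \<partial>lebesgue)" "0 \<le> A"
  shows "A powr (1 / Q) \<le> C * \<nu>"
proof -
  have "f \<in> Lp_space p"
    using f by (auto simp: Lp_space_def intro: le_less_trans)
  have "ennreal (A powr (1 / Q)) = ennreal_rpow (ennreal A) (1 / Q)"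
    using A by (simp add: ennreal_rpow_ennreal)
  also have "\<dots> \<le> ennreal_rpow (\<integral>\<^sup>+x. ennreal (\<bar>T f x\<bar> powr Q) \<partial>lebesgue) (1 / Q)"
    using A assms(3) by (intro ennreal_rpow_mono) auto
  also have "\<dots> = Lp_norm (ennreal Q) (T f)"
    using assms(3) by (simp add: Lp_norm_def)
  also have "\<dots> \<le> ennreal C * Lp_norm p f"
    by (rule T) fact
  also have "\<dots> \<le> ennreal C * ennreal \<nu>"
    by (intro mult_left_mono f) simp
  also have "\<dots> = ennreal (C * \<nu>)"
    using assms(2) f by (simp add: ennreal_mult)
  finally show ?thesis
    using assms(2) f by (subst (asm) ennreal_le_iff) auto
qed

lemma ennreal_ge_1_cases:
  assumes "1 \<le> (p::ennreal)"
  obtains "p = \<infinity>" "enn2real (1 / p) = 0" | P where "p = ennreal P" "1 \<le> P" "enn2real (1 / p) = 1 / P"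
proof (cases "p = \<infinity>")
  case False
  then obtain P where P: "p = ennreal P" "1 \<le> P"
    using assms by (cases p) (auto simp: one_ennreal_def[symmetric] ennreal_le_iff2)
  moreover have "enn2real (1 / p) = 1 / P"
    using P by (simp add: divide_ennreal ennreal_1[symmetric] del: ennreal_1)
  ultimately show thesis by (rule that(2))
qed (auto intro: that(1))

text \<open>The P-th power of |y|^(-d/P) is the critical |y|^(-d), whose integral over the annulus
  is logarithmic. At p = \<infinity> the exponent u is 0 and the right-hand side is 1.\<close>

lemma Lp_norm_powr_annulus_le:
  fixes d u a b :: real
  assumes p: "1 \<le> p" and d: "d = real CARD('n)" and u: "u = enn2real (1 / p)" and ab: "0 < a" "a < b"
  shows "Lp_norm p (\<lambda>y::real^'n. norm y powr (- (d * u)) * indicat_real {a..b} (norm y)) \<le>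
    ennreal ((d * unit_ball_vol d * ln (b / a)) powr u)"
  using p
proof (cases rule: ennreal_ge_1_cases)
  case 1
  have "0 < d" using d by simp
  then have pos: "0 < d * unit_ball_vol d * ln (b / a)"
    using ab by (auto intro!: mult_pos_pos)
  have u0: "u = 0" using 1 u by simp
  have "esssup lebesgue (\<lambda>y::real^'n. ennreal \<bar>norm y powr (- (d * u)) * indicat_real {a..b} (norm y)\<bar>) \<le> 1"
  proof (rule esssup_I)
    have "(\<lambda>y::real^'n. ennreal \<bar>norm y powr (- (d * u)) * indicat_real {a..b} (norm y)\<bar>) \<in> borel_measurable lborel"
      by measurable
    then show "(\<lambda>y::real^'n. ennreal \<bar>norm y powr (- (d * u)) * indicat_real {a..b} (norm y)\<bar>) \<in> borel_measurable lebesgue"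
      by (rule measurable_completion)
  qed (auto simp: u0 indicator_def)
  moreover have "(d * unit_ball_vol d * ln (b / a)) powr u = 1"
    using less_imp_neq[OF pos] by (simp only: u0 powr_zero_eq_one) auto
  ultimately show ?thesis
    using 1(1) by (simp only: Lp_norm_def refl if_True ennreal_1)
next
  case (2 P)
  have "0 < d" using d by simp
  then have pos: "0 < d * unit_ball_vol d * ln (b / a)"
    using ab by (auto intro!: mult_pos_pos)
  have uP: "u = 1 / P" using 2 u by simp
  have "(\<integral>\<^sup>+y. ennreal (\<bar>norm (y::real^'n) powr (- (d * u)) * indicat_real {a..b} (norm y)\<bar> powr P) \<partial>lebesgue) =
    (\<integral>\<^sup>+y. ennreal (norm (y::real^'n) powr (- d)) * indicator {a..b} (norm y) \<partial>lebesgue)"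
    using 2(2) uP by (intro nn_integral_cong) (auto simp: indicator_def powr_powr)
  also have "\<dots> = ennreal (d * unit_ball_vol d * ln (b / a))"
    using nn_integral_powr_norm_annulus[where 'a="real^'n", of a b] ab d by (simp add: nn_integral_completion)
  finally show ?thesis
    using 2 uP pos by (simp add: Lp_norm_def ennreal_rpow_ennreal)
qed

lemma nn_integral_ge_annulus:
  fixes h :: "real^'n \<Rightarrow> real" and d a b B Q s :: real
  assumes d: "d = real CARD('n)" and ab: "0 < a" "a \<le> b" and "0 \<le> B" "0 < Q" "s * Q = d"
    and h: "\<And>x. a \<le> norm x \<Longrightarrow> norm x \<le> b \<Longrightarrow> B * norm x powr (- s) \<le> h x"
  shows "ennreal (B powr Q * (d * unit_ball_vol d * ln (b / a))) \<le> (\<integral>\<^sup>+x. ennreal (\<bar>h x\<bar> powr Q) \<partial>lebesgue)"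
proof -
  have "0 < d" using d by simp
  have "ennreal (B powr Q * (d * unit_ball_vol d * ln (b / a))) =
    ennreal (B powr Q) * (\<integral>\<^sup>+x. ennreal (norm (x::real^'n) powr (- d)) * indicator {a..b} (norm x) \<partial>lborel)"
    using nn_integral_powr_norm_annulus[where 'a="real^'n", of a b] ab d by (simp add: ennreal_mult')
  also have "\<dots> = (\<integral>\<^sup>+x. ennreal (B powr Q) * (ennreal (norm (x::real^'n) powr (- d)) * indicator {a..b} (norm x)) \<partial>lebesgue)"
    by (simp add: nn_integral_cmult nn_integral_completion)
  also have "\<dots> \<le> (\<integral>\<^sup>+x. ennreal (\<bar>h x\<bar> powr Q) \<partial>lebesgue)"
  proof (rule nn_integral_mono)
    fix x :: "real^'n"
    show "ennreal (B powr Q) * (ennreal (norm x powr (- d)) * indicator {a..b} (norm x)) \<le> ennreal (\<bar>h x\<bar> powr Q)"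
    proof (cases "a \<le> norm x \<and> norm x \<le> b")
      case True
      have "(B * norm x powr (- s)) powr Q \<le> \<bar>h x\<bar> powr Q"
        using h[of x] True assms(4,5) by (intro powr_mono2) auto
      also have "(B * norm x powr (- s)) powr Q = B powr Q * norm x powr (- d)"
        using assms(6) by (simp add: powr_mult powr_powr)
      finally show ?thesis
        using True by (simp add: ennreal_mult'[symmetric] ennreal_leI)
    qed (auto simp: indicator_def)
  qed
  finally show ?thesis .
qed

text \<open>For f = |y|^(-du) on 1 \<le> |y| \<le> R the norm is at most of order (ln R)^u, while
  the potential is at least of order |x|^(-2\<sigma> - du) = |x|^(-d/Q), whose L^Q norm on an
  annulus is of order the power 1/Q of a logarithm. The powers differ by 1/Q - u = 2\<sigma>/d >
  0.\<close>

lemma not_bounded_upper_edge: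
  fixes \<sigma> Q :: real
  assumes \<sigma>: "0 < \<sigma>" "\<sigma> < real CARD('n) / 2" and p: "1 \<le> p" and Q: "1 \<le> Q"
    and pQ: "1 / Q = enn2real (1 / p) + 2 * \<sigma> / real CARD('n)"
  shows "\<not> bounded_Lp_Lq (potential_operator \<sigma> :: (real^'n \<Rightarrow> real) \<Rightarrow> _) p (ennreal Q)"
proof
  assume "bounded_Lp_Lq (potential_operator \<sigma> :: (real^'n \<Rightarrow> real) \<Rightarrow> _) p (ennreal Q)"
  then obtain C where C: "0 < C" "\<And>f::real^'n \<Rightarrow> real. f \<in> Lp_space p \<Longrightarrow>
      Lp_norm (ennreal Q) (potential_operator \<sigma> f) \<le> ennreal C * Lp_norm p f"
    by (auto simp: bounded_Lp_Lq_def)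
  define d where "d = real CARD('n)"
  have d: "0 < d" by (simp add: d_def)
  define u where "u = enn2real (1 / p)"
  have u: "0 \<le> u" by (simp add: u_def)
  have Qu: "1 / Q = u + 2 * \<sigma> / d" using pQ by (simp add: u_def d_def)
  define \<omega> where "\<omega> = d * unit_ball_vol d"
  have \<omega>: "0 < \<omega>" using d by (simp add: \<omega>_def)
  obtain c where c: "0 < c" "\<And>(g::real^'n \<Rightarrow> real) M x \<rho> m. g \<in> borel_measurable borel \<Longrightarrow> (\<forall>y. 0 \<le> g y \<and> g y \<le> M) \<Longrightarrow>
    0 < \<rho> \<Longrightarrow> \<rho> \<le> 1 \<Longrightarrow> \<rho> * (2 * norm x + \<rho>) \<le> 3 \<Longrightarrow> 0 \<le> m \<Longrightarrow> (\<forall>y\<in>cball x \<rho>. m \<le> g y) \<Longrightarrow>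
    c * \<rho> powr (2 * \<sigma>) * m \<le> potential_operator \<sigma> g x"
    using potential_operator_ge_ball[OF \<sigma>] by blast
  \<comment> \<open>The factor 2^(-du) is the loss from |y| \<le> 2|x| on the ball about x.\<close>
  define B where "B = c * 2 powr (- (d * u))"
  have B: "0 < B" using c by (simp add: B_def)
  have "0 < 2 * \<sigma> / d" using \<sigma> d by simp
  then obtain L where L: "2 \<le> L" "C * (2 * \<omega>) powr u / (B * \<omega> powr (1 / Q)) < L powr (2 * \<sigma> / d)"
    using powr_unbounded by blast
  \<comment> \<open>The potential is estimated on 2 \<le> |x| \<le> 2 exp L, so that the ball of
    radius 1/|x| about x stays in the annulus 1 \<le> |y| \<le> R. The quotient of the radii for x
    is exp L, and ln R \<le> 2L.\<close>
  define R where "R = 4 * exp L"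
  have R: "4 < R" using L by (simp add: R_def)
  define f where "f = (\<lambda>y::real^'n. norm y powr (- (d * u)) * indicat_real {1..R} (norm y))"
  have fm [measurable]: "f \<in> borel_measurable borel"
    unfolding f_def by measurable
  have f01: "0 \<le> f y \<and> f y \<le> 1" for y
    using powr_mono2'[of "- (d * u)" 1 "norm y"] d u by (auto simp: f_def indicator_def)
  have lnR: "ln R \<le> 2 * L"
  proof -
    have "ln R = 2 * ln 2 + L"
      using ln_realpow[of 2 2] by (simp add: R_def ln_mult)
    moreover have "ln (2::real) \<le> 1"
      using ln_le_minus_one[of "2::real"] by simp
    ultimately show ?thesis using L by linarith
  qed
  have "(B powr Q * (\<omega> * ln ((2 * exp L) / 2))) powr (1 / Q) \<le> C * ((2 * \<omega> * L) powr u)"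
  proof (rule bounded_Lp_Lq_lower[OF C(2) C(1)])
    show "f \<in> borel_measurable lebesgue"
      using fm by (intro measurable_completion) simp
    have "Lp_norm p f \<le> ennreal ((\<omega> * ln (R / 1)) powr u)"
      unfolding f_def \<omega>_def using R by (intro Lp_norm_powr_annulus_le[OF p]) (auto simp: d_def u_def)
    also have "\<dots> \<le> ennreal ((2 * \<omega> * L) powr u)"
      using lnR R \<omega> u by (intro ennreal_leI powr_mono2) auto
    finally show "Lp_norm p f \<le> ennreal ((2 * \<omega> * L) powr u)" .
    show "ennreal (B powr Q * (\<omega> * ln ((2 * exp L) / 2))) \<le> (\<integral>\<^sup>+x. ennreal (\<bar>potential_operator \<sigma> f x\<bar> powr Q) \<partial>lebesgue)"
      unfolding \<omega>_def
    proof (rule nn_integral_ge_annulus[where s = "2 * \<sigma> + d * u"])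
      have "2 * \<sigma> + d * u = d * (1 / Q)"
        unfolding Qu using d by (simp add: distrib_left)
      then show "(2 * \<sigma> + d * u) * Q = d" using Q by simp
      show "2 \<le> 2 * exp L" using L by simp
      fix x :: "real^'n"
      assume x: "2 \<le> norm x" "norm x \<le> 2 * exp L"
      have nx: "0 < norm x" using x by linarith
      have "c * (1 / norm x) powr (2 * \<sigma>) * (2 * norm x) powr (- (d * u)) \<le> potential_operator \<sigma> f x"
      proof (rule c(2)[OF fm, where M = 1])
        have r: "1 / norm x \<le> 1" using x by (simp add: divide_le_eq)
        have "1 / norm x * (1 / norm x) \<le> 1 * 1"
          using r nx by (intro mult_mono) auto
        then show "1 / norm x * (2 * norm x + 1 / norm x) \<le> 3"
          using nx by (simp add: distrib_left)
        show "\<forall>y\<in>cball x (1 / norm x). (2 * norm x) powr (- (d * u)) \<le> f y"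
        proof
          fix y assume "y \<in> cball x (1 / norm x)"
          then have "norm (x - y) \<le> 1"
            using r by (simp add: dist_norm)
          then have y: "norm x - 1 \<le> norm y" "norm y \<le> norm x + 1"
            using norm_triangle_sub[of y x] norm_triangle_sub[of x y] by (auto simp: norm_minus_commute)
          have "(2 * norm x) powr (- (d * u)) \<le> norm y powr (- (d * u))"
            using x y d u by (intro powr_mono2') auto
          moreover have "1 \<le> norm y" "norm y \<le> R"
            using x y R by (auto simp: R_def)
          ultimately show "(2 * norm x) powr (- (d * u)) \<le> f y"
            by (simp add: f_def)
        qed
        show "1 / norm x \<le> 1" by (rule r)
      qed (use f01 nx in auto)
      moreover have "c * (1 / norm x) powr (2 * \<sigma>) * (2 * norm x) powr (- (d * u)) = B * norm x powr (- (2 * \<sigma> + d * u))"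
      proof -
        have "(1 / norm x) powr (2 * \<sigma>) = norm x powr (- (2 * \<sigma>))"
          by (simp add: powr_divide powr_minus_divide)
        then show ?thesis
          by (simp add: B_def powr_mult powr_diff powr_minus_divide)
      qed
      ultimately show "B * norm x powr (- (2 * \<sigma> + d * u)) \<le> potential_operator \<sigma> f x" by simp
    qed (use B Q in \<open>auto simp: d_def\<close>)
  qed (use Q L \<omega> B in auto)
  moreover have "(B powr Q * (\<omega> * ln ((2 * exp L) / 2))) powr (1 / Q) = (B * \<omega> powr (1 / Q)) * L powr (1 / Q)"
    using B Q by (simp add: powr_mult powr_powr)
  moreover have "(2 * \<omega> * L) powr u = (2 * \<omega>) powr u * L powr u"
    by (rule powr_mult)
  ultimately have "(B * \<omega> powr (1 / Q)) * L powr (1 / Q) \<le> C * (2 * \<omega>) powr u * L powr u"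
    by simp
  then have "L powr (1 / Q) / L powr u \<le> C * (2 * \<omega>) powr u / (B * \<omega> powr (1 / Q))"
    using L B \<omega> by (simp add: divide_simps mult.commute)
  then show False
    using L unfolding powr_diff[symmetric] Qu by simp
qed

text \<open>For |y| \<le> |x|/2 the distance |x - y| is at most 3|x|/2, and near the origin the
  product |x - y| |x + y| is small. Both argument orders are recorded: the larger point is the
  variable of the potential for data in L^1, and the variable of integration for the bound in
  L^\<infinity>.\<close>

lemma potential_kernel_ge_near_origin:
  fixes \<sigma> :: real
  assumes \<sigma>: "0 < \<sigma>" "\<sigma> < real CARD('n) / 2"
  shows "\<exists>c>0. \<forall>(x::real^'n) y. 2 * norm y \<le> norm x \<longrightarrow> 0 < norm x \<longrightarrow> norm x \<le> 1 / 2 \<longrightarrow>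
    c * norm x powr (2 * \<sigma> - real CARD('n)) \<le> potential_kernel \<sigma> x y \<and>
    c * norm x powr (2 * \<sigma> - real CARD('n)) \<le> potential_kernel \<sigma> y x"
proof -
  obtain c where c: "0 < c" "\<And>(x::real^'n) y. x \<noteq> y \<Longrightarrow> norm (x - y) \<le> 1 \<Longrightarrow> norm (x - y) * norm (x + y) \<le> 3 \<Longrightarrow>
    c * norm (x - y) powr (2 * \<sigma> - real CARD('n)) \<le> potential_kernel \<sigma> x y"
    using potential_kernel_lower[OF \<sigma>] by blast
  have "c * (3 / 2) powr (2 * \<sigma> - real CARD('n)) * norm x powr (2 * \<sigma> - real CARD('n)) \<le> potential_kernel \<sigma> x y \<and>
    c * (3 / 2) powr (2 * \<sigma> - real CARD('n)) * norm x powr (2 * \<sigma> - real CARD('n)) \<le> potential_kernel \<sigma> y x"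
    if xy: "2 * norm y \<le> norm x" "0 < norm x" "norm x \<le> 1 / 2" for x y :: "real^'n"
  proof -
    have n: "norm (x - y) \<le> 3 / 2 * norm x" "norm (x + y) \<le> 3 / 2 * norm x" "norm x / 2 \<le> norm (x - y)"
      using norm_triangle_ineq4[of x y] norm_triangle_ineq[of x y] norm_triangle_sub[of x y] xy by linarith+
    have ne: "x \<noteq> y" using xy by auto
    have "norm (x - y) * norm (x + y) \<le> 1 * 1"
      using n xy by (intro mult_mono) auto
    then have le: "norm (x - y) \<le> 1" "norm (x - y) * norm (x + y) \<le> 3"
      using n xy by linarith+
    have "c * norm (x - y) powr (2 * \<sigma> - real CARD('n)) \<le> potential_kernel \<sigma> x y"
      using ne le by (rule c(2))
    moreover have "c * norm (y - x) powr (2 * \<sigma> - real CARD('n)) \<le> potential_kernel \<sigma> y x"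
      using ne le by (intro c(2)) (simp_all add: norm_minus_commute add.commute)
    moreover have "(3 / 2 * norm x) powr (2 * \<sigma> - real CARD('n)) \<le> norm (x - y) powr (2 * \<sigma> - real CARD('n))"
      using n xy \<sigma> by (intro powr_mono2') auto
    then have "c * (3 / 2 * norm x) powr (2 * \<sigma> - real CARD('n)) \<le> c * norm (x - y) powr (2 * \<sigma> - real CARD('n))"
      using c(1) by (intro mult_left_mono) auto
    ultimately show ?thesis
      unfolding powr_mult norm_minus_commute[of y x] mult.assoc by linarith
  qed
  moreover have "0 < c * (3 / 2) powr (2 * \<sigma> - real CARD('n))" using c by simp
  ultimately show ?thesis by blast
qed

text \<open>The indicator of a small ball imitates a point mass: away from the ball its potential is
  at least c m |x|^(2\<sigma> - d) = c m |x|^(-d/Q), with m the L^1 norm. The mass cancels, and the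
  L^Q norm over an annulus grows at least like the power 1/Q of the logarithm L.\<close>

lemma not_bounded_from_L1:
  fixes \<sigma> Q :: real
  assumes \<sigma>: "0 < \<sigma>" "\<sigma> < real CARD('n) / 2" and Q: "1 \<le> Q" "1 / Q = 1 - 2 * \<sigma> / real CARD('n)"
  shows "\<not> bounded_Lp_Lq (potential_operator \<sigma> :: (real^'n \<Rightarrow> real) \<Rightarrow> _) 1 (ennreal Q)"
proof
  assume "bounded_Lp_Lq (potential_operator \<sigma> :: (real^'n \<Rightarrow> real) \<Rightarrow> _) 1 (ennreal Q)"
  then obtain C where C: "0 < C" "\<And>f::real^'n \<Rightarrow> real. f \<in> Lp_space 1 \<Longrightarrow>
      Lp_norm (ennreal Q) (potential_operator \<sigma> f) \<le> ennreal C * Lp_norm 1 f"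
    by (auto simp: bounded_Lp_Lq_def)
  define d where "d = real CARD('n)"
  have d: "0 < d" by (simp add: d_def)
  define \<omega> where "\<omega> = d * unit_ball_vol d"
  have \<omega>: "0 < \<omega>" using d by (simp add: \<omega>_def)
  obtain c where c: "0 < c" "\<And>(x::real^'n) y. 2 * norm y \<le> norm x \<Longrightarrow> 0 < norm x \<Longrightarrow> norm x \<le> 1 / 2 \<Longrightarrow>
    c * norm x powr (2 * \<sigma> - d) \<le> potential_kernel \<sigma> x y"
    using potential_kernel_ge_near_origin[OF \<sigma>] unfolding d_def by blast
  have "0 < 1 / Q" using Q(1) by simp
  then obtain L where L: "1 \<le> L" "C / (c * \<omega> powr (1 / Q)) < L powr (1 / Q)"
    using powr_unbounded by blast
  \<comment> \<open>Then the annulus 2r \<le> |x| \<le> 1/2 has the quotient of radii exp L.\<close>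
  define r where "r = 1 / (4 * exp L)"
  have r: "0 < r" "2 * r \<le> 1 / 2" "(1 / 2) / (2 * r) = exp L"
    using L by (auto simp: r_def divide_simps)
  define m where "m = measure lebesgue (cball 0 r :: (real^'n) set)"
  have m: "0 < m" "emeasure lborel (cball 0 r :: (real^'n) set) = ennreal m"
    using r d by (auto simp: m_def content_cball emeasure_cball d_def)
  define f where "f = indicat_real (cball 0 r :: (real^'n) set)"
  have fm: "f \<in> borel_measurable borel"
    unfolding f_def by (intro borel_measurable_indicator borel_closed closed_cball)
  have "((c * m) powr Q * (\<omega> * ln ((1 / 2) / (2 * r)))) powr (1 / Q) \<le> C * m"
  proof (rule bounded_Lp_Lq_lower[OF C(2) C(1)])
    show "f \<in> borel_measurable lebesgue"
      using fm by (intro measurable_completion) simp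
    have "Lp_norm (ennreal 1) f = ennreal (m powr (1 / 1))"
      unfolding f_def m_def by (intro Lp_norm_indicator) auto
    then show "Lp_norm 1 f \<le> ennreal m"
      using m by simp
    show "ennreal ((c * m) powr Q * (\<omega> * ln ((1 / 2) / (2 * r)))) \<le> (\<integral>\<^sup>+x. ennreal (\<bar>potential_operator \<sigma> f x\<bar> powr Q) \<partial>lebesgue)"
      unfolding \<omega>_def
    proof (rule nn_integral_ge_annulus[where s = "d - 2 * \<sigma>"])
      have "d - 2 * \<sigma> = d * (1 / Q)"
        unfolding Q(2) using d by (simp add: d_def right_diff_distrib)
      then show "(d - 2 * \<sigma>) * Q = d" using Q(1) by simp
      fix x :: "real^'n"
      assume x: "2 * r \<le> norm x" "norm x \<le> 1 / 2"
      have nx: "0 < norm x" using x r by linarith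
      have "ennreal (c * norm x powr (2 * \<sigma> - d) * m) = (\<integral>\<^sup>+y. ennreal (c * norm x powr (2 * \<sigma> - d)) * indicator (cball 0 r) (y::real^'n) \<partial>lborel)"
        using c(1) m by (subst nn_integral_cmult_indicator) (auto simp: ennreal_mult)
      also have "\<dots> \<le> (\<integral>\<^sup>+y. ennreal (potential_kernel \<sigma> x y * f y) \<partial>lborel)"
        using c(2) x nx by (intro nn_integral_mono) (auto simp: f_def indicator_def intro!: ennreal_leI)
      also have "\<dots> = ennreal (potential_operator \<sigma> f x)"
        using fm by (intro potential_operator_eq_nn_integral[OF \<sigma>(1), symmetric, where M = 1]) (auto simp: f_def indicator_def)
      finally have "c * norm x powr (2 * \<sigma> - d) * m \<le> potential_operator \<sigma> f x"
        using potential_operator_nonneg[OF \<sigma>(1), of f x] by (subst (asm) ennreal_le_iff) (auto simp: f_def)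
      then show "c * m * norm x powr (- (d - 2 * \<sigma>)) \<le> potential_operator \<sigma> f x"
        by (simp add: mult_ac)
    qed (use c m r Q(1) in \<open>auto simp: d_def\<close>)
  qed (use Q(1) c m r L \<omega> in auto)
  moreover have "((c * m) powr Q * (\<omega> * ln ((1 / 2) / (2 * r)))) powr (1 / Q) = m * ((c * \<omega> powr (1 / Q)) * L powr (1 / Q))"
    unfolding r(3) using c m Q(1) by (simp add: powr_mult powr_powr)
  ultimately have "m * ((c * \<omega> powr (1 / Q)) * L powr (1 / Q)) \<le> m * C"
    by (simp only: mult.commute)
  then have "(c * \<omega> powr (1 / Q)) * L powr (1 / Q) \<le> C"
    using m(1) by simp
  then have "L powr (1 / Q) \<le> C / (c * \<omega> powr (1 / Q))"
    using c \<omega> by (simp add: divide_simps mult.commute)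
  then show False using L by simp
qed

text \<open>For f = |y|^(-2\<sigma>) on \<rho> \<le> |y| \<le> 1/2 the kernel turns the integrand
  near the origin into |y|^(-d), so the potential is at least of order L = ln(1/(2\<rho>)), whereas
  the norm of f is at most of order L^(2\<sigma>/d), and 2\<sigma>/d < 1.\<close>

lemma not_weak_type_to_Linfinity:
  fixes \<sigma> P :: real
  assumes \<sigma>: "0 < \<sigma>" "\<sigma> < real CARD('n) / 2" and P: "1 \<le> P" "1 / P = 2 * \<sigma> / real CARD('n)"
  shows "\<not> weak_type (potential_operator \<sigma> :: (real^'n \<Rightarrow> real) \<Rightarrow> _) (ennreal P) \<infinity>"
proof
  assume "weak_type (potential_operator \<sigma> :: (real^'n \<Rightarrow> real) \<Rightarrow> _) (ennreal P) \<infinity>"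
  then obtain C where C: "0 < C" "\<And>f::real^'n \<Rightarrow> real. f \<in> Lp_space (ennreal P) \<Longrightarrow> weak_type_bound C (potential_operator \<sigma>) (ennreal P) \<infinity> f"
    by (auto simp: weak_type_def)
  define d where "d = real CARD('n)"
  have d: "0 < d" by (simp add: d_def)
  define \<omega> where "\<omega> = d * unit_ball_vol d"
  have \<omega>: "0 < \<omega>" using d by (simp add: \<omega>_def)
  define u where "u = enn2real (1 / ennreal P)"
  have u: "u = 1 / P"
    using P(1) by (simp add: u_def divide_ennreal ennreal_1[symmetric] del: ennreal_1)
  have du: "d * u = 2 * \<sigma>"
    unfolding u P(2) using d by (simp add: d_def)
  have "u < 1"
    unfolding u P(2) using \<sigma> by simp
  obtain c where c: "0 < c" "\<And>(x::real^'n) y. 2 * norm y \<le> norm x \<Longrightarrow> 0 < norm x \<Longrightarrow> norm x \<le> 1 / 2 \<Longrightarrow>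
    c * norm x powr (2 * \<sigma> - d) \<le> potential_kernel \<sigma> y x"
    using potential_kernel_ge_near_origin[OF \<sigma>] unfolding d_def by blast
  have "0 < 1 - u" using \<open>u < 1\<close> by simp
  then obtain L where L: "1 \<le> L" "2 * max C 1 * \<omega> powr u / (c * \<omega>) < L powr (1 - u)"
    using powr_unbounded by blast
  define \<rho> where "\<rho> = 1 / (2 * exp L)"
  have \<rho>: "0 < \<rho>" "\<rho> < 1 / 2" "(1 / 2) / \<rho> = exp L"
    using L by (auto simp: \<rho>_def divide_simps)
  define f where "f = (\<lambda>y::real^'n. norm y powr (- (d * u)) * indicat_real {\<rho>..1/2} (norm y))"
  have fm [measurable]: "f \<in> borel_measurable borel"
    unfolding f_def by measurable
  have fl [measurable]: "f \<in> borel_measurable lebesgue"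
    using fm by (intro measurable_completion) simp
  have f0: "0 \<le> f y" and fM: "f y \<le> \<rho> powr (- (d * u))" for y
    using powr_mono2'[of "- (d * u)" \<rho> "norm y"] \<sigma> \<rho> du by (auto simp: f_def indicator_def)
  have "Lp_norm (ennreal P) f \<le> ennreal ((\<omega> * ln ((1 / 2) / \<rho>)) powr u)"
    unfolding f_def \<omega>_def using \<rho> P(1) by (intro Lp_norm_powr_annulus_le) (auto simp: d_def u_def)
  then have norm_f: "Lp_norm (ennreal P) f \<le> ennreal ((\<omega> * L) powr u)"
    unfolding \<rho>(3) by simp
  have "f \<in> Lp_space (ennreal P)"
    using norm_f by (auto simp: Lp_space_def fl intro: le_less_trans)
  \<comment> \<open>The lower bound is uniform on a ball of radius \<rho>/2, a set of positive
    measure, as the essential supremum requires. Its volume enters with the exponent 0 that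
    \<open>1 / \<infinity>\<close> stands for.\<close>
  have "(c * (\<omega> * L)) * (unit_ball_vol d * (\<rho> / 2) ^ CARD('n)) powr enn2real (1 / \<infinity>) \<le> 2 * max C 1 * (\<omega> * L) powr u"
  proof (rule weak_type_bound_lower[OF C(2) C(1) _ norm_f])
    show "potential_operator \<sigma> f \<in> borel_measurable lebesgue"
      by (rule potential_operator_measurable) fact
    show "cball 0 (\<rho> / 2) \<in> sets lebesgue" by simp
    show "ennreal (unit_ball_vol d * (\<rho> / 2) ^ CARD('n)) \<le> emeasure lebesgue (cball 0 (\<rho> / 2) :: (real^'n) set)"
      using \<rho> by (simp add: emeasure_cball d_def)
    fix x :: "real^'n"
    assume "x \<in> cball 0 (\<rho> / 2)"
    then have x: "norm x \<le> \<rho> / 2" by simp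
    have "ennreal (c * (\<omega> * L)) = ennreal c * (\<integral>\<^sup>+y. ennreal (norm (y::real^'n) powr (- d)) * indicator {\<rho>..1/2} (norm y) \<partial>lborel)"
      using nn_integral_powr_norm_annulus[where 'a="real^'n", of \<rho> "1/2"] \<rho> c
      unfolding \<rho>(3) by (simp add: ennreal_mult' \<omega>_def d_def)
    also have "\<dots> = (\<integral>\<^sup>+y. ennreal c * (ennreal (norm (y::real^'n) powr (- d)) * indicator {\<rho>..1/2} (norm y)) \<partial>lborel)"
      by (rule nn_integral_cmult[symmetric]) measurable
    also have "\<dots> \<le> (\<integral>\<^sup>+y. ennreal (potential_kernel \<sigma> x y * f y) \<partial>lborel)"
    proof (rule nn_integral_mono)
      fix y :: "real^'n"
      show "ennreal c * (ennreal (norm y powr (- d)) * indicator {\<rho>..1/2} (norm y)) \<le> ennreal (potential_kernel \<sigma> x y * f y)"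
      proof (cases "\<rho> \<le> norm y \<and> norm y \<le> 1 / 2")
        case True
        have "c * norm y powr (2 * \<sigma> - d) \<le> potential_kernel \<sigma> x y"
          using x True \<rho> by (intro c(2)) auto
        then have "c * norm y powr (2 * \<sigma> - d) * norm y powr (- (d * u)) \<le> potential_kernel \<sigma> x y * norm y powr (- (d * u))"
          by (rule mult_right_mono) simp
        moreover have "norm y powr (2 * \<sigma> - d) * norm y powr (- (d * u)) = norm y powr (- d)"
          unfolding powr_add[symmetric] du by simp
        ultimately show ?thesis
          using True c(1) by (simp add: f_def ennreal_mult[symmetric] ennreal_leI mult.assoc)
      qed (auto simp: indicator_def)
    qed
    also have "\<dots> = ennreal (potential_operator \<sigma> f x)"
      using f0 fM by (intro potential_operator_eq_nn_integral[OF \<sigma>(1) fm, symmetric])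
    finally have "c * (\<omega> * L) \<le> potential_operator \<sigma> f x"
      using potential_operator_nonneg[OF \<sigma>(1), of f x] f0 by (subst (asm) ennreal_le_iff) auto
    then show "c * (\<omega> * L) \<le> \<bar>potential_operator \<sigma> f x\<bar>" by linarith
  qed (use \<omega> L c \<rho> d \<open>f \<in> Lp_space (ennreal P)\<close> in auto)
  moreover have "unit_ball_vol d \<noteq> 0" "\<rho> \<noteq> 0" using unit_ball_vol_pos[of d] d \<rho> by linarith+
  ultimately have "(c * \<omega>) * L \<le> 2 * max C 1 * \<omega> powr u * L powr u"
    by (simp add: powr_mult mult.assoc)
  then have "L powr 1 / L powr u \<le> 2 * max C 1 * \<omega> powr u / (c * \<omega>)"
    using L c \<omega> by (simp add: divide_simps mult.commute)
  then show False
    using L unfolding powr_diff[symmetric] by simp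
qed


section \<open>The boundedness region\<close>

lemma bounded_Lp_Lq_imp_weak_type:
  fixes T :: "(real^'n \<Rightarrow> real) \<Rightarrow> real^'n \<Rightarrow> real"
  assumes q: "1 \<le> q" and "bounded_Lp_Lq T p q"
  shows "weak_type T p q"
proof -
  obtain C where C: "0 < C" "\<And>f. f \<in> Lp_space p \<Longrightarrow> T f \<in> Lp_space q \<and> Lp_norm q (T f) \<le> ennreal C * Lp_norm p f"
    using assms(2) by (auto simp: bounded_Lp_Lq_def)
  show ?thesis
    using q
  proof (cases rule: ennreal_ge_1_cases)
    case 1
    then show ?thesis
      using C unfolding weak_type_def weak_type_bound_def by (intro exI[of _ C]) auto
  next
    case (2 Q)
    have "emeasure lebesgue {x. \<bar>T f x\<bar> > s} \<le> ennreal (C powr Q) * ennreal_rpow (Lp_norm p f / ennreal s) Q"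
      if f: "f \<in> Lp_space p" and s: "0 < s" for f and s :: real
    proof -
      have [measurable]: "T f \<in> borel_measurable lebesgue"
        using C(2)[OF f] by (simp add: Lp_space_def)
      obtain \<nu> where \<nu>: "0 \<le> \<nu>" "Lp_norm p f = ennreal \<nu>"
        using f by (cases "Lp_norm p f") (auto simp: Lp_space_def)
      define A where "A = (\<integral>\<^sup>+x. ennreal (\<bar>T f x\<bar> powr Q) \<partial>lebesgue)"
      have "ennreal_rpow A (1 / Q) \<le> ennreal (C * \<nu>)"
        using C(2)[OF f] 2 \<nu> C(1) by (simp add: Lp_norm_def A_def ennreal_mult)
      then have "A \<noteq> \<infinity>" "enn2real A powr (1 / Q) \<le> C * \<nu>"
        using C(1) \<nu> by (auto simp: ennreal_rpow_def top_unique split: if_splits)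
      then have A: "A = ennreal (enn2real A)" "(enn2real A powr (1 / Q)) powr Q \<le> (C * \<nu>) powr Q"
        using 2 by (auto intro!: powr_mono2 simp: ennreal_enn2real_if)
      then have A': "A \<le> ennreal ((C * \<nu>) powr Q)"
      proof -
        have "enn2real A \<le> (C * \<nu>) powr Q"
          using A(2) 2(2) by (simp add: powr_powr)
        then show ?thesis
          using A(1) ennreal_leI by metis
      qed
      have "{x \<in> space lebesgue. \<bar>T f x\<bar> > s} \<in> sets lebesgue"
        by measurable
      then have m: "{x. \<bar>T f x\<bar> > s} \<in> sets lebesgue" by simp
      have "emeasure lebesgue {x. \<bar>T f x\<bar> > s} = (\<integral>\<^sup>+x. indicator {x. \<bar>T f x\<bar> > s} x \<partial>lebesgue)"
        using m by simp
      also have "\<dots> \<le> (\<integral>\<^sup>+x. ennreal (s powr (- Q)) * ennreal (\<bar>T f x\<bar> powr Q) \<partial>lebesgue)"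
      proof (rule nn_integral_mono)
        fix x
        show "indicator {x. \<bar>T f x\<bar> > s} x \<le> ennreal (s powr (- Q)) * ennreal (\<bar>T f x\<bar> powr Q)"
        proof (cases "\<bar>T f x\<bar> > s")
          case True
          then have "s powr Q \<le> \<bar>T f x\<bar> powr Q"
            using s 2 by (intro powr_mono2) auto
          then have "1 \<le> s powr (- Q) * \<bar>T f x\<bar> powr Q"
            using s by (simp add: powr_minus field_simps)
          then show ?thesis
            using True by (simp add: ennreal_mult[symmetric])
        qed simp
      qed
      also have "\<dots> = ennreal (s powr (- Q)) * A"
        unfolding A_def by (rule nn_integral_cmult) measurable
      also have "\<dots> \<le> ennreal (s powr (- Q)) * ennreal ((C * \<nu>) powr Q)"
        by (rule mult_left_mono[OF A']) simp
      also have "\<dots> = ennreal (C powr Q) * ennreal_rpow (Lp_norm p f / ennreal s) Q"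
        using s \<nu> by (simp add: divide_ennreal ennreal_rpow_ennreal ennreal_mult[symmetric] powr_mult powr_divide powr_minus_divide)
      finally show ?thesis .
    qed
    then show ?thesis
      using 2 C(1) unfolding weak_type_def weak_type_bound_def by (intro exI[of _ "C powr Q"]) auto
  qed
qed

lemma indicator_in_Lp_space:
  assumes "1 \<le> p" "E \<in> lmeasurable"
  shows "indicat_real E \<in> (Lp_space p :: (real^'n \<Rightarrow> real) set)"
proof -
  have m [measurable]: "E \<in> sets lebesgue" using assms(2) by (rule fmeasurableD)
  have "Lp_norm p (indicat_real E :: real^'n \<Rightarrow> real) < \<infinity>"
    using assms(1)
  proof (cases rule: ennreal_ge_1_cases)
    case 1
    have "esssup lebesgue (\<lambda>x. ennreal \<bar>indicat_real E x\<bar>) \<le> 1"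
    proof (rule esssup_I)
      show "(\<lambda>x. ennreal \<bar>indicat_real E x\<bar>) \<in> borel_measurable lebesgue"
        by measurable
    qed (auto simp: indicator_def)
    also have "(1::ennreal) < \<infinity>" by simp
    finally show ?thesis
      by (simp add: 1(1) Lp_norm_def)
  next
    case (2 P)
    then show ?thesis
      using assms(2) by (simp add: Lp_norm_indicator)
  qed
  then show ?thesis
    by (simp add: Lp_space_def)
qed

lemma weak_type_imp_restricted_weak_type:
  assumes "1 \<le> p" "weak_type T p q"
  shows "restricted_weak_type T p q"
  using assms indicator_in_Lp_space unfolding weak_type_def restricted_weak_type_def by blast

text \<open>The segment from (u, v) to (1/2, 1/2) is followed: by convexity all six inequalities are
  strict after any step t > 0, and a point with strict inequalities is not one of the removed
  ones.\<close>

lemma in_closure_boundedness_region: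
  fixes u v d \<sigma> :: real
  assumes "0 < \<sigma>" "0 < d" and uv: "0 \<le> u" "u \<le> 1" "0 \<le> v" "v \<le> 1" "u - 2 * \<sigma> / d \<le> v" "v \<le> u + 2 * \<sigma> / d"
  shows "(u, v) \<in> closure (boundedness_region d \<sigma>)"
proof -
  define \<alpha> where "\<alpha> = 2 * \<sigma> / d"
  have \<alpha>: "0 < \<alpha>" using assms by (simp add: \<alpha>_def)
  define x where "x = (\<lambda>n. (u + (1 / 2 - u) * inverse (real (Suc n)), v + (1 / 2 - v) * inverse (real (Suc n))))"
  have "x n \<in> boundedness_region d \<sigma>" for n
  proof -
    define t where "t = inverse (real (Suc n))"
    have t: "0 < t" "t \<le> 1" by (auto simp: t_def inverse_eq_divide)
    have d: "u - v \<le> \<alpha>" "v - u \<le> \<alpha>" and t1: "0 \<le> 1 - t"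
      using uv t by (simp_all add: \<alpha>_def)
    have "0 \<le> (1 - t) * u" "0 \<le> (1 - t) * v"
      using uv t1 by simp_all
    moreover note mult_left_mono[OF uv(2) t1] mult_left_mono[OF uv(4) t1] mult_left_mono[OF d(1) t1] mult_left_mono[OF d(2) t1]
      mult_pos_pos[OF t(1) \<alpha>]
    ultimately have "0 < u + (1 / 2 - u) * t" "u + (1 / 2 - u) * t < 1" "0 < v + (1 / 2 - v) * t" "v + (1 / 2 - v) * t < 1"
      "(u + (1 / 2 - u) * t) - (v + (1 / 2 - v) * t) < \<alpha>" "(v + (1 / 2 - v) * t) - (u + (1 / 2 - u) * t) < \<alpha>"
      using t by (auto simp: algebra_simps)
    then show ?thesis
      unfolding x_def boundedness_region_def t_def[symmetric] \<alpha>_def[symmetric] by auto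
  qed
  moreover have "x \<longlonglongrightarrow> (u + (1 / 2 - u) * 0, v + (1 / 2 - v) * 0)"
    unfolding x_def by (intro tendsto_intros LIMSEQ_inverse_real_of_nat)
  ultimately show ?thesis
    unfolding closure_sequential by auto
qed

lemma reciprocal_ennreal_bounds:
  assumes "1 \<le> (p::ennreal)"
  shows "0 \<le> enn2real (1 / p)" "enn2real (1 / p) \<le> 1"
  using assms by (cases rule: ennreal_ge_1_cases; simp)+

lemma bounded_if_in_region:
  fixes \<sigma> :: real
  assumes \<sigma>: "0 < \<sigma>" "\<sigma> < real CARD('n) / 2" and p: "1 \<le> p" and q: "1 \<le> q"
    and R: "reciprocal_pair p q \<in> boundedness_region (real CARD('n)) \<sigma>"
  shows "bounded_Lp_Lq (potential_operator \<sigma> :: (real^'n \<Rightarrow> real) \<Rightarrow> _) p q"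
proof -
  define \<alpha> where "\<alpha> = 2 * \<sigma> / real CARD('n)"
  have \<alpha>: "0 < \<alpha>" "\<alpha> < 1" using \<sigma> by (auto simp: \<alpha>_def)
  define u where "u = enn2real (1 / p)"
  define v where "v = enn2real (1 / q)"
  have uv: "u - \<alpha> \<le> v" "v \<le> 1" "v \<le> u + \<alpha>" "u \<le> 1 - \<alpha> \<Longrightarrow> v \<noteq> u + \<alpha>" "u = \<alpha> \<Longrightarrow> v \<noteq> 0" "u = 1 \<Longrightarrow> v \<noteq> 1 - \<alpha>"
    using R p q unfolding boundedness_region_def reciprocal_pair_def u_def[symmetric] v_def[symmetric] \<alpha>_def[symmetric]
    by (auto simp: u_def reciprocal_ennreal_bounds)
  \<comment> \<open>For u \<le> 1 - \<alpha> the upper edge is removed from the region; beyond, v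
    \<le> 1 < u + \<alpha>.\<close>
  then have lt: "v < u + \<alpha>" by linarith
  show ?thesis
    using p
  proof (cases rule: ennreal_ge_1_cases)
    case p: 1
    show ?thesis
      using q
    proof (cases rule: ennreal_ge_1_cases)
      case q: 1
      show ?thesis
        unfolding p(1) q(1) by (rule bounded_Linfinity_Linfinity[OF \<sigma>])
    next
      case q: (2 Q)
      show ?thesis
        unfolding p(1) q(1) using lt p(2) q(2,3)
        by (intro bounded_from_Linfinity[OF \<sigma>]) (auto simp: u_def v_def \<alpha>_def)
    qed
  next
    case p: (2 P)
    show ?thesis
      using q
    proof (cases rule: ennreal_ge_1_cases)
      case q: 1
      \<comment> \<open>The lower edge gives u \<le> \<alpha> at v = 0, and the point (\<alpha>, 0)
        is removed.\<close>
      have "u < \<alpha>"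
      proof -
        have "v = 0" using q(2) by (simp add: v_def)
        with uv(1,5) show ?thesis by force
      qed
      then show ?thesis
        unfolding p(1) q(1) using p(2,3) by (intro bounded_to_Linfinity[OF \<sigma>]) (auto simp: u_def \<alpha>_def)
    next
      case q: (2 Q)
      show ?thesis
      proof (cases "u \<le> v")
        case True
        then show ?thesis
          unfolding p(1) q(1) using p(2,3) q(2,3) lt
          by (intro bounded_above_diagonal[OF \<sigma>]) (auto simp: u_def v_def \<alpha>_def)
      next
        case False
        then have PQ: "P < Q"
          using p(2,3) q(2,3) by (simp add: u_def v_def field_simps)
        show ?thesis
        proof (cases "u - \<alpha> < v")
          case True
          then show ?thesis
            unfolding p(1) q(1) using p(2,3) q(2,3) PQ
            by (intro bounded_below_diagonal[OF \<sigma>]) (auto simp: u_def v_def \<alpha>_def)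
        next
          case False
          then have v: "v = u - \<alpha>" using uv(1) by simp
          \<comment> \<open>On the lower edge P = 1 would be the removed point (1, 1 - \<alpha>), so
            the Hardy-Littlewood-Sobolev case has 1 < P.\<close>
          then have "P \<noteq> 1" using uv(6) p(3) by (auto simp: u_def)
          then show ?thesis
            unfolding p(1) q(1) using p(2,3) q(2,3) v
            by (intro bounded_hardy_littlewood_sobolev[OF \<sigma>]) (auto simp: u_def v_def \<alpha>_def)
        qed
      qed
    qed
  qed
qed

text \<open>Strong type implies restricted weak type, which confines (u, v) to the closed region.
  What is left are the removed boundary pieces, each with its own counterexample.\<close>

lemma in_region_if_bounded:
  fixes \<sigma> :: real
  assumes \<sigma>: "0 < \<sigma>" "\<sigma> < real CARD('n) / 2" and p: "1 \<le> p" and q: "1 \<le> q"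
    and bounded: "bounded_Lp_Lq (potential_operator \<sigma> :: (real^'n \<Rightarrow> real) \<Rightarrow> _) p q"
  shows "reciprocal_pair p q \<in> boundedness_region (real CARD('n)) \<sigma>"
proof -
  define \<alpha> where "\<alpha> = 2 * \<sigma> / real CARD('n)"
  have \<alpha>: "0 < \<alpha>" "\<alpha> < 1" using \<sigma> by (auto simp: \<alpha>_def)
  define u where "u = enn2real (1 / p)"
  define v where "v = enn2real (1 / q)"
  have uv: "0 \<le> u" "u \<le> 1" "0 \<le> v" "v \<le> 1"
    unfolding u_def v_def using reciprocal_ennreal_bounds p q by auto
  note weak = bounded_Lp_Lq_imp_weak_type[OF q bounded]
  have edge: "u - \<alpha> \<le> v" "v \<le> u + \<alpha>"
    using restricted_weak_type_necessary[OF \<sigma> p q weak_type_imp_restricted_weak_type[OF p weak]]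
    by (simp_all add: u_def v_def \<alpha>_def)
  \<comment> \<open>The whole line may be excluded, not only the removed segment: for u > 1 -
    \<alpha> it lies above v = 1.\<close>
  have "v \<noteq> u + \<alpha>"
  proof
    assume eq: "v = u + \<alpha>"
    show False
      using q
    proof (cases rule: ennreal_ge_1_cases)
      case 1
      then show ?thesis using eq uv(1) \<alpha> by (simp add: v_def)
    next
      case (2 Q)
      have "1 / Q = enn2real (1 / p) + 2 * \<sigma> / real CARD('n)"
        using eq 2(3) by (simp add: u_def v_def \<alpha>_def)
      from not_bounded_upper_edge[OF \<sigma> p 2(2) this] bounded show ?thesis
        unfolding 2(1) by simp
    qed
  qed
  moreover have "\<not> (u = \<alpha> \<and> v = 0)"
  proof
    assume eq: "u = \<alpha> \<and> v = 0"
    have q': "q = \<infinity>"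
      using q by (cases rule: ennreal_ge_1_cases) (use eq in \<open>auto simp: v_def\<close>)
    show False
      using p
    proof (cases rule: ennreal_ge_1_cases)
      case 1
      then show ?thesis using eq \<alpha> by (simp add: u_def)
    next
      case (2 P)
      have "1 / P = 2 * \<sigma> / real CARD('n)"
        using eq 2(3) by (simp add: u_def \<alpha>_def)
      from not_weak_type_to_Linfinity[OF \<sigma> 2(2) this] weak show ?thesis
        unfolding 2(1) q' by simp
    qed
  qed
  moreover have "\<not> (u = 1 \<and> v = 1 - \<alpha>)"
  proof
    assume eq: "u = 1 \<and> v = 1 - \<alpha>"
    have p': "p = 1"
      using p by (cases rule: ennreal_ge_1_cases) (use eq in \<open>auto simp: u_def\<close>)
    show False
      using q
    proof (cases rule: ennreal_ge_1_cases)
      case 1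
      then show ?thesis using eq \<alpha> by (simp add: v_def)
    next
      case (2 Q)
      have "1 / Q = 1 - 2 * \<sigma> / real CARD('n)"
        using eq 2(3) by (simp add: v_def \<alpha>_def)
      from not_bounded_from_L1[OF \<sigma> 2(2) this] bounded show ?thesis
        unfolding 2(1) p' by simp
    qed
  qed
  ultimately show ?thesis
    unfolding boundedness_region_def reciprocal_pair_def u_def[symmetric] v_def[symmetric] \<alpha>_def[symmetric]
    using uv edge by auto
qed

theorem theorem3p1:
  fixes \<sigma> d :: real and p q :: ennreal
    and I :: "(real^'n \<Rightarrow> real) \<Rightarrow> real^'n \<Rightarrow> real"
  defines "d \<equiv> real CARD('n)" and "I \<equiv> potential_operator \<sigma>"
  assumes "0 < \<sigma>" and "\<sigma> < d / 2" and "1 \<le> p" and "1 \<le> q"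
  shows "(bounded_Lp_Lq I p q \<longleftrightarrow> reciprocal_pair p q \<in> boundedness_region d \<sigma>) \<and>
         (reciprocal_pair p q \<notin> closure (boundedness_region d \<sigma>) \<longrightarrow>
            \<not> restricted_weak_type I p q) \<and>
         (reciprocal_pair p q \<in> {(0, 2 * \<sigma> / d), (1, 1 - 2 * \<sigma> / d)} \<longrightarrow>
            weak_type I p q) \<and>
         (reciprocal_pair p q = (2 * \<sigma> / d, 0) \<longrightarrow>
            restricted_weak_type I p q \<and> \<not> weak_type I p q)"
proof -
  note \<sigma> = assms(3) assms(4)[unfolded d_def]
  note p = assms(5) and q = assms(6)
  have d: "0 < d" by (simp add: d_def)
  have \<alpha>: "0 < 2 * \<sigma> / d" "2 * \<sigma> / d < 1"
    using assms(3,4) d by auto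
  define u where "u = enn2real (1 / p)"
  define v where "v = enn2real (1 / q)"
  have uv: "0 \<le> u" "u \<le> 1" "0 \<le> v" "v \<le> 1"
    unfolding u_def v_def using reciprocal_ennreal_bounds p q by auto
  have rp: "reciprocal_pair p q = (u, v)"
    by (simp add: reciprocal_pair_def u_def v_def)
  have 1: "bounded_Lp_Lq I p q \<longleftrightarrow> reciprocal_pair p q \<in> boundedness_region d \<sigma>"
    unfolding I_def d_def using bounded_if_in_region[OF \<sigma> p q] in_region_if_bounded[OF \<sigma> p q] by blast
  \<comment> \<open>By contraposition: restricted weak type gives the closed inequalities, and every
    point satisfying them is a limit of points of the region.\<close>
  have 2: "\<not> restricted_weak_type I p q" if "reciprocal_pair p q \<notin> closure (boundedness_region d \<sigma>)"
  proof
    assume "restricted_weak_type I p q"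
    then have "u - 2 * \<sigma> / d \<le> v" "v \<le> u + 2 * \<sigma> / d"
      using restricted_weak_type_necessary[OF \<sigma> p q] by (simp_all add: I_def d_def u_def v_def)
    then show False
      using that in_closure_boundedness_region[OF \<sigma>(1) d uv] by (simp add: rp)
  qed
  \<comment> \<open>The first coordinate 0 forces p = \<infinity>, and v > 0 makes q finite; the
    other end points are decoded in the same way.\<close>
  have 3: "weak_type I p q" if "u = 0" "v = 2 * \<sigma> / d"
  proof -
    have p': "p = \<infinity>"
      using p by (cases rule: ennreal_ge_1_cases) (use that in \<open>auto simp: u_def\<close>)
    show ?thesis
      using q
    proof (cases rule: ennreal_ge_1_cases)
      case 1
      then show ?thesis using that(2) \<alpha> unfolding v_def by linarith
    next
      case (2 Q)
      have "1 / Q = 2 * \<sigma> / real CARD('n)"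
        using that(2) 2(3) by (simp add: v_def d_def)
      then show ?thesis
        unfolding I_def p' 2(1) using 2(2) by (intro weak_type_from_Linfinity[OF \<sigma>]) auto
    qed
  qed
  have 4: "weak_type I p q" if "u = 1" "v = 1 - 2 * \<sigma> / d"
  proof -
    have p': "p = 1"
      using p by (cases rule: ennreal_ge_1_cases) (use that in \<open>auto simp: u_def\<close>)
    show ?thesis
      using q
    proof (cases rule: ennreal_ge_1_cases)
      case 1
      then show ?thesis using that(2) \<alpha> unfolding v_def by linarith
    next
      case (2 Q)
      have "1 / Q = 1 - 2 * \<sigma> / real CARD('n)"
        using that(2) 2(3) by (simp add: v_def d_def)
      then show ?thesis
        unfolding I_def p' 2(1) using 2(2) by (intro weak_type_from_L1[OF \<sigma>]) auto
    qed
  qed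
  have 5: "restricted_weak_type I p q \<and> \<not> weak_type I p q" if "u = 2 * \<sigma> / d" "v = 0"
  proof -
    have q': "q = \<infinity>"
      using q by (cases rule: ennreal_ge_1_cases) (use that in \<open>auto simp: v_def\<close>)
    show ?thesis
      using p
    proof (cases rule: ennreal_ge_1_cases)
      case 1
      then show ?thesis using that(1) \<alpha> unfolding u_def by linarith
    next
      case (2 P)
      have "1 / P = 2 * \<sigma> / real CARD('n)"
        using that(1) 2(3) by (simp add: u_def d_def)
      then show ?thesis
        unfolding I_def q' 2(1) using 2(2)
        by (intro conjI restricted_weak_type_to_Linfinity[OF \<sigma>] not_weak_type_to_Linfinity[OF \<sigma>]) auto
    qed
  qed
  show ?thesis
    using 1 2 3 4 5 by (auto simp: rp)
qed

end
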